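(* Let $T$ be the complete continuous first-order theory of Tsirelson's space $M_{\mathcal T}$ (in a countable language). Then: (i) $T$ is not $\aleph_0$-categorical. (ii) There exists a separable model $M$ of $T$ whose type space is not strongly separable.
   Context: **Tsirelson's space.** Let $c_{00}$ be the space of finitely supported real sequences. For finite sets $E,F\subseteq\mathbb N$, $E<F$ means $\max E<\min F$, and $n\leqslant E$ means $n\leqslant\min E$. A family $(E_i)_{i=1}^n$ of finite subsets of $\mathbb N$ is admissible if $n\leqslant E_1<E_2<\cdots<E_n$. $Ex$ is the restriction of $x$ to $E$ (equal to $x(k)$ for $k\in E$, $0$ otherwise). Put $\|x\|_0=\|x\|_\infty$ and $\|x\|_{n+1}=\max\big(\|x\|_n,\ \sup\{\frac12\sum_{i=1}^k\|E_ix\|_n : k\geqslant 1,\ (E_i)_{i=1}^k \text{ admissible}\}\big)$, and $\|x\|=\lim_n\|x\|_n$. Then $M_{\mathcal T}$ is the completion of $(c_{00},\|\cdot\|)$. Banach spaces are regarded as structures of continuous logic by means of their unit balls, in a countable language containing the language of Banach spaces; elements $a,b\in M$ below range over the unit ball. A complete theory in a countable language is $\aleph_0$-categorical if it has an infinite model and any two separable models are isomorphic (isometric as structures). Let $\phi(x,y)=\|x+y\|$. $S_\phi(M)$ is the space of complete $\phi$-types over $M$; it can be identified with the closure in $[0,2]^{M}$ (product topology) of the set of functions $f_b:M\to[0,2]$, $f_b(x)=\|x+b\|$, $b\in M$, and $\phi(p,a)$ is the value of the type $p$ at $a$. The type space of $M$ is strongly separable if $S_\phi(M)$ is separable with respect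 to the metric $\rho(p,q)=\sup_{a\in M,\ \|a\|\leqslant 1}|\phi(p,a)-\phi(q,a)|$. *)

theory Defs
  imports "HOL-Analysis.Analysis"
begin

section \<open>Continuous first-order logic\<close>

text \<open>
  One-sorted metric signatures in the style of Ben Yaacov, Berenstein, Henson and Usvyatsov: every
  symbol comes with an arity and a modulus of uniform continuity, every predicate symbol with a
  compact interval of values, and the sort with a bound on the diameter. Constants are function
  symbols of arity 0.
\<close>

record ('f, 'p) metric_language =
  Funs :: "'f set"
  Fun_arity :: "'f \<Rightarrow> nat"
  Fun_modulus :: "'f \<Rightarrow> real \<Rightarrow> real"
  Preds :: "'p set"
  Pred_arity :: "'p \<Rightarrow> nat"
  Pred_modulus :: "'p \<Rightarrow> real \<Rightarrow> real"
  Pred_lower :: "'p \<Rightarrow> real"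
  Pred_upper :: "'p \<Rightarrow> real"
  Diameter :: real

definition is_language :: "('f, 'p) metric_language \<Rightarrow> bool" where
  "is_language L \<longleftrightarrow>
     (\<forall>f\<in>Funs L. \<forall>\<epsilon>>0. Fun_modulus L f \<epsilon> > 0) \<and>
     (\<forall>P\<in>Preds L. (\<forall>\<epsilon>>0. Pred_modulus L P \<epsilon> > 0) \<and> Pred_lower L P \<le> Pred_upper L P)"

definition countable_language :: "('f, 'p) metric_language \<Rightarrow> bool" where
  "countable_language L \<longleftrightarrow> countable (Funs L) \<and> countable (Preds L)"

record ('a, 'f, 'p) metric_structure =
  Univ :: "'a set"
  Metr :: "'a \<Rightarrow> 'a \<Rightarrow> real"
  Fun_interp :: "'f \<Rightarrow> 'a list \<Rightarrow> 'a"
  Pred_interp :: "'p \<Rightarrow> 'a list \<Rightarrow> real"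

definition tuples :: "'a set \<Rightarrow> nat \<Rightarrow> 'a list set" where
  "tuples A n = {xs. length xs = n \<and> set xs \<subseteq> A}"

definition is_structure ::
    "('f, 'p) metric_language \<Rightarrow> ('a, 'f, 'p) metric_structure \<Rightarrow> bool" where
  "is_structure L M \<longleftrightarrow>
     Univ M \<noteq> {} \<and>
     Metric_space (Univ M) (Metr M) \<and>
     Metric_space.mcomplete (Univ M) (Metr M) \<and>
     (\<forall>x\<in>Univ M. \<forall>y\<in>Univ M. Metr M x y \<le> Diameter L) \<and>
     (\<forall>f\<in>Funs L. \<forall>xs\<in>tuples (Univ M) (Fun_arity L f).
        Fun_interp M f xs \<in> Univ M \<and>
        (\<forall>ys\<in>tuples (Univ M) (Fun_arity L f). \<forall>\<epsilon>>0.
           (\<forall>i<Fun_arity L f. Metr M (xs ! i) (ys ! i) < Fun_modulus L f \<epsilon>) \<longrightarrow>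
           Metr M (Fun_interp M f xs) (Fun_interp M f ys) \<le> \<epsilon>)) \<and>
     (\<forall>P\<in>Preds L. \<forall>xs\<in>tuples (Univ M) (Pred_arity L P).
        Pred_interp M P xs \<in> {Pred_lower L P..Pred_upper L P} \<and>
        (\<forall>ys\<in>tuples (Univ M) (Pred_arity L P). \<forall>\<epsilon>>0.
           (\<forall>i<Pred_arity L P. Metr M (xs ! i) (ys ! i) < Pred_modulus L P \<epsilon>) \<longrightarrow>
           \<bar>Pred_interp M P xs - Pred_interp M P ys\<bar> \<le> \<epsilon>))"

datatype 'f trm = Var nat | Fn 'f "'f trm list"

datatype ('f, 'p) fm =
    Dist "'f trm" "'f trm"
  | Pred 'p "'f trm list"
  | Conn "real list \<Rightarrow> real" "('f, 'p) fm list"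
  | SupQ nat "('f, 'p) fm"
  | InfQ nat "('f, 'p) fm"

primrec trm_vars :: "'f trm \<Rightarrow> nat set" where
  "trm_vars (Var n) = {n}"
| "trm_vars (Fn f ts) = \<Union> (set (map trm_vars ts))"

primrec free_vars :: "('f, 'p) fm \<Rightarrow> nat set" where
  "free_vars (Dist s t) = trm_vars s \<union> trm_vars t"
| "free_vars (Pred P ts) = \<Union> (set (map trm_vars ts))"
| "free_vars (Conn u \<phi>s) = \<Union> (set (map free_vars \<phi>s))"
| "free_vars (SupQ n \<phi>) = free_vars \<phi> - {n}"
| "free_vars (InfQ n \<phi>) = free_vars \<phi> - {n}"

primrec wf_trm :: "('f, 'p) metric_language \<Rightarrow> 'f trm \<Rightarrow> bool" where
  "wf_trm L (Var n) \<longleftrightarrow> True"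
| "wf_trm L (Fn f ts) \<longleftrightarrow> f \<in> Funs L \<and> length ts = Fun_arity L f \<and> list_all (wf_trm L) ts"

text \<open>
  Connectives are arbitrary continuous functions from \<open>\<real>\<^sup>n\<close> to \<open>\<real>\<close>. A function \<open>u\<close> on lists stands
  for the family of its restrictions to lists of each length; only the restriction to length
  \<open>n = length \<phi>s\<close> matters, and its continuity is expressed in the product topology on
  \<open>nat \<Rightarrow> real\<close>, of which only the first \<open>n\<close> coordinates are used.
\<close>

primrec wf_fm :: "('f, 'p) metric_language \<Rightarrow> ('f, 'p) fm \<Rightarrow> bool" where
  "wf_fm L (Dist s t) \<longleftrightarrow> wf_trm L s \<and> wf_trm L t"
| "wf_fm L (Pred P ts) \<longleftrightarrow> P \<in> Preds L \<and> length ts = Pred_arity L P \<and> list_all (wf_trm L) ts"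
| "wf_fm L (Conn u \<phi>s) \<longleftrightarrow>
     continuous_on UNIV (\<lambda>v :: nat \<Rightarrow> real. u (map v [0..<length \<phi>s])) \<and> list_all (wf_fm L) \<phi>s"
| "wf_fm L (SupQ n \<phi>) \<longleftrightarrow> wf_fm L \<phi>"
| "wf_fm L (InfQ n \<phi>) \<longleftrightarrow> wf_fm L \<phi>"

primrec trm_val :: "('a, 'f, 'p) metric_structure \<Rightarrow> (nat \<Rightarrow> 'a) \<Rightarrow> 'f trm \<Rightarrow> 'a" where
  "trm_val M e (Var n) = e n"
| "trm_val M e (Fn f ts) = Fun_interp M f (map (trm_val M e) ts)"

primrec fm_val :: "('a, 'f, 'p) metric_structure \<Rightarrow> ('f, 'p) fm \<Rightarrow> (nat \<Rightarrow> 'a) \<Rightarrow> real" where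
  "fm_val M (Dist s t) = (\<lambda>e. Metr M (trm_val M e s) (trm_val M e t))"
| "fm_val M (Pred P ts) = (\<lambda>e. Pred_interp M P (map (trm_val M e) ts))"
| "fm_val M (Conn u \<phi>s) = (\<lambda>e. u (map (\<lambda>v. v e) (map (fm_val M) \<phi>s)))"
| "fm_val M (SupQ n \<phi>) = (\<lambda>e. SUP a\<in>Univ M. fm_val M \<phi> (e(n := a)))"
| "fm_val M (InfQ n \<phi>) = (\<lambda>e. INF a\<in>Univ M. fm_val M \<phi> (e(n := a)))"

definition sentences :: "('f, 'p) metric_language \<Rightarrow> ('f, 'p) fm set" where
  "sentences L = {\<phi>. wf_fm L \<phi> \<and> free_vars \<phi> = {}}"

text \<open>
  A sentence \<open>\<phi>\<close> is read as the closed condition \<open>\<phi> = 0\<close>. As the connectives include all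
  translations, the conditions \<open>\<phi> = r\<close> are covered as well. The value of a sentence does not depend
  on the assignment.
\<close>

definition satisfies :: "('a, 'f, 'p) metric_structure \<Rightarrow> ('f, 'p) fm \<Rightarrow> bool" where
  "satisfies M \<phi> \<longleftrightarrow> (\<forall>e. range e \<subseteq> Univ M \<longrightarrow> fm_val M \<phi> e = 0)"

definition complete_theory_of ::
    "('f, 'p) metric_language \<Rightarrow> ('a, 'f, 'p) metric_structure \<Rightarrow> ('f, 'p) fm set" where
  "complete_theory_of L M = {\<phi>\<in>sentences L. satisfies M \<phi>}"

definition is_model ::
    "('f, 'p) metric_language \<Rightarrow> ('f, 'p) fm set \<Rightarrow> ('a, 'f, 'p) metric_structure \<Rightarrow> bool" where
  "is_model L T M \<longleftrightarrow> is_structure L M \<and> (\<forall>\<phi>\<in>T. satisfies M \<phi>)"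

definition isomorphic_structures ::
    "('f, 'p) metric_language \<Rightarrow> ('a, 'f, 'p) metric_structure \<Rightarrow> ('b, 'f, 'p) metric_structure
       \<Rightarrow> bool" where
  "isomorphic_structures L M N \<longleftrightarrow> (\<exists>h. bij_betw h (Univ M) (Univ N) \<and>
     (\<forall>x\<in>Univ M. \<forall>y\<in>Univ M. Metr N (h x) (h y) = Metr M x y) \<and>
     (\<forall>f\<in>Funs L. \<forall>xs\<in>tuples (Univ M) (Fun_arity L f).
        h (Fun_interp M f xs) = Fun_interp N f (map h xs)) \<and>
     (\<forall>P\<in>Preds L. \<forall>xs\<in>tuples (Univ M) (Pred_arity L P).
        Pred_interp N P (map h xs) = Pred_interp M P xs))"

definition separable_structure :: "('a, 'f, 'p) metric_structure \<Rightarrow> bool" where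
  "separable_structure M \<longleftrightarrow> separable_space (Metric_space.mtopology (Univ M) (Metr M))"

text \<open>
  A separable metric space has at most continuum many points, so every separable structure is
  isomorphic to one whose universe is a set of real numbers; and by the downward
  Loewenheim-Skolem theorem a theory in a countable language with an infinite model has a separable
  infinite one. Hence nothing is lost by letting the models range over structures on subsets of
  \<^typ>\<open>real\<close>, whose metric and operations have nothing to do with those of the reals.
\<close>

type_synonym ('f, 'p) small_structure = "(real, 'f, 'p) metric_structure"

definition aleph0_categorical :: "('f, 'p) metric_language \<Rightarrow> ('f, 'p) fm set \<Rightarrow> bool" where
  "aleph0_categorical L T \<longleftrightarrow>
     (\<exists>M :: ('f, 'p) small_structure. is_model L T M \<and> infinite (Univ M)) \<and>
     (\<forall>(M :: ('f, 'p) small_structure) (N :: ('f, 'p) small_structure).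
        is_model L T M \<and> separable_structure M \<and> is_model L T N \<and> separable_structure N \<longrightarrow>
        isomorphic_structures L M N)"


section \<open>Unit balls of Banach spaces as metric structures\<close>

text \<open>
  The language of Banach spaces has a constant for the origin, a binary symbol for
  \<open>(x, y) \<mapsto> r x + s y\<close> for all rationals with \<open>\<bar>r\<bar> + \<bar>s\<bar> \<le> 1\<close> (these are the linear combinations
  under which the unit ball is closed), and a predicate for the norm.
\<close>

datatype banach_fun = Zero | Comb rat rat

datatype banach_pred = Norm

definition banach_funs :: "banach_fun set" where
  "banach_funs = insert Zero {Comb r s | r s. \<bar>r\<bar> + \<bar>s\<bar> \<le> 1}"

primrec banach_arity :: "banach_fun \<Rightarrow> nat" where
  "banach_arity Zero = 0"
| "banach_arity (Comb r s) = 2"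

definition extends_banach_language ::
    "(banach_fun + 'f, banach_pred + 'p) metric_language \<Rightarrow> bool" where
  "extends_banach_language L \<longleftrightarrow>
     Diameter L = 2 \<and>
     (\<forall>c\<in>banach_funs. Inl c \<in> Funs L \<and> Fun_arity L (Inl c) = banach_arity c \<and>
        Fun_modulus L (Inl c) = (\<lambda>\<epsilon>. \<epsilon>)) \<and>
     Inl Norm \<in> Preds L \<and> Pred_arity L (Inl Norm) = 1 \<and> Pred_modulus L (Inl Norm) = (\<lambda>\<epsilon>. \<epsilon>) \<and>
     Pred_lower L (Inl Norm) = 0 \<and> Pred_upper L (Inl Norm) = 1"

text \<open>
  The reduct of the structure to the language of Banach spaces is the unit ball of the Banach space
  \<^typ>\<open>'a\<close>; the interpretation of the remaining symbols is not restricted.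
\<close>

definition expands_unit_ball ::
    "('a::banach, banach_fun + 'f, banach_pred + 'p) metric_structure \<Rightarrow> bool" where
  "expands_unit_ball M \<longleftrightarrow>
     Univ M = cball 0 1 \<and>
     (\<forall>x\<in>Univ M. \<forall>y\<in>Univ M. Metr M x y = norm (x - y)) \<and>
     Fun_interp M (Inl Zero) [] = 0 \<and>
     (\<forall>r s. \<bar>r\<bar> + \<bar>s\<bar> \<le> 1 \<longrightarrow> (\<forall>x\<in>Univ M. \<forall>y\<in>Univ M.
        Fun_interp M (Inl (Comb r s)) [x, y] = of_rat r *\<^sub>R x + of_rat s *\<^sub>R y)) \<and>
     (\<forall>x\<in>Univ M. Pred_interp M (Inl Norm) [x] = norm x)"

text \<open>
  The case without additional symbols, showing that the notions above are instantiated by the unit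
  ball of any Banach space.
\<close>

definition banach_language :: "(banach_fun + 'f, banach_pred + 'p) metric_language" where
  "banach_language =
     \<lparr>Funs = Inl ` banach_funs,
      Fun_arity = case_sum banach_arity (\<lambda>_. 0), Fun_modulus = (\<lambda>_ \<epsilon>. \<epsilon>),
      Preds = {Inl Norm}, Pred_arity = (\<lambda>_. 1), Pred_modulus = (\<lambda>_ \<epsilon>. \<epsilon>),
      Pred_lower = (\<lambda>_. 0), Pred_upper = (\<lambda>_. 1), Diameter = 2\<rparr>"

primrec banach_fun_interp :: "banach_fun \<Rightarrow> 'a::real_vector list \<Rightarrow> 'a" where
  "banach_fun_interp Zero xs = 0"
| "banach_fun_interp (Comb r s) xs = of_rat r *\<^sub>R (xs ! 0) + of_rat s *\<^sub>R (xs ! 1)"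

definition unit_ball_structure ::
    "('a::banach, banach_fun + 'f, banach_pred + 'p) metric_structure" where
  "unit_ball_structure =
     \<lparr>Univ = cball 0 1, Metr = dist,
      Fun_interp = case_sum banach_fun_interp (\<lambda>_ _. 0), Pred_interp = (\<lambda>_ xs. norm (xs ! 0))\<rparr>"

lemma banach_language:
  "is_language banach_language" "countable_language banach_language"
  "extends_banach_language banach_language"
proof -
  have "banach_funs \<subseteq> insert Zero (range (\<lambda>(r, s). Comb r s))"
    by (auto simp: banach_funs_def)
  moreover have "countable (insert Zero (range (\<lambda>(r, s). Comb r s)))"
    by (intro countable_insert countable_image countableI_type)
  ultimately have "countable banach_funs"
    by (rule countable_subset)
  then show "countable_language banach_language"
    by (simp add: countable_language_def banach_language_def)
qed (auto simp: is_language_def extends_banach_language_def banach_language_def)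

lemma norm_comb_le:
  fixes x y :: "'a::real_normed_vector"
  assumes "\<bar>r\<bar> + \<bar>s\<bar> \<le> 1" "norm x \<le> c" "norm y \<le> c"
  shows "norm (of_rat r *\<^sub>R x + of_rat s *\<^sub>R y) \<le> c"
proof -
  have c: "0 \<le> c" using assms(2) norm_ge_zero order_trans by blast
  have "of_rat (\<bar>r\<bar> + \<bar>s\<bar>) \<le> (1 :: real)" using assms(1) by simp
  then have rs: "\<bar>of_rat r\<bar> + \<bar>of_rat s\<bar> \<le> (1 :: real)"
    by (simp only: of_rat_add abs_of_rat)
  have "norm (of_rat r *\<^sub>R x + of_rat s *\<^sub>R y) \<le> \<bar>of_rat r\<bar> * norm x + \<bar>of_rat s\<bar> * norm y"
    using norm_triangle_ineq[of "of_rat r *\<^sub>R x" "of_rat s *\<^sub>R y"] by simp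
  also have "\<dots> \<le> \<bar>of_rat r\<bar> * c + \<bar>of_rat s\<bar> * c"
    by (intro add_mono mult_left_mono assms) auto
  also have "\<dots> = (\<bar>of_rat r\<bar> + \<bar>of_rat s\<bar>) * c"
    by (simp add: distrib_right)
  also have "\<dots> \<le> 1 * c"
    by (rule mult_right_mono[OF rs c])
  finally show ?thesis by simp
qed

lemma expands_unit_ball_structure: "expands_unit_ball unit_ball_structure"
  by (simp add: expands_unit_ball_def unit_ball_structure_def dist_norm)

lemma is_structure_unit_ball_structure:
  "is_structure banach_language
     (unit_ball_structure :: ('a::banach, banach_fun + 'f, banach_pred + 'p) metric_structure)"
proof -
  let ?B = "cball (0 :: 'a) 1"
  have met: "Metric_space ?B dist"
    by (rule Met_TC.subspace) simp
  interpret ball: Submetric UNIV dist ?B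
    by unfold_locales simp
  have "Metric_space.mcomplete ?B dist"
    by (rule ball.closedin_mcomplete_imp_mcomplete) (simp_all add: complete_UNIV)
  moreover have "dist x y \<le> 2" if "x \<in> ?B" "y \<in> ?B" for x y
    using that norm_triangle_ineq4[of x y] by (simp add: dist_norm)
  moreover have fun_in: "banach_fun_interp c xs \<in> ?B"
    if "c \<in> banach_funs" "xs \<in> tuples ?B (banach_arity c)" for c xs
  proof (cases c)
    case (Comb r s)
    with that have "norm (xs ! 0) \<le> 1" "norm (xs ! 1) \<le> 1" "\<bar>r\<bar> + \<bar>s\<bar> \<le> 1"
      by (auto simp: tuples_def banach_funs_def subset_iff)
    with Comb show ?thesis using norm_comb_le by simp
  qed simp
  moreover have fun_cont: "dist (banach_fun_interp c xs) (banach_fun_interp c ys) \<le> e"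
    if "c \<in> banach_funs" "0 < e" "\<forall>i<banach_arity c. dist (xs ! i) (ys ! i) < e"
    for c e and xs ys :: "'a list"
  proof (cases c)
    case (Comb r s)
    with that have rs: "\<bar>r\<bar> + \<bar>s\<bar> \<le> 1" by (auto simp: banach_funs_def)
    have "norm (xs ! i - ys ! i) \<le> e" if "i < 2" for i
      using \<open>\<forall>i<banach_arity c. _ i\<close> Comb that by (auto simp: dist_norm intro: less_imp_le)
    then have "norm (of_rat r *\<^sub>R (xs ! 0 - ys ! 0) + of_rat s *\<^sub>R (xs ! 1 - ys ! 1)) \<le> e"
      by (intro norm_comb_le rs) auto
    with Comb show ?thesis by (simp add: dist_norm algebra_simps)
  qed (use that in simp)
  moreover have "\<bar>norm x - norm y\<bar> \<le> e" if "dist x y < e" for x y :: 'a and e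
    using that norm_triangle_ineq3[of x y] by (simp add: dist_norm)
  moreover have "norm (xs ! 0) \<le> 1" if "xs \<in> tuples ?B 1" for xs
    using that by (auto simp: tuples_def subset_iff)
  ultimately show ?thesis
    using met unfolding is_structure_def banach_language_def unit_ball_structure_def
    by (simp add: ball_simps del: mem_cball)
qed

text \<open>
  The formula \<open>\<phi>(x, y) = \<parallel>x + y\<parallel>\<close>, written as \<open>2 \<parallel>(x + y) / 2\<parallel>\<close> because \<open>x + y\<close> may leave the
  unit ball; \<open>x\<close> and \<open>y\<close> are the variables 0 and 1.
\<close>

definition norm_sum_fm :: "(banach_fun + 'f, banach_pred + 'p) fm" where
  "norm_sum_fm =
     Conn (\<lambda>v. 2 * v ! 0) [Pred (Inl Norm) [Fn (Inl (Comb (1 / 2) (1 / 2))) [Var 0, Var 1]]]"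

definition norm_sum ::
    "('a, banach_fun + 'f, banach_pred + 'p) metric_structure \<Rightarrow> 'a \<Rightarrow> 'a \<Rightarrow> real" where
  "norm_sum M a b = fm_val M norm_sum_fm (\<lambda>n. if n = 0 then a else b)"

lemma wf_norm_sum_fm:
  assumes "extends_banach_language L"
  shows "wf_fm L norm_sum_fm"
proof -
  have "Comb (1 / 2) (1 / 2) \<in> banach_funs"
    unfolding banach_funs_def by (intro insertI2 CollectI exI[of _ "1 / 2"]) simp
  moreover have "continuous_on UNIV (\<lambda>v :: nat \<Rightarrow> real. 2 * v 0)"
    by (intro continuous_intros continuous_on_product_coordinates)
  ultimately show ?thesis
    using assms by (auto simp: norm_sum_fm_def extends_banach_language_def)
qed

lemma norm_sum_unit_ball:
  assumes "expands_unit_ball M" "a \<in> Univ M" "b \<in> Univ M"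
  shows "norm_sum M a b = norm (a + b)"
proof -
  have eq: "(1 / 2) *\<^sub>R a + (1 / 2) *\<^sub>R b = (1 / 2) *\<^sub>R (a + b)"
    by (simp add: scaleR_add_right)
  have half: "of_rat (1 / 2) = (1 / 2 :: real)"
    by (simp add: of_rat_divide)
  have "Fun_interp M (Inl (Comb (1 / 2) (1 / 2))) [a, b] =
      of_rat (1 / 2) *\<^sub>R a + of_rat (1 / 2) *\<^sub>R b"
    using assms by (simp add: expands_unit_ball_def)
  have "norm (a + b) \<le> 2"
    using assms norm_triangle_ineq[of a b] by (simp add: expands_unit_ball_def)
  then have "(1 / 2) *\<^sub>R (a + b) \<in> Univ M"
    using assms by (simp add: expands_unit_ball_def)
  moreover note \<open>Fun_interp M (Inl (Comb (1 / 2) (1 / 2))) [a, b] = _\<close>[unfolded half eq]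
  ultimately show ?thesis
    using assms by (simp add: norm_sum_def norm_sum_fm_def expands_unit_ball_def)
qed

text \<open>
  The space of \<open>\<phi>\<close>-types over \<open>M\<close>, as the closure of the types realised in \<open>M\<close> in the product
  \<open>[0,2]\<^sup>M\<close>. Points of the product are extensional functions on the universe, and \<open>p a\<close> is the
  value \<open>\<phi>(p, a)\<close>.
\<close>

definition phi_types ::
    "('a, banach_fun + 'f, banach_pred + 'p) metric_structure \<Rightarrow> ('a \<Rightarrow> real) set" where
  "phi_types M =
     product_topology (\<lambda>_. top_of_set {0..2}) (Univ M)
       closure_of ((\<lambda>b. \<lambda>a\<in>Univ M. norm_sum M a b) ` Univ M)"

text \<open>
  The supremum ranges over the unit ball, which is the whole universe of \<open>M\<close>. The value 0 off the
  type space is a convention required by the locale \<^locale>\<open>Metric_space\<close>.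
\<close>

definition phi_dist ::
    "('a, banach_fun + 'f, banach_pred + 'p) metric_structure
       \<Rightarrow> ('a \<Rightarrow> real) \<Rightarrow> ('a \<Rightarrow> real) \<Rightarrow> real" where
  "phi_dist M p q =
     (if p \<in> phi_types M \<and> q \<in> phi_types M then SUP a\<in>Univ M. \<bar>p a - q a\<bar> else 0)"

lemma phi_types_PiE: "phi_types M \<subseteq> (\<Pi>\<^sub>E a\<in>Univ M. {0..2})"
  unfolding phi_types_def
  by (rule order_trans[OF closure_of_subset_topspace]) simp

lemma Metric_space_phi_types:
  assumes "Univ M \<noteq> {}"
  shows "Metric_space (phi_types M) (phi_dist M)"
proof -
  have bd: "bdd_above ((\<lambda>a. \<bar>p a - q a\<bar>) ` Univ M)"
    if "p \<in> phi_types M" "q \<in> phi_types M" for p q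
  proof (rule bdd_aboveI2)
    fix a assume "a \<in> Univ M"
    then have "p a \<in> {0..2}" "q a \<in> {0..2}"
      using that phi_types_PiE[of M] by (auto simp: PiE_def Pi_def)
    then show "\<bar>p a - q a\<bar> \<le> 2" by auto
  qed
  have up: "\<bar>p a - q a\<bar> \<le> phi_dist M p q"
    if "p \<in> phi_types M" "q \<in> phi_types M" "a \<in> Univ M" for p q a
    using that cSUP_upper[OF that(3) bd[OF that(1,2)]] by (simp add: phi_dist_def)
  have le: "phi_dist M p q \<le> c"
    if "p \<in> phi_types M" "q \<in> phi_types M" "\<And>a. a \<in> Univ M \<Longrightarrow> \<bar>p a - q a\<bar> \<le> c" for p q c
    using that assms by (auto simp: phi_dist_def intro: cSUP_least)
  have nonneg: "0 \<le> phi_dist M p q" for p q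
  proof (cases "p \<in> phi_types M \<and> q \<in> phi_types M")
    case True
    obtain a where "a \<in> Univ M" using assms by blast
    with up[of p q a] True show ?thesis by (meson abs_ge_zero order_trans)
  qed (auto simp: phi_dist_def)
  show ?thesis
  proof
    show "0 \<le> phi_dist M p q" for p q by (rule nonneg)
    show "phi_dist M p q = phi_dist M q p" for p q
      by (auto simp: phi_dist_def abs_minus_commute)
    show "phi_dist M p q = 0 \<longleftrightarrow> p = q" if pq: "p \<in> phi_types M" "q \<in> phi_types M" for p q
    proof
      assume "phi_dist M p q = 0"
      then have "p a = q a" if "a \<in> Univ M" for a using up[OF pq that] by simp
      then show "p = q"
        using pq phi_types_PiE[of M] by (meson PiE_ext subsetD)
    next
      assume "p = q"
      then show "phi_dist M p q = 0" using le[OF pq, of 0] nonneg[of p q] by fastforce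
    qed
    show "phi_dist M p r \<le> phi_dist M p q + phi_dist M q r"
      if "p \<in> phi_types M" "q \<in> phi_types M" "r \<in> phi_types M" for p q r
    proof (rule le[OF that(1,3)])
      fix a assume a: "a \<in> Univ M"
      show "\<bar>p a - r a\<bar> \<le> phi_dist M p q + phi_dist M q r"
        using up[OF that(1,2) a] up[OF that(2,3) a] by linarith
    qed
  qed
qed

definition strongly_separable_types ::
    "('a, banach_fun + 'f, banach_pred + 'p) metric_structure \<Rightarrow> bool" where
  "strongly_separable_types M \<longleftrightarrow>
     separable_space (Metric_space.mtopology (phi_types M) (phi_dist M))"


section \<open>Completion of a normed space\<close>

definition cauchy_equiv :: "(nat \<Rightarrow> 'a::real_normed_vector) \<Rightarrow> (nat \<Rightarrow> 'a) \<Rightarrow> bool" where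
  "cauchy_equiv X Y \<longleftrightarrow> Cauchy X \<and> Cauchy Y \<and> (\<lambda>n. X n - Y n) \<longlonglongrightarrow> 0"

lemma cauchy_equiv_refl: "cauchy_equiv X X \<longleftrightarrow> Cauchy X"
  by (simp add: cauchy_equiv_def)

lemma part_equivp_cauchy_equiv:
  "part_equivp (cauchy_equiv :: (nat \<Rightarrow> 'a::real_normed_vector) \<Rightarrow> _)"
proof (rule part_equivpI)
  show "\<exists>X :: nat \<Rightarrow> 'a. cauchy_equiv X X"
    by (rule exI[of _ "\<lambda>_. 0"]) (simp add: cauchy_equiv_def convergent_Cauchy convergent_const)
  show "symp (cauchy_equiv :: (nat \<Rightarrow> 'a) \<Rightarrow> _)"
  proof (rule sympI)
    fix X Y :: "nat \<Rightarrow> 'a" assume "cauchy_equiv X Y"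
    then show "cauchy_equiv Y X"
      using tendsto_minus[of "\<lambda>n. X n - Y n" 0 sequentially] by (simp add: cauchy_equiv_def)
  qed
  show "transp (cauchy_equiv :: (nat \<Rightarrow> 'a) \<Rightarrow> _)"
  proof (rule transpI)
    fix X Y Z :: "nat \<Rightarrow> 'a" assume "cauchy_equiv X Y" "cauchy_equiv Y Z"
    then show "cauchy_equiv X Z"
      using tendsto_add[of "\<lambda>n. X n - Y n" 0 sequentially "\<lambda>n. Y n - Z n" 0]
      by (simp add: cauchy_equiv_def)
  qed
qed

quotient_type (overloaded) 'a completion = "nat \<Rightarrow> 'a::real_normed_vector" / partial: cauchy_equiv
  morphisms rep_completion abs_completion
  by (rule part_equivp_cauchy_equiv)

lemma Cauchy_scaleR:
  fixes X :: "nat \<Rightarrow> 'a::real_normed_vector"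
  assumes "Cauchy X"
  shows "Cauchy (\<lambda>n. c *\<^sub>R X n)"
  using bounded_linear.Cauchy[OF bounded_linear_scaleR_right assms] .

lemma Cauchy_plus:
  fixes X Y :: "nat \<Rightarrow> 'a::real_normed_vector"
  assumes "Cauchy X" "Cauchy Y"
  shows "Cauchy (\<lambda>n. X n + Y n)"
proof (rule metric_CauchyI)
  fix e :: real assume "e > 0"
  then have "e / 2 > 0" by simp
  from metric_CauchyD[OF assms(1) this] metric_CauchyD[OF assms(2) this]
  obtain K N where K: "\<forall>m\<ge>K. \<forall>n\<ge>K. dist (X m) (X n) < e / 2"
    and N: "\<forall>m\<ge>N. \<forall>n\<ge>N. dist (Y m) (Y n) < e / 2"
    by blast
  have "dist (X m + Y m) (X n + Y n) < e" if "m \<ge> max K N" "n \<ge> max K N" for m n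
  proof -
    have "dist (X m) (X n) < e / 2" "dist (Y m) (Y n) < e / 2"
      using K N that by auto
    then show ?thesis
      using dist_triangle_add[of "X m" "Y m" "X n" "Y n"] by linarith
  qed
  then show "\<exists>M. \<forall>m\<ge>M. \<forall>n\<ge>M. dist (X m + Y m) (X n + Y n) < e"
    by blast
qed

lemma Cauchy_norm_seq:
  fixes X :: "nat \<Rightarrow> 'a::real_normed_vector"
  assumes "Cauchy X"
  shows "(\<lambda>n. norm (X n)) \<longlonglongrightarrow> lim (\<lambda>n. norm (X n))"
proof -
  have "Cauchy (\<lambda>n. norm (X n))"
  proof (rule metric_CauchyI)
    fix e :: real assume "e > 0"
    then obtain N where N: "\<forall>m\<ge>N. \<forall>n\<ge>N. dist (X m) (X n) < e"
      using assms metric_CauchyD by blast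
    have "dist (norm (X m)) (norm (X n)) \<le> dist (X m) (X n)" for m n
      by (simp add: dist_norm norm_triangle_ineq3)
    then show "\<exists>N. \<forall>m\<ge>N. \<forall>n\<ge>N. dist (norm (X m)) (norm (X n)) < e"
      using N by (meson le_less_trans)
  qed
  then show ?thesis
    by (simp add: Cauchy_convergent_iff convergent_LIMSEQ_iff)
qed

instantiation completion :: (real_normed_vector) real_normed_vector
begin

lift_definition zero_completion :: "'a completion" is "\<lambda>_. 0"
  by (simp add: cauchy_equiv_def convergent_Cauchy convergent_const)

lift_definition plus_completion :: "'a completion \<Rightarrow> 'a completion \<Rightarrow> 'a completion"
  is "\<lambda>X Y n. X n + Y n"
proof -
  fix X X' Y Y' :: "nat \<Rightarrow> 'a" assume "cauchy_equiv X X'" "cauchy_equiv Y Y'"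
  then show "cauchy_equiv (\<lambda>n. X n + Y n) (\<lambda>n. X' n + Y' n)"
    using tendsto_add[of "\<lambda>n. X n - X' n" 0 sequentially "\<lambda>n. Y n - Y' n" 0]
    by (auto simp: cauchy_equiv_def intro: Cauchy_plus simp: algebra_simps)
qed

lift_definition uminus_completion :: "'a completion \<Rightarrow> 'a completion" is "\<lambda>X n. - X n"
proof -
  fix X Y :: "nat \<Rightarrow> 'a" assume "cauchy_equiv X Y"
  then show "cauchy_equiv (\<lambda>n. - X n) (\<lambda>n. - Y n)"
    using tendsto_minus[of "\<lambda>n. X n - Y n" 0 sequentially] Cauchy_scaleR[of X "-1"]
      Cauchy_scaleR[of Y "-1"]
    by (auto simp: cauchy_equiv_def algebra_simps)
qed

definition minus_completion :: "'a completion \<Rightarrow> 'a completion \<Rightarrow> 'a completion" where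
  "minus_completion x y = x + - y"

lift_definition scaleR_completion :: "real \<Rightarrow> 'a completion \<Rightarrow> 'a completion"
  is "\<lambda>c X n. c *\<^sub>R X n"
proof -
  fix c and X Y :: "nat \<Rightarrow> 'a" assume "cauchy_equiv X Y"
  then show "cauchy_equiv (\<lambda>n. c *\<^sub>R X n) (\<lambda>n. c *\<^sub>R Y n)"
    using tendsto_scaleR[OF tendsto_const[of c], of "\<lambda>n. X n - Y n" 0 sequentially]
      Cauchy_scaleR[of X c] Cauchy_scaleR[of Y c]
    by (auto simp: cauchy_equiv_def scaleR_diff_right)
qed

lift_definition norm_completion :: "'a completion \<Rightarrow> real" is "\<lambda>X. lim (\<lambda>n. norm (X n))"
proof -
  fix X Y :: "nat \<Rightarrow> 'a" assume *: "cauchy_equiv X Y"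
  have "(\<lambda>n. norm (X n) - norm (Y n)) \<longlonglongrightarrow> 0"
  proof (rule tendsto_rabs_zero_cancel, rule Lim_null_comparison[of _ "\<lambda>n. norm (X n - Y n)"])
    show "\<forall>\<^sub>F n in sequentially. norm \<bar>norm (X n) - norm (Y n)\<bar> \<le> norm (X n - Y n)"
      by (simp add: norm_triangle_ineq3)
    show "(\<lambda>n. norm (X n - Y n)) \<longlonglongrightarrow> 0"
      using * tendsto_norm_zero by (auto simp: cauchy_equiv_def)
  qed
  moreover have "(\<lambda>n. norm (X n) - norm (Y n)) \<longlonglongrightarrow>
      lim (\<lambda>n. norm (X n)) - lim (\<lambda>n. norm (Y n))"
    using * by (intro tendsto_diff Cauchy_norm_seq) (auto simp: cauchy_equiv_def)
  ultimately show "lim (\<lambda>n. norm (X n)) = lim (\<lambda>n. norm (Y n))"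
    using LIMSEQ_unique by fastforce
qed

definition sgn_completion :: "'a completion \<Rightarrow> 'a completion" where
  "sgn_completion x = inverse (norm x) *\<^sub>R x"

definition dist_completion :: "'a completion \<Rightarrow> 'a completion \<Rightarrow> real" where
  "dist_completion x y = norm (x - y)"

definition uniformity_completion :: "('a completion \<times> 'a completion) filter" where
  "uniformity_completion = (INF e\<in>{0<..}. principal {(x, y). dist x y < e})"

definition open_completion :: "'a completion set \<Rightarrow> bool" where
  "open_completion U \<longleftrightarrow> (\<forall>x\<in>U. \<forall>\<^sub>F (x', y) in uniformity. x' = x \<longrightarrow> y \<in> U)"

instance
proof
  fix x y z :: "'a completion" and c d :: real
  show "x + y + z = x + (y + z)"
    by transfer (auto simp: add.assoc cauchy_equiv_refl intro!: Cauchy_plus)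
  show "x + y = y + x"
    by transfer (auto simp: add.commute cauchy_equiv_refl intro!: Cauchy_plus)
  show "0 + x = x"
    by transfer simp
  show "- x + x = 0"
    by transfer (simp add: cauchy_equiv_def convergent_Cauchy convergent_const)
  show "x - y = x + - y"
    by (rule minus_completion_def)
  show "c *\<^sub>R (x + y) = c *\<^sub>R x + c *\<^sub>R y"
    by transfer (auto simp: scaleR_add_right cauchy_equiv_refl intro!: Cauchy_plus Cauchy_scaleR)
  show "(c + d) *\<^sub>R x = c *\<^sub>R x + d *\<^sub>R x"
    by transfer (auto simp: scaleR_add_left cauchy_equiv_refl intro!: Cauchy_plus Cauchy_scaleR)
  show "c *\<^sub>R d *\<^sub>R x = (c * d) *\<^sub>R x"
    by transfer (auto simp: cauchy_equiv_refl intro!: Cauchy_scaleR)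
  show "1 *\<^sub>R x = x"
    by transfer simp
  show "sgn x = inverse (norm x) *\<^sub>R x"
    by (rule sgn_completion_def)
  show "dist x y = norm (x - y)"
    by (rule dist_completion_def)
  show "uniformity = (INF e\<in>{0<..}. principal {(x :: 'a completion, y). dist x y < e})"
    by (rule uniformity_completion_def)
  show "open U \<longleftrightarrow> (\<forall>x\<in>U. \<forall>\<^sub>F (x', y) in uniformity. x' = x \<longrightarrow> y \<in> U)"
    for U :: "'a completion set"
    by (rule open_completion_def)
  show "norm x = 0 \<longleftrightarrow> x = 0"
  proof transfer
    fix X :: "nat \<Rightarrow> 'a" assume "cauchy_equiv X X"
    then have "Cauchy X" by (simp add: cauchy_equiv_refl)
    have "lim (\<lambda>n. norm (X n)) = 0 \<longleftrightarrow> (\<lambda>n. norm (X n)) \<longlonglongrightarrow> 0"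
      using Cauchy_norm_seq[OF \<open>Cauchy X\<close>] LIMSEQ_unique by auto
    also have "\<dots> \<longleftrightarrow> cauchy_equiv X (\<lambda>_. 0)"
      using \<open>Cauchy X\<close>
      by (simp add: cauchy_equiv_def tendsto_norm_zero_iff convergent_Cauchy convergent_const)
    finally show "lim (\<lambda>n. norm (X n)) = 0 \<longleftrightarrow> cauchy_equiv X (\<lambda>_. 0)" .
  qed
  show "norm (x + y) \<le> norm x + norm y"
  proof transfer
    fix X Y :: "nat \<Rightarrow> 'a" assume "cauchy_equiv X X" "cauchy_equiv Y Y"
    then have *: "Cauchy X" "Cauchy Y" by (simp_all add: cauchy_equiv_refl)
    show "lim (\<lambda>n. norm (X n + Y n)) \<le> lim (\<lambda>n. norm (X n)) + lim (\<lambda>n. norm (Y n))"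
      by (rule LIMSEQ_le[OF Cauchy_norm_seq[OF Cauchy_plus[OF *]]
            tendsto_add[OF Cauchy_norm_seq[OF *(1)] Cauchy_norm_seq[OF *(2)]]])
        (auto intro: norm_triangle_ineq)
  qed
  show "norm (c *\<^sub>R x) = \<bar>c\<bar> * norm x"
  proof transfer
    fix c and X :: "nat \<Rightarrow> 'a" assume "cauchy_equiv X X"
    then have "(\<lambda>n. norm (c *\<^sub>R X n)) \<longlonglongrightarrow> \<bar>c\<bar> * lim (\<lambda>n. norm (X n))"
      by (auto simp: cauchy_equiv_refl intro!: tendsto_mult Cauchy_norm_seq)
    then show "lim (\<lambda>n. norm (c *\<^sub>R X n)) = \<bar>c\<bar> * lim (\<lambda>n. norm (X n))"
      by (rule limI)
  qed
qed

end

lift_definition to_completion :: "'a::real_normed_vector \<Rightarrow> 'a completion" is "\<lambda>x _. x"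
  by (simp add: cauchy_equiv_def convergent_Cauchy convergent_const)

lemma norm_to_completion: "norm (to_completion x) = norm x"
  by transfer simp

lemma linear_to_completion: "linear to_completion"
proof
  show "to_completion (x + y) = to_completion x + to_completion y" for x y :: 'a
    by transfer (simp add: cauchy_equiv_def convergent_Cauchy convergent_const)
  show "to_completion (c *\<^sub>R x) = c *\<^sub>R to_completion x" for c and x :: 'a
    by transfer (simp add: cauchy_equiv_def convergent_Cauchy convergent_const)
qed

lemma to_completion_approx:
  fixes x :: "'a::real_normed_vector completion"
  assumes "e > 0"
  shows "\<exists>a. norm (x - to_completion a) < e"
  using assms unfolding minus_completion_def
proof transfer
  fix e :: real and X :: "nat \<Rightarrow> 'a" assume "cauchy_equiv X X" and e: "0 < e"
  then have X: "Cauchy X" by (simp add: cauchy_equiv_refl)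
  then obtain N where N: "\<forall>m\<ge>N. \<forall>n\<ge>N. dist (X m) (X n) < e / 2"
    using metric_CauchyD[of X "e / 2"] e by auto
  have "Cauchy (\<lambda>n. X n + - X N)"
    by (rule Cauchy_plus[OF X]) (simp add: convergent_Cauchy convergent_const)
  from Cauchy_norm_seq[OF this] have "lim (\<lambda>n. norm (X n + - X N)) \<le> e / 2"
    by (rule LIMSEQ_le_const2) (use N in \<open>auto simp: dist_norm intro!: exI[of _ N] less_imp_le\<close>)
  then show "\<exists>a. lim (\<lambda>n. norm (X n + - a)) < e"
    using e by (intro exI[of _ "X N"]) linarith
qed

lemma closure_range_to_completion:
  "closure (range (to_completion :: 'a::real_normed_vector \<Rightarrow> _)) = UNIV"
proof -
  have "x \<in> closure (range to_completion)" for x :: "'a completion"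
    unfolding closure_approachable
  proof (intro allI impI)
    fix e :: real assume "0 < e"
    then obtain a where "norm (x - to_completion a) < e"
      using to_completion_approx by blast
    then show "\<exists>y\<in>range to_completion. dist y x < e"
      by (auto simp: dist_norm norm_minus_commute)
  qed
  then show ?thesis by blast
qed

instance completion :: (real_normed_vector) banach
proof
  fix A :: "nat \<Rightarrow> 'a completion" assume A: "Cauchy A"
  have "\<forall>n. \<exists>a. norm (A n - to_completion a) < inverse (real (Suc n))"
    by (intro allI to_completion_approx) simp
  then obtain X where X: "\<And>n. norm (A n - to_completion (X n)) < inverse (real (Suc n))"
    by metis
  have close: "(\<lambda>n. A n - to_completion (X n)) \<longlonglongrightarrow> 0"
    by (rule Lim_null_comparison[OF _ LIMSEQ_inverse_real_of_nat])
      (use X in \<open>intro always_eventually allI less_imp_le, blast\<close>)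
  have "Cauchy (\<lambda>n. A n + - (A n - to_completion (X n)))"
    by (intro Cauchy_plus A convergent_Cauchy)
      (use tendsto_minus[OF close] in \<open>auto simp: convergent_def\<close>)
  then have "Cauchy (\<lambda>n. to_completion (X n))" by simp
  then have CX: "Cauchy X"
    by (simp only: Cauchy_def dist_norm norm_to_completion
        linear_diff[OF linear_to_completion, symmetric])
  define L where "L = abs_completion X"
  have "(\<lambda>n. to_completion (X n)) \<longlonglongrightarrow> L"
  proof (rule metric_LIMSEQ_I)
    fix e :: real assume e: "0 < e"
    then obtain N where N: "\<forall>m\<ge>N. \<forall>n\<ge>N. dist (X m) (X n) < e / 2"
      using metric_CauchyD[OF CX, of "e / 2"] by auto
    have "norm (L - to_completion (X n)) < e" if "n \<ge> N" for n
    proof -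
      have "L - to_completion (X n) = abs_completion (\<lambda>m. X m + - X n)"
        unfolding L_def minus_completion_def to_completion.abs_eq
        by (simp add: uminus_completion.abs_eq plus_completion.abs_eq CX cauchy_equiv_refl
            convergent_Cauchy convergent_const)
      moreover have C: "Cauchy (\<lambda>m. X m + - X n)"
        by (rule Cauchy_plus[OF CX]) (simp add: convergent_Cauchy convergent_const)
      ultimately have "norm (L - to_completion (X n)) = lim (\<lambda>m. norm (X m + - X n))"
        by (simp add: norm_completion.abs_eq cauchy_equiv_refl)
      also have "\<dots> \<le> e / 2"
        using Cauchy_norm_seq[OF C]
        by (rule LIMSEQ_le_const2)
          (use N that in \<open>auto simp: dist_norm intro!: exI[of _ N] less_imp_le\<close>)
      finally show ?thesis using e by linarith
    qed
    then show "\<exists>N. \<forall>n\<ge>N. dist (to_completion (X n)) L < e"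
      by (auto simp: dist_norm norm_minus_commute)
  qed
  from tendsto_add[OF this close] show "convergent A"
    by (auto simp: convergent_def)
qed


section \<open>Tsirelson's space\<close>

text \<open>
  Sequences are indexed by \<open>{1, 2, \<dots>}\<close>; they are represented by functions on \<^typ>\<open>nat\<close> that vanish
  at 0. The members of an admissible family are nonempty (empty sets contribute nothing to the sums
  and have no minimum); since a nonempty family \<open>Es\<close> has \<open>length Es \<ge> 1\<close>, none of its members
  contains 0.
\<close>

definition seq_restrict :: "nat set \<Rightarrow> (nat \<Rightarrow> real) \<Rightarrow> nat \<Rightarrow> real" where
  "seq_restrict E x = (\<lambda>k. if k \<in> E then x k else 0)"

definition admissible :: "nat set list \<Rightarrow> bool" where
  "admissible Es \<longleftrightarrow>
     Es \<noteq> [] \<and> (\<forall>E\<in>set Es. finite E \<and> E \<noteq> {}) \<and> length Es \<le> Min (hd Es) \<and>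
     sorted_wrt (\<lambda>E F. Max E < Min F) Es"

primrec tsirelson_norm_step :: "nat \<Rightarrow> (nat \<Rightarrow> real) \<Rightarrow> real" where
  "tsirelson_norm_step 0 x = (SUP k. \<bar>x k\<bar>)"
| "tsirelson_norm_step (Suc n) x =
     max (tsirelson_norm_step n x)
       (SUP Es\<in>{Es. admissible Es}. 1 / 2 * (\<Sum>E\<leftarrow>Es. tsirelson_norm_step n (seq_restrict E x)))"

definition tsirelson_norm :: "(nat \<Rightarrow> real) \<Rightarrow> real" where
  "tsirelson_norm x = lim (\<lambda>n. tsirelson_norm_step n x)"

lemma finite_support_restrict:
  assumes "finite {k. x k \<noteq> 0}"
  shows "finite {k. seq_restrict E x k \<noteq> 0}"
  by (rule finite_subset[OF _ assms]) (auto simp: seq_restrict_def)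

lemma finite_support_add:
  assumes "finite {k. x k \<noteq> 0}" "finite {k. y k \<noteq> (0 :: real)}"
  shows "finite {k. x k + y k \<noteq> 0}"
  by (rule finite_subset[OF _ finite_UnI[OF assms]]) auto

definition l1_norm :: "(nat \<Rightarrow> real) \<Rightarrow> real" where
  "l1_norm x = (\<Sum>k | x k \<noteq> 0. \<bar>x k\<bar>)"

lemma l1_norm_restrict:
  assumes "finite {k. x k \<noteq> 0}"
  shows "l1_norm (seq_restrict E x) + l1_norm (seq_restrict (- E) x) = l1_norm x"
proof -
  have "l1_norm (seq_restrict F x) = (\<Sum>k\<in>{k. x k \<noteq> 0} \<inter> F. \<bar>x k\<bar>)" for F
    unfolding l1_norm_def by (rule sum.cong) (auto simp: seq_restrict_def)
  then show ?thesis
    using sum.Int_Diff[OF assms, of "\<lambda>k. \<bar>x k\<bar>" E] by (simp add: l1_norm_def Diff_eq)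
qed

lemma l1_norm_disjoint:
  assumes "sorted_wrt (\<lambda>E F. E \<inter> F = {}) Es" "finite {k. x k \<noteq> 0}"
  shows "(\<Sum>E\<leftarrow>Es. l1_norm (seq_restrict E x)) \<le> l1_norm x"
  using assms
proof (induction Es arbitrary: x)
  case Nil
  then show ?case by (simp add: l1_norm_def sum_nonneg)
next
  case (Cons E Es)
  have "seq_restrict F (seq_restrict (- E) x) = seq_restrict F x" if "F \<in> set Es" for F
    using Cons.prems(1) that by (auto simp: seq_restrict_def fun_eq_iff)
  then have "(\<Sum>F\<leftarrow>Es. l1_norm (seq_restrict F x)) =
      (\<Sum>F\<leftarrow>Es. l1_norm (seq_restrict F (seq_restrict (- E) x)))"
    by (intro arg_cong[of _ _ sum_list] map_cong) auto
  also have "\<dots> \<le> l1_norm (seq_restrict (- E) x)"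
    using Cons.prems by (intro Cons.IH finite_support_restrict) auto
  finally show ?case
    using l1_norm_restrict[OF Cons.prems(2), of E] by simp
qed

lemma admissible_disjoint:
  assumes "admissible Es"
  shows "sorted_wrt (\<lambda>E F. E \<inter> F = {}) Es"
proof (rule sorted_wrt_mono_rel)
  show "sorted_wrt (\<lambda>E F. Max E < Min F) Es"
    using assms by (simp add: admissible_def)
  fix E F assume "E \<in> set Es" "F \<in> set Es" and less: "Max E < Min F"
  then have "finite E" "finite F" using assms by (auto simp: admissible_def)
  then have "k < l" if "k \<in> E" "l \<in> F" for k l
    using that less Max_ge[of E k] Min_le[of F l] by linarith
  then show "E \<inter> F = {}" by blast
qed

lemma admissible_singleton: "admissible [{1}]"
  by (simp add: admissible_def)

lemma admissible_nonempty: "{Es. admissible Es} \<noteq> {}"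
  using admissible_singleton by blast

lemma bdd_above_coords:
  assumes "finite {k. x k \<noteq> (0 :: real)}"
  shows "bdd_above (range (\<lambda>k. \<bar>x k\<bar>))"
proof (rule bdd_above_mono)
  show "bdd_above (insert 0 ((\<lambda>k. \<bar>x k\<bar>) ` {k. x k \<noteq> 0}))"
    using assms by (intro bdd_above_finite) auto
qed auto

lemma admissible_sum_le:
  assumes "\<And>x. finite {k. x k \<noteq> 0} \<Longrightarrow> tsirelson_norm_step n x \<le> l1_norm x"
    and "finite {k. x k \<noteq> 0}" "admissible Es"
  shows "1 / 2 * (\<Sum>E\<leftarrow>Es. tsirelson_norm_step n (seq_restrict E x)) \<le> l1_norm x"
proof -
  have "(\<Sum>E\<leftarrow>Es. tsirelson_norm_step n (seq_restrict E x)) \<le>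
      (\<Sum>E\<leftarrow>Es. l1_norm (seq_restrict E x))"
    by (intro sum_list_mono assms finite_support_restrict)
  also have "\<dots> \<le> l1_norm x"
    by (intro l1_norm_disjoint admissible_disjoint assms)
  finally have "(\<Sum>E\<leftarrow>Es. tsirelson_norm_step n (seq_restrict E x)) \<le> l1_norm x" .
  moreover have "0 \<le> l1_norm x"
    by (simp add: l1_norm_def sum_nonneg)
  ultimately show ?thesis by linarith
qed

lemma tsirelson_norm_step_le_l1:
  assumes "finite {k. x k \<noteq> 0}"
  shows "tsirelson_norm_step n x \<le> l1_norm x"
  using assms
proof (induction n arbitrary: x)
  case 0
  have "\<bar>x k\<bar> \<le> l1_norm x" for k
  proof (cases "x k = 0")
    case True
    then show ?thesis by (simp add: l1_norm_def sum_nonneg)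
  next
    case False
    then show ?thesis
      unfolding l1_norm_def using 0 by (intro member_le_sum) auto
  qed
  then show ?case by (simp add: cSUP_least)
next
  case (Suc n)
  then show ?case
    unfolding tsirelson_norm_step.simps
    by (intro max.boundedI cSUP_least[OF admissible_nonempty] admissible_sum_le) auto
qed

lemma bdd_above_admissible:
  assumes "finite {k. x k \<noteq> 0}"
  shows "bdd_above ((\<lambda>Es. 1 / 2 * (\<Sum>E\<leftarrow>Es. tsirelson_norm_step n (seq_restrict E x)))
    ` {Es. admissible Es})"
proof (rule bdd_aboveI2)
  fix Es assume "Es \<in> {Es. admissible Es}"
  then show "1 / 2 * (\<Sum>E\<leftarrow>Es. tsirelson_norm_step n (seq_restrict E x)) \<le> l1_norm x"
    using assms by (intro admissible_sum_le tsirelson_norm_step_le_l1) auto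
qed

lemma tsirelson_norm_step_upper:
  assumes "finite {k. x k \<noteq> 0}" "admissible Es"
  shows "1 / 2 * (\<Sum>E\<leftarrow>Es. tsirelson_norm_step n (seq_restrict E x)) \<le>
    tsirelson_norm_step (Suc n) x"
proof -
  have "1 / 2 * (\<Sum>E\<leftarrow>Es. tsirelson_norm_step n (seq_restrict E x)) \<le>
      (SUP Es\<in>{Es. admissible Es}. 1 / 2 * (\<Sum>E\<leftarrow>Es. tsirelson_norm_step n (seq_restrict E x)))"
    using assms by (intro cSUP_upper bdd_above_admissible) auto
  then show ?thesis unfolding tsirelson_norm_step.simps by linarith
qed

lemma tsirelson_norm_step_Suc_least:
  assumes "tsirelson_norm_step n x \<le> c"
    and "\<And>Es. admissible Es \<Longrightarrow>
      1 / 2 * (\<Sum>E\<leftarrow>Es. tsirelson_norm_step n (seq_restrict E x)) \<le> c"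
  shows "tsirelson_norm_step (Suc n) x \<le> c"
  unfolding tsirelson_norm_step.simps
  by (intro max.boundedI assms(1) cSUP_least[OF admissible_nonempty]) (use assms(2) in blast)

lemma tsirelson_norm_step_incseq: "incseq (\<lambda>n. tsirelson_norm_step n x)"
  by (rule incseq_SucI) simp

lemma coord_le_tsirelson_norm_step:
  assumes "finite {k. x k \<noteq> 0}"
  shows "\<bar>x k\<bar> \<le> tsirelson_norm_step n x"
proof -
  have "\<bar>x k\<bar> \<le> tsirelson_norm_step 0 x"
    using cSUP_upper[OF UNIV_I bdd_above_coords[OF assms], of k] by simp
  also have "\<dots> \<le> tsirelson_norm_step n x"
    by (rule incseqD[OF tsirelson_norm_step_incseq]) simp
  finally show ?thesis .
qed

lemma tsirelson_norm_step_triangle: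
  assumes "finite {k. x k \<noteq> 0}" "finite {k. y k \<noteq> 0}"
  shows "tsirelson_norm_step n (\<lambda>k. x k + y k) \<le> tsirelson_norm_step n x + tsirelson_norm_step n y"
  using assms
proof (induction n arbitrary: x y)
  case 0
  have "\<bar>x k + y k\<bar> \<le> tsirelson_norm_step 0 x + tsirelson_norm_step 0 y" for k
    using coord_le_tsirelson_norm_step[OF 0(1), of k 0] coord_le_tsirelson_norm_step[OF 0(2), of k 0]
    by linarith
  then show ?case by (simp add: cSUP_least)
next
  case (Suc n)
  show ?case
  proof (rule tsirelson_norm_step_Suc_least)
    show "tsirelson_norm_step n (\<lambda>k. x k + y k) \<le>
        tsirelson_norm_step (Suc n) x + tsirelson_norm_step (Suc n) y"
      using Suc.IH[OF Suc.prems] incseq_SucD[OF tsirelson_norm_step_incseq[of x], of n]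
        incseq_SucD[OF tsirelson_norm_step_incseq[of y], of n] by linarith
    fix Es assume Es: "admissible Es"
    have "seq_restrict E (\<lambda>k. x k + y k) = (\<lambda>k. seq_restrict E x k + seq_restrict E y k)" for E
      by (auto simp: seq_restrict_def)
    then have "tsirelson_norm_step n (seq_restrict E (\<lambda>k. x k + y k)) \<le>
        tsirelson_norm_step n (seq_restrict E x) + tsirelson_norm_step n (seq_restrict E y)" for E
      using Suc.IH[OF finite_support_restrict finite_support_restrict, OF Suc.prems] by metis
    then have "(\<Sum>E\<leftarrow>Es. tsirelson_norm_step n (seq_restrict E (\<lambda>k. x k + y k))) \<le>
        (\<Sum>E\<leftarrow>Es. tsirelson_norm_step n (seq_restrict E x) + tsirelson_norm_step n (seq_restrict E y))"
      by (rule sum_list_mono)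
    also have "\<dots> = (\<Sum>E\<leftarrow>Es. tsirelson_norm_step n (seq_restrict E x)) +
        (\<Sum>E\<leftarrow>Es. tsirelson_norm_step n (seq_restrict E y))"
      by (rule sum_list_addf)
    finally show "1 / 2 * (\<Sum>E\<leftarrow>Es. tsirelson_norm_step n (seq_restrict E (\<lambda>k. x k + y k))) \<le>
        tsirelson_norm_step (Suc n) x + tsirelson_norm_step (Suc n) y"
      using tsirelson_norm_step_upper[OF Suc.prems(1) Es, of n]
        tsirelson_norm_step_upper[OF Suc.prems(2) Es, of n] by argo
  qed
qed

lemma tsirelson_norm_step_nonneg:
  assumes "finite {k. x k \<noteq> 0}"
  shows "0 \<le> tsirelson_norm_step n x"
  using coord_le_tsirelson_norm_step[OF assms, of 0 n] by linarith

lemma finite_support_scale: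
  assumes "finite {k. x k \<noteq> 0}"
  shows "finite {k. c * x k \<noteq> (0 :: real)}"
  by (rule finite_subset[OF _ assms]) auto

lemma tsirelson_norm_step_scale_le:
  assumes "finite {k. x k \<noteq> 0}"
  shows "tsirelson_norm_step n (\<lambda>k. c * x k) \<le> \<bar>c\<bar> * tsirelson_norm_step n x"
  using assms
proof (induction n arbitrary: x)
  case 0
  have "\<bar>c * x k\<bar> \<le> \<bar>c\<bar> * tsirelson_norm_step 0 x" for k
    using coord_le_tsirelson_norm_step[OF 0, of k 0] by (simp only: abs_mult mult_left_mono abs_ge_zero)
  then show ?case
    unfolding tsirelson_norm_step.simps(1)[of "\<lambda>k. c * x k"] by (intro cSUP_least) auto
next
  case (Suc n)
  show ?case
  proof (rule tsirelson_norm_step_Suc_least)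
    have "tsirelson_norm_step n (\<lambda>k. c * x k) \<le> \<bar>c\<bar> * tsirelson_norm_step n x"
      by (rule Suc.IH[OF Suc.prems])
    also have "\<dots> \<le> \<bar>c\<bar> * tsirelson_norm_step (Suc n) x"
      by (intro mult_left_mono incseq_SucD[OF tsirelson_norm_step_incseq]) simp
    finally show "tsirelson_norm_step n (\<lambda>k. c * x k) \<le> \<bar>c\<bar> * tsirelson_norm_step (Suc n) x" .
    fix Es assume Es: "admissible Es"
    have "seq_restrict E (\<lambda>k. c * x k) = (\<lambda>k. c * seq_restrict E x k)" for E
      by (auto simp: seq_restrict_def)
    then have "tsirelson_norm_step n (seq_restrict E (\<lambda>k. c * x k)) \<le>
        \<bar>c\<bar> * tsirelson_norm_step n (seq_restrict E x)" for E
      using Suc.IH[OF finite_support_restrict, OF Suc.prems] by metis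
    then have "(\<Sum>E\<leftarrow>Es. tsirelson_norm_step n (seq_restrict E (\<lambda>k. c * x k))) \<le>
        (\<Sum>E\<leftarrow>Es. \<bar>c\<bar> * tsirelson_norm_step n (seq_restrict E x))"
      by (rule sum_list_mono)
    also have "\<dots> = \<bar>c\<bar> * (\<Sum>E\<leftarrow>Es. tsirelson_norm_step n (seq_restrict E x))"
      by (rule sum_list_const_mult)
    finally have "1 / 2 * (\<Sum>E\<leftarrow>Es. tsirelson_norm_step n (seq_restrict E (\<lambda>k. c * x k))) \<le>
        \<bar>c\<bar> * (1 / 2 * (\<Sum>E\<leftarrow>Es. tsirelson_norm_step n (seq_restrict E x)))"
      by argo
    also have "\<dots> \<le> \<bar>c\<bar> * tsirelson_norm_step (Suc n) x"
      by (intro mult_left_mono tsirelson_norm_step_upper Suc.prems Es) simp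
    finally show "1 / 2 * (\<Sum>E\<leftarrow>Es. tsirelson_norm_step n (seq_restrict E (\<lambda>k. c * x k))) \<le>
        \<bar>c\<bar> * tsirelson_norm_step (Suc n) x" .
  qed
qed

lemma tsirelson_norm_LIMSEQ:
  assumes "finite {k. x k \<noteq> 0}"
  shows "(\<lambda>n. tsirelson_norm_step n x) \<longlonglongrightarrow> tsirelson_norm x"
proof -
  obtain L where "(\<lambda>n. tsirelson_norm_step n x) \<longlonglongrightarrow> L"
    using incseq_convergent[OF tsirelson_norm_step_incseq[of x], of "l1_norm x"]
      tsirelson_norm_step_le_l1[OF assms] by blast
  then show ?thesis
    unfolding tsirelson_norm_def by (simp add: limI)
qed

lemma coord_le_tsirelson_norm:
  assumes "finite {k. x k \<noteq> 0}"
  shows "\<bar>x k\<bar> \<le> tsirelson_norm x"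
  by (rule LIMSEQ_le_const[OF tsirelson_norm_LIMSEQ[OF assms]])
    (use coord_le_tsirelson_norm_step[OF assms] in blast)

lemma tsirelson_norm_triangle:
  assumes "finite {k. x k \<noteq> 0}" "finite {k. y k \<noteq> 0}"
  shows "tsirelson_norm (\<lambda>k. x k + y k) \<le> tsirelson_norm x + tsirelson_norm y"
  by (rule LIMSEQ_le[OF tsirelson_norm_LIMSEQ[OF finite_support_add[OF assms]]
        tendsto_add[OF tsirelson_norm_LIMSEQ[OF assms(1)] tsirelson_norm_LIMSEQ[OF assms(2)]]])
    (use tsirelson_norm_step_triangle[OF assms] in blast)

lemma tsirelson_norm_scale_le:
  assumes "finite {k. x k \<noteq> 0}"
  shows "tsirelson_norm (\<lambda>k. c * x k) \<le> \<bar>c\<bar> * tsirelson_norm x"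
  by (rule LIMSEQ_le[OF tsirelson_norm_LIMSEQ[OF finite_support_scale[OF assms]]
        tendsto_mult[OF tendsto_const tsirelson_norm_LIMSEQ[OF assms]]])
    (use tsirelson_norm_step_scale_le[OF assms] in blast)

lemma tsirelson_norm_scale:
  assumes "finite {k. x k \<noteq> 0}"
  shows "tsirelson_norm (\<lambda>k. c * x k) = \<bar>c\<bar> * tsirelson_norm x"
proof (cases "c = 0")
  case True
  have "0 \<le> tsirelson_norm (\<lambda>k. 0 * x k)"
    using coord_le_tsirelson_norm[OF finite_support_scale[OF assms], of 0 0] by simp
  with tsirelson_norm_scale_le[OF assms, of 0] True show ?thesis by simp
next
  case False
  have "tsirelson_norm x = tsirelson_norm (\<lambda>k. inverse c * (c * x k))"
    using False by (simp add: field_simps)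
  also have "\<dots> \<le> \<bar>inverse c\<bar> * tsirelson_norm (\<lambda>k. c * x k)"
    by (rule tsirelson_norm_scale_le[OF finite_support_scale[OF assms]])
  finally have "\<bar>c\<bar> * tsirelson_norm x \<le> tsirelson_norm (\<lambda>k. c * x k)"
    using False by (simp add: field_simps)
  with tsirelson_norm_scale_le[OF assms, of c] show ?thesis by linarith
qed

typedef c00 = "{x :: nat \<Rightarrow> real. x 0 = 0 \<and> finite {k. x k \<noteq> 0}}"
  morphisms coord Abs_c00
  by (rule exI[of _ "\<lambda>_. 0"]) simp

setup_lifting type_definition_c00

instantiation c00 :: real_normed_vector
begin

lift_definition zero_c00 :: c00 is "\<lambda>_. 0"
  by simp

lift_definition plus_c00 :: "c00 \<Rightarrow> c00 \<Rightarrow> c00" is "\<lambda>x y k. x k + y k"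
  by (simp add: finite_support_add)

lift_definition uminus_c00 :: "c00 \<Rightarrow> c00" is "\<lambda>x k. - x k"
  by simp

lift_definition minus_c00 :: "c00 \<Rightarrow> c00 \<Rightarrow> c00" is "\<lambda>x y k. x k - y k"
proof -
  fix x y :: "nat \<Rightarrow> real"
  assume "x 0 = 0 \<and> finite {k. x k \<noteq> 0}" "y 0 = 0 \<and> finite {k. y k \<noteq> 0}"
  then show "x 0 - y 0 = 0 \<and> finite {k. x k - y k \<noteq> 0}"
    using finite_support_add[of x "\<lambda>k. - y k"] by simp
qed

lift_definition scaleR_c00 :: "real \<Rightarrow> c00 \<Rightarrow> c00" is "\<lambda>c x k. c * x k"
  using finite_support_scale by simp

lift_definition norm_c00 :: "c00 \<Rightarrow> real" is tsirelson_norm .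

definition sgn_c00 :: "c00 \<Rightarrow> c00" where
  "sgn_c00 x = inverse (norm x) *\<^sub>R x"

definition dist_c00 :: "c00 \<Rightarrow> c00 \<Rightarrow> real" where
  "dist_c00 x y = norm (x - y)"

definition uniformity_c00 :: "(c00 \<times> c00) filter" where
  "uniformity_c00 = (INF e\<in>{0<..}. principal {(x, y). dist x y < e})"

definition open_c00 :: "c00 set \<Rightarrow> bool" where
  "open_c00 U \<longleftrightarrow> (\<forall>x\<in>U. \<forall>\<^sub>F (x', y) in uniformity. x' = x \<longrightarrow> y \<in> U)"

instance
proof
  fix x y z :: c00 and c d :: real
  show "x + y + z = x + (y + z)" by transfer (simp add: add.assoc)
  show "x + y = y + x" by transfer (simp add: add.commute)
  show "0 + x = x" by transfer simp
  show "- x + x = 0" by transfer simp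
  show "x - y = x + - y" by transfer simp
  show "c *\<^sub>R (x + y) = c *\<^sub>R x + c *\<^sub>R y" by transfer (simp add: distrib_left)
  show "(c + d) *\<^sub>R x = c *\<^sub>R x + d *\<^sub>R x" by transfer (simp add: distrib_right)
  show "c *\<^sub>R d *\<^sub>R x = (c * d) *\<^sub>R x" by transfer (simp add: mult.assoc)
  show "1 *\<^sub>R x = x" by transfer simp
  show "sgn x = inverse (norm x) *\<^sub>R x" by (rule sgn_c00_def)
  show "dist x y = norm (x - y)" by (rule dist_c00_def)
  show "uniformity = (INF e\<in>{0<..}. principal {(x :: c00, y). dist x y < e})"
    by (rule uniformity_c00_def)
  show "open U \<longleftrightarrow> (\<forall>x\<in>U. \<forall>\<^sub>F (x', y) in uniformity. x' = x \<longrightarrow> y \<in> U)" for U :: "c00 set"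
    by (rule open_c00_def)
  show "norm x = 0 \<longleftrightarrow> x = 0"
  proof transfer
    fix x :: "nat \<Rightarrow> real" assume "x 0 = 0 \<and> finite {k. x k \<noteq> 0}"
    then have fin: "finite {k. x k \<noteq> 0}" by simp
    show "tsirelson_norm x = 0 \<longleftrightarrow> x = (\<lambda>_. 0)"
    proof
      assume "tsirelson_norm x = 0"
      then show "x = (\<lambda>_. 0)" using coord_le_tsirelson_norm[OF fin] by (simp add: fun_eq_iff)
    next
      assume "x = (\<lambda>_. 0)"
      then show "tsirelson_norm x = 0" using tsirelson_norm_scale[OF fin, of 0] by simp
    qed
  qed
  show "norm (x + y) \<le> norm x + norm y"
    by transfer (simp add: tsirelson_norm_triangle)
  show "norm (c *\<^sub>R x) = \<bar>c\<bar> * norm x"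
    by transfer (simp add: tsirelson_norm_scale)
qed

end

type_synonym tsirelson = "c00 completion"

end

(*
Both parts start from an ultrapower of the unit ball of Tsirelson's space, cut down to a separable
elementary substructure by the Loewenheim-Skolem theorem.

(i) Vectors e_j + e_(j+1) with disjoint supports of total size at most the smallest index in the
supports span an isometric copy of l1, so some separable model of T contains an isometric copy of
infinite-dimensional l1. Tsirelson's space does not: after subtracting terms of such a sequence one
gets almost successive vectors, and the norm of x_0 + (x_1 + ... + x_r) / r stays away from 2 for
large r by the Figiel-Johnson estimate. A separable elementary substructure of the unit ball of Tsirelson's
space is therefore another model, not isomorphic to the first.

(ii) Let b be 2/R times the sum of R basis vectors far beyond m. The norm of e_m + b is at least 3/2
if R < m and at most 5/4 if R >= 4 m, because an admissible family that starts at m has at most m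
members and so cannot separate the coordinates of b in the second case. Hence the formula
||x + y|| has the order property, in some separable model there are families a_q and b_r indexed by
the rationals witnessing it, and the limits of ||x + b_r|| for r decreasing to a real number c are
continuum many types at mutual distance at least 1/4.
*)

theory Submission
  imports Defs
begin

section \<open>Ultrafilter limits\<close>

text \<open>Why pairs \<open>e_j + e_(j+1)\<close>: separating coordinates by an admissible family
  recovers only half of the l1 norm. Single basis vectors would therefore miss an isometric copy by
  a factor 2, while a vector with two unit coordinates has norm 1 and l1 norm 2, which absorbs the
  factor. Admissibility allows this only for finitely many vectors at a time, depending on where
  they start; in the ultrapower the starting index goes to infinity and the restriction disappears.

  Part (i) never forms the span. The models are told apart by the atomic formulas
  \<open>l1_test_fm r s\<close>: in one model a single sequence gives all of them the value 1, in
  the other every sequence makes one of them smaller. An isomorphism preserves these values; the two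
  models can share their theory because a statement about all infinite sequences is not first-order.

  Models live on sets of reals, so neither the ultrapower nor the unit ball itself is a candidate.
  Every model used is a small elementary substructure of one of them, and the substructure of the
  ultrapower is chosen to serve both parts.\<close>

lemma exists_free_ultrafilter:
  "\<exists>F :: nat filter. F \<le> sequentially \<and> F \<noteq> bot \<and>
     (\<forall>P. eventually P F \<or> eventually (\<lambda>n. \<not> P n) F)"
proof -
  define A where "A = {F :: nat filter. F \<le> sequentially \<and> F \<noteq> bot}"
  have "\<exists>m\<in>A. \<forall>a\<in>A. m \<ge> a \<longrightarrow> a = m"
  proof (rule predicate_Zorn)
    show "partial_order_on A (relation_of (\<ge>) A)"
      by (rule partial_order_on_relation_ofI) auto
    fix C assume "C \<in> Chains (relation_of (\<ge>) A)"
    then have CA: "C \<subseteq> A" and ch: "\<And>F G. F \<in> C \<Longrightarrow> G \<in> C \<Longrightarrow> F \<le> G \<or> G \<le> F"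
      unfolding Chains_def relation_of_def by auto
    show "\<exists>u\<in>A. \<forall>a\<in>C. a \<ge> u"
    proof (cases "C = {}")
      case True
      then show ?thesis
        unfolding A_def by (auto intro!: exI[of _ sequentially])
    next
      case False
      have "\<exists>x\<in>C. x \<le> inf F G" if "F \<in> C" "G \<in> C" for F G
        using ch[OF that] that by auto
      \<comment> \<open>A chain is downward directed, so its infimum is improper only if one of its
        members is.\<close>
      then have "eventually (\<lambda>_. False) (Inf C) \<longleftrightarrow> (\<exists>b\<in>C. eventually (\<lambda>_. False) b)"
        by (rule eventually_Inf_base[OF False])
      then have "Inf C \<noteq> bot"
        using CA by (auto simp: A_def trivial_limit_def)
      moreover have "Inf C \<le> sequentially"
        using False CA by (auto simp: A_def intro: Inf_lower2)
      ultimately show ?thesis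
        by (intro bexI[of _ "Inf C"]) (auto simp: A_def intro: Inf_lower)
    qed
  qed
  then obtain F where F: "F \<in> A" and max: "\<And>G. G \<in> A \<Longrightarrow> G \<le> F \<Longrightarrow> G = F" by auto
  have "eventually P F" if "\<not> eventually (\<lambda>n. \<not> P n) F" for P
  proof -
    \<comment> \<open>Adding the set where \<open>P\<close> holds to \<open>F\<close> leaves the
      filter proper, so minimality of \<open>F\<close> shows that the set was there already.\<close>
    let ?G = "inf F (principal {n. P n})"
    have "?G \<noteq> bot"
      using that by (auto simp: trivial_limit_def eventually_inf_principal)
    then have "?G = F"
      using F by (intro max) (auto simp: A_def intro: le_infI1)
    then have "F \<le> principal {n. P n}" by (metis inf_le2)
    then show ?thesis by (simp add: le_principal)
  qed
  with F show ?thesis by (auto simp: A_def)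
qed

definition ultra :: "nat filter" where
  "ultra = (SOME F. F \<le> sequentially \<and> F \<noteq> bot \<and>
     (\<forall>P. eventually P F \<or> eventually (\<lambda>n. \<not> P n) F))"

lemma ultra: "ultra \<le> sequentially" "ultra \<noteq> bot"
    "eventually P ultra \<or> eventually (\<lambda>n. \<not> P n) ultra"
  using someI_ex[OF exists_free_ultrafilter] unfolding ultra_def by auto

lemma eventually_ultra_ge: "eventually (\<lambda>n. N \<le> n) ultra"
  using ultra(1) eventually_ge_at_top[of N] by (simp add: filter_leD)

lemma eventually_ultra_ex: "eventually P ultra \<Longrightarrow> \<exists>n\<ge>N. P n"
  using eventually_happens'[OF ultra(2) eventually_conj[OF eventually_ultra_ge[of N], of P]] by auto

definition ulim :: "(nat \<Rightarrow> real) \<Rightarrow> real" where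
  "ulim f = Lim ultra f"

lemma tendsto_imp_ulim: "(f \<longlongrightarrow> l) ultra \<Longrightarrow> ulim f = l"
  unfolding ulim_def by (rule tendsto_Lim[OF ultra(2)])

text \<open>By compactness the image filter has a cluster point, and for an ultrafilter a cluster
  point is a limit: a neighbourhood that is not large has a large complement.\<close>

lemma tendsto_ulim:
  assumes "eventually (\<lambda>n. \<bar>f n\<bar> \<le> B) ultra"
  shows "(f \<longlongrightarrow> ulim f) ultra"
proof -
  let ?F = "filtermap f ultra"
  have "?F \<noteq> bot" using ultra(2) by (simp add: filtermap_bot_iff)
  moreover have "eventually (\<lambda>x. x \<in> {-B..B}) ?F"
    using assms by (auto simp: eventually_filtermap abs_le_iff elim: eventually_mono)
  ultimately obtain l where l: "inf (nhds l) ?F \<noteq> bot"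
    using compact_filter[THEN iffD1, OF compact_Icc[of "-B" B]] by blast
  have "eventually (\<lambda>n. f n \<in> S) ultra" if "open S" "l \<in> S" for S
  proof (rule ccontr)
    assume "\<not> ?thesis"
    then have "eventually (\<lambda>n. \<not> f n \<in> S) ultra" using ultra(3) by blast
    then have "eventually (\<lambda>x. x \<notin> S) ?F" by (simp add: eventually_filtermap)
    moreover have "eventually (\<lambda>x. x \<in> S) (nhds l)" using that by (rule eventually_nhds_in_open)
    ultimately have "eventually (\<lambda>_. False) (inf (nhds l) ?F)"
      unfolding eventually_inf by blast
    with l show False by (simp add: trivial_limit_def)
  qed
  then have "(f \<longlongrightarrow> l) ultra" by (rule topological_tendstoI)
  then show ?thesis using tendsto_imp_ulim by metis
qed

lemma ulim_le:
  fixes f :: "nat \<Rightarrow> real"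
  assumes "(f \<longlongrightarrow> l) ultra" "eventually (\<lambda>n. f n \<le> c) ultra"
  shows "l \<le> c"
  using tendsto_upperbound[OF assms ultra(2)] .

section \<open>Continuous connectives\<close>

lemma tendsto_fun_componentwise:
  fixes v :: "'b \<Rightarrow> 'i \<Rightarrow> 'c::topological_space"
  assumes "\<And>i. ((\<lambda>k. v k i) \<longlongrightarrow> l i) F"
  shows "(v \<longlongrightarrow> l) F"
proof -
  have "limitin (product_topology (\<lambda>_. euclidean) UNIV) v l F"
    unfolding limitin_componentwise using assms by simp
  then show ?thesis by (simp add: euclidean_product_topology)
qed

lemma tendsto_connective:
  fixes u :: "real list \<Rightarrow> real"
  assumes u: "continuous_on UNIV (\<lambda>v :: nat \<Rightarrow> real. u (map v [0..<n]))"
    and len: "\<And>k. length (xs k) = n" "length l = n"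
    and lim: "\<And>i. i < n \<Longrightarrow> ((\<lambda>k. xs k ! i) \<longlongrightarrow> l ! i) F"
  shows "((\<lambda>k. u (xs k)) \<longlongrightarrow> u l) F"
proof -
  \<comment> \<open>Padding by 0 turns lists into points of the product space in which the
    continuity of \<open>u\<close> is stated.\<close>
  define v where "v k i = (if i < n then xs k ! i else 0)" for k i
  define w where "w i = (if i < n then l ! i else 0)" for i
  have "((\<lambda>k. v k i) \<longlongrightarrow> w i) F" for i
    using lim[of i] by (simp add: v_def w_def)
  then have "(v \<longlongrightarrow> w) F" by (rule tendsto_fun_componentwise)
  moreover have "isCont (\<lambda>v :: nat \<Rightarrow> real. u (map v [0..<n])) w"
    using u continuous_on_eq_continuous_at by blast
  ultimately have "((\<lambda>k. u (map (v k) [0..<n])) \<longlongrightarrow> u (map w [0..<n])) F"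
    by (rule isCont_tendsto_compose[rotated])
  moreover have "map (v k) [0..<n] = xs k" for k
    using len by (intro nth_equalityI) (auto simp: v_def)
  moreover have "map w [0..<n] = l"
    using len by (intro nth_equalityI) (auto simp: w_def)
  ultimately show ?thesis by simp
qed

lemma bounded_lists_ulim:
  fixes xs :: "nat \<Rightarrow> real list"
  assumes "\<And>k. length (xs k) = n" "\<And>k i. i < n \<Longrightarrow> \<bar>xs k ! i\<bar> \<le> B"
  shows "\<exists>l. length l = n \<and> (\<forall>i<n. ((\<lambda>k. xs k ! i) \<longlongrightarrow> l ! i) ultra)"
proof (intro exI[of _ "map (\<lambda>i. ulim (\<lambda>k. xs k ! i)) [0..<n]"] conjI allI impI)
  fix i assume "i < n"
  moreover have "((\<lambda>k. xs k ! i) \<longlongrightarrow> ulim (\<lambda>k. xs k ! i)) ultra"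
    using assms \<open>i < n\<close> by (intro tendsto_ulim[of _ B]) auto
  ultimately show "((\<lambda>k. xs k ! i) \<longlongrightarrow> map (\<lambda>i. ulim (\<lambda>k. xs k ! i)) [0..<n] ! i) ultra" by simp
qed simp

text \<open>Compactness of the cube, used in the form that bounded sequences of lists converge along
  the ultrafilter: unbounded values of \<open>u\<close> would contradict its continuity at the
  limit.\<close>

lemma connective_bounded:
  fixes u :: "real list \<Rightarrow> real"
  assumes u: "continuous_on UNIV (\<lambda>v :: nat \<Rightarrow> real. u (map v [0..<n]))"
  shows "\<exists>C. \<forall>xs. length xs = n \<and> (\<forall>i<n. \<bar>xs ! i\<bar> \<le> B) \<longrightarrow> \<bar>u xs\<bar> \<le> C"
proof (rule ccontr)
  assume "\<not> ?thesis"
  then have "\<forall>k::nat. \<exists>xs. length xs = n \<and> (\<forall>i<n. \<bar>xs ! i\<bar> \<le> B) \<and> \<bar>u xs\<bar> > real k"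
    by (metis not_le)
  then obtain xs where xs: "\<And>k. length (xs k) = n" "\<And>k i. i < n \<Longrightarrow> \<bar>xs k ! i\<bar> \<le> B"
      "\<And>k. \<bar>u (xs k)\<bar> > real k" by metis
  obtain l where l: "length l = n" "\<And>i. i < n \<Longrightarrow> ((\<lambda>k. xs k ! i) \<longlongrightarrow> l ! i) ultra"
    using bounded_lists_ulim[of xs n B, OF xs(1,2)] by auto
  have "((\<lambda>k. \<bar>u (xs k)\<bar>) \<longlongrightarrow> \<bar>u l\<bar>) ultra"
    by (intro tendsto_rabs tendsto_connective[OF u xs(1) l])
  then have "eventually (\<lambda>k. \<bar>u (xs k)\<bar> < \<bar>u l\<bar> + 1) ultra"
    by (rule order_tendstoD) simp
  moreover obtain N where "real N > \<bar>u l\<bar> + 1" using reals_Archimedean2 by blast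
  ultimately obtain k where "k \<ge> N" "\<bar>u (xs k)\<bar> < \<bar>u l\<bar> + 1"
    using eventually_ultra_ex by blast
  with xs(3)[of k] \<open>real N > _\<close> show False by linarith
qed

text \<open>Heine-Cantor by ultrafilter limits: counterexamples at distance below 1/(k+1) have a
  common limit. Only \<open>xs\<close> is confined to the cube, because \<open>ys\<close> will also
  be a rounded argument that may leave it slightly.\<close>

lemma connective_uniform:
  fixes u :: "real list \<Rightarrow> real"
  assumes u: "continuous_on UNIV (\<lambda>v :: nat \<Rightarrow> real. u (map v [0..<n]))" and "\<epsilon> > 0"
  shows "\<exists>\<delta>>0. \<forall>xs ys. length xs = n \<and> length ys = n \<and> (\<forall>i<n. \<bar>xs ! i\<bar> \<le> B) \<and>
    (\<forall>i<n. \<bar>xs ! i - ys ! i\<bar> < \<delta>) \<longrightarrow> \<bar>u xs - u ys\<bar> < \<epsilon>"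
proof (rule ccontr)
  assume neg: "\<not> ?thesis"
  have "\<exists>xs ys. length xs = n \<and> length ys = n \<and> (\<forall>i<n. \<bar>xs ! i\<bar> \<le> B) \<and>
    (\<forall>i<n. \<bar>xs ! i - ys ! i\<bar> < 1 / real (Suc k)) \<and> \<epsilon> \<le> \<bar>u xs - u ys\<bar>" for k
  proof -
    have "1 / real (Suc k) > 0" by simp
    with neg show ?thesis by (meson not_le)
  qed
  then obtain xs ys where xs: "\<And>k. length (xs k) = n" "\<And>k i. i < n \<Longrightarrow> \<bar>xs k ! i\<bar> \<le> B"
      and ys: "\<And>k. length (ys k) = n"
      and xy: "\<And>k i. i < n \<Longrightarrow> \<bar>xs k ! i - ys k ! i\<bar> < 1 / real (Suc k)"
      and ge: "\<And>k. \<epsilon> \<le> \<bar>u (xs k) - u (ys k)\<bar>" by metis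
  obtain l where l: "length l = n" "\<And>i. i < n \<Longrightarrow> ((\<lambda>k. xs k ! i) \<longlongrightarrow> l ! i) ultra"
    using bounded_lists_ulim[of xs n B, OF xs(1,2)] by auto
  have l2: "((\<lambda>k. ys k ! i) \<longlongrightarrow> l ! i) ultra" if "i < n" for i
  proof -
    have "((\<lambda>k. xs k ! i - ys k ! i) \<longlongrightarrow> 0) sequentially"
      by (rule Lim_null_comparison[OF _ lim_1_over_n[THEN LIMSEQ_Suc]])
        (use xy[OF that] in \<open>auto intro!: always_eventually less_imp_le\<close>)
    then have "((\<lambda>k. xs k ! i - ys k ! i) \<longlongrightarrow> 0) ultra"
      using ultra(1) tendsto_mono by blast
    from tendsto_diff[OF l(2)[OF that] this] show ?thesis by simp
  qed
  have "((\<lambda>k. \<bar>u (xs k) - u (ys k)\<bar>) \<longlongrightarrow> \<bar>u l - u l\<bar>) ultra"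
    by (intro tendsto_rabs tendsto_diff tendsto_connective[OF u xs(1) l]
        tendsto_connective[OF u ys l(1) l2])
  then have "\<epsilon> \<le> \<bar>u l - u l\<bar>"
    using ge by (intro tendsto_lowerbound[OF _ _ ultra(2)]) auto
  with \<open>\<epsilon> > 0\<close> show False by simp
qed

section \<open>Values of terms and formulas\<close>

lemma range_fun_upd_subset: "range e \<subseteq> A \<Longrightarrow> a \<in> A \<Longrightarrow> range (e(n := a)) \<subseteq> A"
  by auto

lemma finite_trm_vars: "finite (trm_vars t)"
  by (induction t) auto

lemma finite_free_vars: "finite (free_vars \<phi>)"
  by (induction \<phi>) (auto simp: finite_trm_vars)

text \<open>Only \<open>f\<close> is assumed bounded: the lemma will also compare a formula with its
  code, and nothing is known beforehand about the values of a code.\<close>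

lemma SUP_INF_diff_le:
  fixes f g :: "'c \<Rightarrow> real"
  assumes "A \<noteq> {}" "\<And>a. a \<in> A \<Longrightarrow> \<bar>f a - g a\<bar> \<le> \<epsilon>" "\<And>a. a \<in> A \<Longrightarrow> \<bar>f a\<bar> \<le> B"
  shows "\<bar>(SUP a\<in>A. f a) - (SUP a\<in>A. g a)\<bar> \<le> \<epsilon>" "\<bar>(INF a\<in>A. f a) - (INF a\<in>A. g a)\<bar> \<le> \<epsilon>"
proof -
  have g: "\<bar>g a\<bar> \<le> B + \<epsilon>" if "a \<in> A" for a
    using assms(2,3)[OF that] by linarith
  have bdd: "bdd_above (f ` A)" "bdd_above (g ` A)" "bdd_below (f ` A)" "bdd_below (g ` A)"
    by (rule bdd_aboveI2[of _ _ B] bdd_aboveI2[of _ _ "B + \<epsilon>"]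
          bdd_belowI2[of _ "- B"] bdd_belowI2[of _ "- (B + \<epsilon>)"],
        use assms(3) g in \<open>force simp: abs_le_iff\<close>)+
  have "f a \<le> (SUP a\<in>A. g a) + \<epsilon>" "g a \<le> (SUP a\<in>A. f a) + \<epsilon>"
    "(INF a\<in>A. g a) - \<epsilon> \<le> f a" "(INF a\<in>A. f a) - \<epsilon> \<le> g a" if "a \<in> A" for a
    using assms(2)[OF that] cSUP_upper[OF that bdd(1)] cSUP_upper[OF that bdd(2)]
      cINF_lower[OF bdd(3) that] cINF_lower[OF bdd(4) that] by linarith+
  then have "(SUP a\<in>A. f a) \<le> (SUP a\<in>A. g a) + \<epsilon>" "(SUP a\<in>A. g a) \<le> (SUP a\<in>A. f a) + \<epsilon>"
    "(INF a\<in>A. g a) - \<epsilon> \<le> (INF a\<in>A. f a)" "(INF a\<in>A. f a) - \<epsilon> \<le> (INF a\<in>A. g a)"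
    by (auto intro!: cSUP_least cINF_greatest assms(1))
  then show "\<bar>(SUP a\<in>A. f a) - (SUP a\<in>A. g a)\<bar> \<le> \<epsilon>" "\<bar>(INF a\<in>A. f a) - (INF a\<in>A. g a)\<bar> \<le> \<epsilon>"
    by linarith+
qed

locale language_structure =
  fixes L :: "('f, 'p) metric_language" and M :: "('a, 'f, 'p) metric_structure"
  assumes language: "is_language L" and struct: "is_structure L M"
begin

sublocale Metric_space "Univ M" "Metr M"
  using struct by (simp add: is_structure_def)

lemma mcomplete: mcomplete
  using struct by (simp add: is_structure_def)

lemma Univ_nonempty: "Univ M \<noteq> {}"
  using struct by (simp add: is_structure_def)

lemma Metr_le: "x \<in> Univ M \<Longrightarrow> y \<in> Univ M \<Longrightarrow> Metr M x y \<le> Diameter L"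
  using struct by (simp add: is_structure_def)

lemma Fun_in_Univ:
  "f \<in> Funs L \<Longrightarrow> xs \<in> tuples (Univ M) (Fun_arity L f) \<Longrightarrow> Fun_interp M f xs \<in> Univ M"
  using struct unfolding is_structure_def by blast

lemma Fun_continuous:
  assumes "f \<in> Funs L" "xs \<in> tuples (Univ M) (Fun_arity L f)" "ys \<in> tuples (Univ M) (Fun_arity L f)"
    "\<epsilon> > 0" "\<And>i. i < Fun_arity L f \<Longrightarrow> Metr M (xs ! i) (ys ! i) < Fun_modulus L f \<epsilon>"
  shows "Metr M (Fun_interp M f xs) (Fun_interp M f ys) \<le> \<epsilon>"
  using struct assms unfolding is_structure_def by blast

lemma Pred_bounds:
  assumes "P \<in> Preds L" "xs \<in> tuples (Univ M) (Pred_arity L P)"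
  shows "Pred_interp M P xs \<in> {Pred_lower L P..Pred_upper L P}"
  using struct assms unfolding is_structure_def by blast

lemma Pred_continuous:
  assumes "P \<in> Preds L" "xs \<in> tuples (Univ M) (Pred_arity L P)" "ys \<in> tuples (Univ M) (Pred_arity L P)"
    "\<epsilon> > 0" "\<And>i. i < Pred_arity L P \<Longrightarrow> Metr M (xs ! i) (ys ! i) < Pred_modulus L P \<epsilon>"
  shows "\<bar>Pred_interp M P xs - Pred_interp M P ys\<bar> \<le> \<epsilon>"
  using struct assms unfolding is_structure_def by blast

lemma modulus_pos:
  "f \<in> Funs L \<Longrightarrow> \<epsilon> > 0 \<Longrightarrow> Fun_modulus L f \<epsilon> > 0"
  "P \<in> Preds L \<Longrightarrow> \<epsilon> > 0 \<Longrightarrow> Pred_modulus L P \<epsilon> > 0"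
  using language by (auto simp: is_language_def)

lemma trm_val_in_Univ:
  assumes "wf_trm L t" "range e \<subseteq> Univ M"
  shows "trm_val M e t \<in> Univ M"
  using assms(1)
proof (induction t)
  case (Var n)
  then show ?case using assms(2) by auto
next
  case (Fn f ts)
  then have "map (trm_val M e) ts \<in> tuples (Univ M) (Fun_arity L f)"
    by (auto simp: tuples_def list_all_iff)
  with Fn.prems show ?case by (auto intro: Fun_in_Univ)
qed

lemma trm_vals_in_tuples:
  assumes "list_all (wf_trm L) ts" "length ts = n" "range e \<subseteq> Univ M"
  shows "map (trm_val M e) ts \<in> tuples (Univ M) n"
  using assms trm_val_in_Univ by (auto simp: tuples_def list_all_iff)

text \<open>Quantifiers are real suprema and infima, which say nothing on unbounded sets.
  Connectives preserve boundedness because they are continuous on a cube.\<close>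

lemma fm_val_bounded:
  assumes "wf_fm L \<phi>"
  shows "\<exists>B. \<forall>e. range e \<subseteq> Univ M \<longrightarrow> \<bar>fm_val M \<phi> e\<bar> \<le> B"
  using assms
proof (induction \<phi>)
  case (Dist s t)
  then show ?case by (auto intro!: exI[of _ "Diameter L"] Metr_le trm_val_in_Univ)
next
  case (Pred P ts)
  have "\<bar>fm_val M (Pred P ts) e\<bar> \<le> max \<bar>Pred_lower L P\<bar> \<bar>Pred_upper L P\<bar>"
    if "range e \<subseteq> Univ M" for e
    using Pred_bounds[of P "map (trm_val M e) ts"] Pred trm_vals_in_tuples[of ts _ e] that by auto
  then show ?case by blast
next
  case (Conn u \<phi>s)
  then have "\<forall>\<phi>\<in>set \<phi>s. \<exists>B. \<forall>e. range e \<subseteq> Univ M \<longrightarrow> \<bar>fm_val M \<phi> e\<bar> \<le> B"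
    by (auto simp: list_all_iff)
  then obtain b where b: "\<And>\<phi> e. \<phi> \<in> set \<phi>s \<Longrightarrow> range e \<subseteq> Univ M \<Longrightarrow> \<bar>fm_val M \<phi> e\<bar> \<le> b \<phi>"
    by metis
  define B where "B = (\<Sum>\<phi>\<in>set \<phi>s. \<bar>b \<phi>\<bar>)"
  have B: "\<bar>fm_val M \<phi> e\<bar> \<le> B" if "\<phi> \<in> set \<phi>s" "range e \<subseteq> Univ M" for \<phi> e
  proof -
    have "\<bar>b \<phi>\<bar> \<le> B" unfolding B_def using that by (intro member_le_sum) auto
    with b[OF that] show ?thesis by linarith
  qed
  obtain C where "\<forall>xs. length xs = length \<phi>s \<and> (\<forall>i<length \<phi>s. \<bar>xs ! i\<bar> \<le> B) \<longrightarrow> \<bar>u xs\<bar> \<le> C"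
    using connective_bounded Conn.prems by (metis wf_fm.simps(3))
  then have "\<forall>e. range e \<subseteq> Univ M \<longrightarrow> \<bar>fm_val M (Conn u \<phi>s) e\<bar> \<le> C"
    using B by simp
  then show ?case by blast
next
  case (SupQ n \<phi>)
  then obtain B where B: "\<And>e. range e \<subseteq> Univ M \<Longrightarrow> \<bar>fm_val M \<phi> e\<bar> \<le> B" by auto
  have "\<bar>fm_val M (SupQ n \<phi>) e\<bar> \<le> B" if "range e \<subseteq> Univ M" for e
    unfolding fm_val.simps
    by (rule cSup_abs_le) (use Univ_nonempty that in \<open>auto intro!: B[OF range_fun_upd_subset] simp del: fun_upd_apply\<close>)
  then show ?case by blast
next
  case (InfQ n \<phi>)
  then obtain B where B: "\<And>e. range e \<subseteq> Univ M \<Longrightarrow> \<bar>fm_val M \<phi> e\<bar> \<le> B" by auto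
  have "\<bar>fm_val M (InfQ n \<phi>) e\<bar> \<le> B" if "range e \<subseteq> Univ M" for e
    unfolding fm_val.simps
    by (rule cInf_abs_ge) (use Univ_nonempty that in \<open>auto intro!: B[OF range_fun_upd_subset] simp del: fun_upd_apply\<close>)
  then show ?case by blast
qed

lemma fm_vals_bounded:
  assumes "list_all (wf_fm L) \<phi>s"
  shows "\<exists>B. \<forall>\<phi>\<in>set \<phi>s. \<forall>e. range e \<subseteq> Univ M \<longrightarrow> \<bar>fm_val M \<phi> e\<bar> \<le> B"
proof -
  have "\<forall>\<phi>\<in>set \<phi>s. \<exists>B. \<forall>e. range e \<subseteq> Univ M \<longrightarrow> \<bar>fm_val M \<phi> e\<bar> \<le> B"
    using assms fm_val_bounded by (auto simp: list_all_iff)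
  then obtain b where b: "\<And>\<phi> e. \<phi> \<in> set \<phi>s \<Longrightarrow> range e \<subseteq> Univ M \<Longrightarrow> \<bar>fm_val M \<phi> e\<bar> \<le> b \<phi>"
    by metis
  have "\<bar>fm_val M \<phi> e\<bar> \<le> (\<Sum>\<phi>\<in>set \<phi>s. \<bar>b \<phi>\<bar>)" if "\<phi> \<in> set \<phi>s" "range e \<subseteq> Univ M" for \<phi> e
    using b[OF that] member_le_sum[of \<phi> "set \<phi>s" "\<lambda>\<phi>. \<bar>b \<phi>\<bar>"] that(1) by simp
  then show ?thesis by blast
qed

lemma trm_val_uniform:
  assumes "wf_trm L t" "\<epsilon> > 0"
  shows "\<exists>\<delta>>0. \<forall>e e'. range e \<subseteq> Univ M \<and> range e' \<subseteq> Univ M \<and>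
    (\<forall>i\<in>trm_vars t. Metr M (e i) (e' i) < \<delta>) \<longrightarrow> Metr M (trm_val M e t) (trm_val M e' t) < \<epsilon>"
  using assms
proof (induction t arbitrary: \<epsilon>)
  case (Var n)
  then show ?case by auto
next
  case (Fn f ts)
  define \<mu> where "\<mu> = Fun_modulus L f (\<epsilon> / 2)"
  have "\<mu> > 0" using Fn.prems modulus_pos by (simp add: \<mu>_def)
  then have "\<forall>t\<in>set ts. \<exists>\<delta>>0. \<forall>e e'. range e \<subseteq> Univ M \<and> range e' \<subseteq> Univ M \<and>
    (\<forall>i\<in>trm_vars t. Metr M (e i) (e' i) < \<delta>) \<longrightarrow> Metr M (trm_val M e t) (trm_val M e' t) < \<mu>"
    using Fn.IH Fn.prems by (auto simp: list_all_iff)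
  then obtain d where d: "\<And>t. t \<in> set ts \<Longrightarrow> d t > 0"
    "\<And>t e e'. t \<in> set ts \<Longrightarrow> range e \<subseteq> Univ M \<Longrightarrow> range e' \<subseteq> Univ M \<Longrightarrow>
    (\<forall>i\<in>trm_vars t. Metr M (e i) (e' i) < d t) \<Longrightarrow> Metr M (trm_val M e t) (trm_val M e' t) < \<mu>"
    by metis
  define \<delta> where "\<delta> = Min (insert 1 (d ` set ts))"
  have \<delta>: "\<delta> > 0" "\<And>t. t \<in> set ts \<Longrightarrow> \<delta> \<le> d t" using d(1) by (auto simp: \<delta>_def)
  have "Metr M (trm_val M e (Fn f ts)) (trm_val M e' (Fn f ts)) < \<epsilon>"
    if "range e \<subseteq> Univ M" "range e' \<subseteq> Univ M"
      "\<forall>i\<in>trm_vars (Fn f ts). Metr M (e i) (e' i) < \<delta>" for e e'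
  proof -
    have "Metr M (trm_val M e t) (trm_val M e' t) < \<mu>" if "t \<in> set ts" for t
      using \<delta>(2)[OF that] \<open>\<forall>i\<in>trm_vars (Fn f ts). _ i\<close> that
      by (intro d(2) \<open>range e \<subseteq> _\<close> \<open>range e' \<subseteq> _\<close>) fastforce+
    then have "Metr M (trm_val M e (Fn f ts)) (trm_val M e' (Fn f ts)) \<le> \<epsilon> / 2"
      unfolding trm_val.simps using Fn.prems that
      by (intro Fun_continuous trm_vals_in_tuples) (auto simp: \<mu>_def)
    with \<open>\<epsilon> > 0\<close> show ?thesis by simp
  qed
  with \<delta>(1) show ?case by blast
qed

lemma trm_vals_uniform:
  assumes "list_all (wf_trm L) ts" "\<epsilon> > 0"
  shows "\<exists>\<delta>>0. \<forall>e e'. range e \<subseteq> Univ M \<and> range e' \<subseteq> Univ M \<and>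
    (\<forall>i\<in>\<Union> (set (map trm_vars ts)). Metr M (e i) (e' i) < \<delta>) \<longrightarrow>
    (\<forall>t\<in>set ts. Metr M (trm_val M e t) (trm_val M e' t) < \<epsilon>)"
proof -
  have "\<forall>t\<in>set ts. \<exists>\<delta>>0. \<forall>e e'. range e \<subseteq> Univ M \<and> range e' \<subseteq> Univ M \<and>
    (\<forall>i\<in>trm_vars t. Metr M (e i) (e' i) < \<delta>) \<longrightarrow> Metr M (trm_val M e t) (trm_val M e' t) < \<epsilon>"
    using trm_val_uniform assms by (auto simp: list_all_iff)
  then obtain d where d: "\<And>t. t \<in> set ts \<Longrightarrow> d t > 0"
    "\<And>t e e'. t \<in> set ts \<Longrightarrow> range e \<subseteq> Univ M \<Longrightarrow> range e' \<subseteq> Univ M \<Longrightarrow>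
    (\<forall>i\<in>trm_vars t. Metr M (e i) (e' i) < d t) \<Longrightarrow> Metr M (trm_val M e t) (trm_val M e' t) < \<epsilon>"
    by metis
  define \<delta> where "\<delta> = Min (insert 1 (d ` set ts))"
  have \<delta>: "\<delta> > 0" "\<And>t. t \<in> set ts \<Longrightarrow> \<delta> \<le> d t" using d(1) by (auto simp: \<delta>_def)
  show ?thesis
  proof (intro exI[of _ \<delta>] conjI \<delta>(1) allI impI ballI)
    fix e e' t
    assume *: "range e \<subseteq> Univ M \<and> range e' \<subseteq> Univ M \<and>
      (\<forall>i\<in>\<Union> (set (map trm_vars ts)). Metr M (e i) (e' i) < \<delta>)" and t: "t \<in> set ts"
    have "Metr M (e i) (e' i) < d t" if "i \<in> trm_vars t" for i
      using * t that \<delta>(2)[OF t] by fastforce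
    with * t show "Metr M (trm_val M e t) (trm_val M e' t) < \<epsilon>" by (intro d(2)) auto
  qed
qed

text \<open>A quantified variable gets the same value under both assignments, so quantifiers cost
  nothing; a connective is uniformly continuous near the cube containing the values of its
  arguments.\<close>

lemma fm_val_uniform:
  assumes "wf_fm L \<phi>" "\<epsilon> > 0"
  shows "\<exists>\<delta>>0. \<forall>e e'. range e \<subseteq> Univ M \<and> range e' \<subseteq> Univ M \<and>
    (\<forall>i\<in>free_vars \<phi>. Metr M (e i) (e' i) < \<delta>) \<longrightarrow> \<bar>fm_val M \<phi> e - fm_val M \<phi> e'\<bar> \<le> \<epsilon>"
  using assms
proof (induction \<phi> arbitrary: \<epsilon>)
  case (Dist s t)
  obtain \<delta> where "\<delta> > 0" and \<delta>: "\<forall>e e'. range e \<subseteq> Univ M \<and> range e' \<subseteq> Univ M \<and>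
    (\<forall>i\<in>\<Union> (set (map trm_vars [s, t])). Metr M (e i) (e' i) < \<delta>) \<longrightarrow>
    (\<forall>t\<in>set [s, t]. Metr M (trm_val M e t) (trm_val M e' t) < \<epsilon> / 2)"
    using trm_vals_uniform[of "[s, t]" "\<epsilon> / 2"] Dist by auto
  have "\<bar>fm_val M (Dist s t) e - fm_val M (Dist s t) e'\<bar> \<le> \<epsilon>"
    if *: "range e \<subseteq> Univ M" "range e' \<subseteq> Univ M" "\<forall>i\<in>free_vars (Dist s t). Metr M (e i) (e' i) < \<delta>"
    for e e'
  proof -
    have in_M: "trm_val M e s \<in> Univ M" "trm_val M e t \<in> Univ M" "trm_val M e' s \<in> Univ M"
      "trm_val M e' t \<in> Univ M" using * Dist by (auto intro: trm_val_in_Univ)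
    have "Metr M (trm_val M e s) (trm_val M e' s) < \<epsilon> / 2"
      "Metr M (trm_val M e t) (trm_val M e' t) < \<epsilon> / 2" using \<delta> * by auto
    then show ?thesis
      using triangle[of "trm_val M e s" "trm_val M e' s" "trm_val M e t"]
        triangle[of "trm_val M e' s" "trm_val M e' t" "trm_val M e t"]
        triangle[of "trm_val M e' s" "trm_val M e s" "trm_val M e' t"]
        triangle[of "trm_val M e s" "trm_val M e t" "trm_val M e' t"] in_M
        commute[of "trm_val M e s" "trm_val M e' s"] commute[of "trm_val M e t" "trm_val M e' t"]
      by simp
  qed
  then show ?case by (intro exI[of _ \<delta>] conjI \<open>\<delta> > 0\<close> allI impI) simp
next
  case (Pred P ts)
  have "list_all (wf_trm L) ts" "Pred_modulus L P \<epsilon> > 0" using Pred modulus_pos by auto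
  from trm_vals_uniform[OF this]
  obtain \<delta> where "\<delta> > 0" and \<delta>: "\<forall>e e'. range e \<subseteq> Univ M \<and> range e' \<subseteq> Univ M \<and>
    (\<forall>i\<in>\<Union> (set (map trm_vars ts)). Metr M (e i) (e' i) < \<delta>) \<longrightarrow>
    (\<forall>t\<in>set ts. Metr M (trm_val M e t) (trm_val M e' t) < Pred_modulus L P \<epsilon>)"
    by auto
  have "\<bar>fm_val M (Pred P ts) e - fm_val M (Pred P ts) e'\<bar> \<le> \<epsilon>"
    if *: "range e \<subseteq> Univ M" "range e' \<subseteq> Univ M" "\<forall>i\<in>free_vars (Pred P ts). Metr M (e i) (e' i) < \<delta>"
    for e e'
    unfolding fm_val.simps using Pred \<delta> *
    by (intro Pred_continuous trm_vals_in_tuples) auto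
  then show ?case by (intro exI[of _ \<delta>] conjI \<open>\<delta> > 0\<close> allI impI) simp
next
  case (Conn u \<phi>s)
  have wf: "wf_fm L \<phi>" if "\<phi> \<in> set \<phi>s" for \<phi> using Conn.prems that by (auto simp: list_all_iff)
  obtain B where B: "\<And>\<phi> e. \<phi> \<in> set \<phi>s \<Longrightarrow> range e \<subseteq> Univ M \<Longrightarrow> \<bar>fm_val M \<phi> e\<bar> \<le> B"
    using fm_vals_bounded[of \<phi>s] Conn.prems(1) by auto
  obtain \<mu> where "\<mu> > 0" and \<mu>: "\<And>xs ys. length xs = length \<phi>s \<Longrightarrow> length ys = length \<phi>s \<Longrightarrow>
    (\<forall>i<length \<phi>s. \<bar>xs ! i\<bar> \<le> B) \<Longrightarrow>
    (\<forall>i<length \<phi>s. \<bar>xs ! i - ys ! i\<bar> < \<mu>) \<Longrightarrow> \<bar>u xs - u ys\<bar> < \<epsilon>"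
    using connective_uniform[where n = "length \<phi>s" and u = u and \<epsilon> = \<epsilon> and B = B] Conn.prems by auto
  have "\<forall>\<phi>\<in>set \<phi>s. \<exists>\<delta>>0. \<forall>e e'. range e \<subseteq> Univ M \<and> range e' \<subseteq> Univ M \<and>
    (\<forall>i\<in>free_vars \<phi>. Metr M (e i) (e' i) < \<delta>) \<longrightarrow> \<bar>fm_val M \<phi> e - fm_val M \<phi> e'\<bar> \<le> \<mu> / 2"
    using Conn.IH[of _ "\<mu> / 2"] wf \<open>\<mu> > 0\<close> by (simp del: le_divide_eq_numeral1)
  then obtain d where d: "\<And>\<phi>. \<phi> \<in> set \<phi>s \<Longrightarrow> d \<phi> > 0"
    "\<And>\<phi> e e'. \<phi> \<in> set \<phi>s \<Longrightarrow> range e \<subseteq> Univ M \<Longrightarrow> range e' \<subseteq> Univ M \<Longrightarrow>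
    (\<forall>i\<in>free_vars \<phi>. Metr M (e i) (e' i) < d \<phi>) \<Longrightarrow> \<bar>fm_val M \<phi> e - fm_val M \<phi> e'\<bar> \<le> \<mu> / 2"
    by metis
  define \<delta> where "\<delta> = Min (insert 1 (d ` set \<phi>s))"
  have \<delta>: "\<delta> > 0" "\<And>t. t \<in> set \<phi>s \<Longrightarrow> \<delta> \<le> d t" using d(1) by (auto simp: \<delta>_def)
  have "\<bar>fm_val M (Conn u \<phi>s) e - fm_val M (Conn u \<phi>s) e'\<bar> \<le> \<epsilon>"
    if *: "range e \<subseteq> Univ M" "range e' \<subseteq> Univ M" "\<forall>i\<in>free_vars (Conn u \<phi>s). Metr M (e i) (e' i) < \<delta>"
    for e e'
  proof -
    have "\<bar>fm_val M \<phi> e - fm_val M \<phi> e'\<bar> < \<mu>" if \<phi>: "\<phi> \<in> set \<phi>s" for \<phi>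
    proof -
      have "Metr M (e i) (e' i) < d \<phi>" if "i \<in> free_vars \<phi>" for i
        using * \<phi> that \<delta>(2)[OF \<phi>] by fastforce
      then have "\<bar>fm_val M \<phi> e - fm_val M \<phi> e'\<bar> \<le> \<mu> / 2" using * \<phi> by (intro d(2)) auto
      with \<open>\<mu> > 0\<close> show ?thesis by simp
    qed
    then have "\<bar>u (map (\<lambda>\<phi>. fm_val M \<phi> e) \<phi>s) - u (map (\<lambda>\<phi>. fm_val M \<phi> e') \<phi>s)\<bar> < \<epsilon>"
      using B * by (intro \<mu>) auto
    then show ?thesis by (simp add: comp_def)
  qed
  then show ?case by (intro exI[of _ \<delta>] conjI \<open>\<delta> > 0\<close> allI impI) simp
next
  case (SupQ n \<phi>)
  have "wf_fm L \<phi>" using SupQ.prems by simp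
  from SupQ.IH[OF this \<open>\<epsilon> > 0\<close>]
  obtain \<delta> where "\<delta> > 0" and \<delta>: "\<And>e e'. range e \<subseteq> Univ M \<and> range e' \<subseteq> Univ M \<and>
    (\<forall>i\<in>free_vars \<phi>. Metr M (e i) (e' i) < \<delta>) \<Longrightarrow> \<bar>fm_val M \<phi> e - fm_val M \<phi> e'\<bar> \<le> \<epsilon>"
    by blast
  obtain B where B: "\<And>e. range e \<subseteq> Univ M \<Longrightarrow> \<bar>fm_val M \<phi> e\<bar> \<le> B"
    using fm_val_bounded[OF \<open>wf_fm L \<phi>\<close>] by blast
  have "\<bar>fm_val M (SupQ n \<phi>) e - fm_val M (SupQ n \<phi>) e'\<bar> \<le> \<epsilon>"
    if *: "range e \<subseteq> Univ M" "range e' \<subseteq> Univ M" "\<forall>i\<in>free_vars (SupQ n \<phi>). Metr M (e i) (e' i) < \<delta>"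
    for e e'
    unfolding fm_val.simps using * \<open>\<delta> > 0\<close>
    by (intro SUP_INF_diff_le(1)[where B = B] Univ_nonempty \<delta> B conjI range_fun_upd_subset) auto
  then show ?case by (intro exI[of _ \<delta>] conjI \<open>\<delta> > 0\<close> allI impI) simp
next
  case (InfQ n \<phi>)
  have "wf_fm L \<phi>" using InfQ.prems by simp
  from InfQ.IH[OF this \<open>\<epsilon> > 0\<close>]
  obtain \<delta> where "\<delta> > 0" and \<delta>: "\<And>e e'. range e \<subseteq> Univ M \<and> range e' \<subseteq> Univ M \<and>
    (\<forall>i\<in>free_vars \<phi>. Metr M (e i) (e' i) < \<delta>) \<Longrightarrow> \<bar>fm_val M \<phi> e - fm_val M \<phi> e'\<bar> \<le> \<epsilon>"
    by blast
  obtain B where B: "\<And>e. range e \<subseteq> Univ M \<Longrightarrow> \<bar>fm_val M \<phi> e\<bar> \<le> B"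
    using fm_val_bounded[OF \<open>wf_fm L \<phi>\<close>] by blast
  have "\<bar>fm_val M (InfQ n \<phi>) e - fm_val M (InfQ n \<phi>) e'\<bar> \<le> \<epsilon>"
    if *: "range e \<subseteq> Univ M" "range e' \<subseteq> Univ M" "\<forall>i\<in>free_vars (InfQ n \<phi>). Metr M (e i) (e' i) < \<delta>"
    for e e'
    unfolding fm_val.simps using * \<open>\<delta> > 0\<close>
    by (intro SUP_INF_diff_le(2)[where B = B] Univ_nonempty \<delta> B conjI range_fun_upd_subset) auto
  then show ?case by (intro exI[of _ \<delta>] conjI \<open>\<delta> > 0\<close> allI impI) simp
qed

end

section \<open>Ultrapowers\<close>

context language_structure
begin

definition useqs :: "(nat \<Rightarrow> 'a) set" where
  "useqs = {x. range x \<subseteq> Univ M}"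

text \<open>The cut at the diameter changes nothing on sequences in the universe, but makes the
  limit exist for all sequences, so that nonnegativity holds off the carrier too, as
  \<open>Metric_space\<close> demands.\<close>

definition udist :: "(nat \<Rightarrow> 'a) \<Rightarrow> (nat \<Rightarrow> 'a) \<Rightarrow> real" where
  "udist x y = ulim (\<lambda>n. min (Diameter L) (Metr M (x n) (y n)))"

text \<open>One chosen sequence per class of sequences at distance 0, so that points of the
  ultrapower are sequences instead of classes.\<close>

definition urep :: "(nat \<Rightarrow> 'a) \<Rightarrow> nat \<Rightarrow> 'a" where
  "urep x = (SOME y. y \<in> useqs \<and> udist x y = 0)"

lemma useqsD: "x \<in> useqs \<Longrightarrow> x n \<in> Univ M"
  by (auto simp: useqs_def)

lemma tendsto_min_udist: "((\<lambda>n. min (Diameter L) (Metr M (x n) (y n))) \<longlongrightarrow> udist x y) ultra"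
  and udist_nonneg: "0 \<le> udist x y"
proof -
  obtain a where "a \<in> Univ M" using Univ_nonempty by blast
  then have D: "0 \<le> Diameter L" using Metr_le[of a a] by simp
  then show lim: "((\<lambda>n. min (Diameter L) (Metr M (x n) (y n))) \<longlongrightarrow> udist x y) ultra"
    unfolding udist_def by (intro tendsto_ulim[of _ "Diameter L"] always_eventually)
      (auto simp: abs_le_iff min_def intro: order_trans[of _ 0])
  show "0 \<le> udist x y"
    by (rule tendsto_lowerbound[OF lim _ ultra(2)]) (use D in auto)
qed

lemma tendsto_udist:
  assumes "x \<in> useqs" "y \<in> useqs"
  shows "((\<lambda>n. Metr M (x n) (y n)) \<longlongrightarrow> udist x y) ultra"
  using tendsto_min_udist[of x y] Metr_le[OF useqsD[OF assms(1)] useqsD[OF assms(2)]]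
  by (simp add: min_absorb2)

lemma udist_commute: "udist x y = udist y x"
  by (simp add: udist_def commute)

lemma udist_refl: "x \<in> useqs \<Longrightarrow> udist x x = 0"
  using tendsto_udist[of x x] useqsD[of x] tendsto_unique[OF ultra(2) _ tendsto_const] by simp

lemma udist_triangle:
  assumes "x \<in> useqs" "y \<in> useqs" "z \<in> useqs"
  shows "udist x z \<le> udist x y + udist y z"
  by (rule tendsto_le[OF ultra(2) tendsto_add[OF tendsto_udist[OF assms(1,2)]
          tendsto_udist[OF assms(2,3)]] tendsto_udist[OF assms(1,3)]])
    (intro always_eventually allI triangle useqsD assms)

lemma udist_le:
  assumes "x \<in> useqs" "y \<in> useqs" "eventually (\<lambda>n. Metr M (x n) (y n) \<le> c) ultra"
  shows "udist x y \<le> c"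
  by (rule ulim_le[OF tendsto_udist[OF assms(1,2)] assms(3)])

lemma urep:
  assumes "x \<in> useqs"
  shows "urep x \<in> useqs" "udist x (urep x) = 0"
proof -
  have "\<exists>y. y \<in> useqs \<and> udist x y = 0" using assms udist_refl by blast
  from someI_ex[OF this] show "urep x \<in> useqs" "udist x (urep x) = 0"
    by (simp_all add: urep_def)
qed

lemma urep_eqI:
  assumes "x \<in> useqs" "y \<in> useqs" "udist x y = 0"
  shows "urep x = urep y"
proof -
  have "udist x z = 0 \<longleftrightarrow> udist y z = 0" if "z \<in> useqs" for z
    using udist_triangle[OF assms(1,2) that] udist_triangle[OF assms(2,1) that]
      udist_nonneg[of x z] udist_nonneg[of y z] assms(3) udist_commute[of x y]
    by linarith
  then have "(\<lambda>z. z \<in> useqs \<and> udist x z = 0) = (\<lambda>z. z \<in> useqs \<and> udist y z = 0)"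
    by blast
  then show ?thesis unfolding urep_def by simp
qed

lemma udist_urep:
  assumes "x \<in> useqs" "y \<in> useqs"
  shows "udist (urep x) (urep y) = udist x y"
  using udist_triangle[OF urep(1)[OF assms(1)] assms(1) urep(1)[OF assms(2)]]
    udist_triangle[OF assms(1,2) urep(1)[OF assms(2)]]
    udist_triangle[OF assms(1) urep(1)[OF assms(1)] assms(2)]
    udist_triangle[OF urep(1)[OF assms(1)] urep(1)[OF assms(2)] assms(2)]
    urep(2)[OF assms(1)] urep(2)[OF assms(2)] udist_commute[of x "urep x"]
    udist_commute[of y "urep y"]
  by linarith

definition ultrapower :: "(nat \<Rightarrow> 'a, 'f, 'p) metric_structure" where
  "ultrapower =
     \<lparr>Univ = urep ` useqs, Metr = udist,
      Fun_interp = (\<lambda>f xs. urep (\<lambda>n. Fun_interp M f (map (\<lambda>x. x n) xs))),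
      Pred_interp = (\<lambda>P xs. ulim (\<lambda>n. Pred_interp M P (map (\<lambda>x. x n) xs)))\<rparr>"

lemma ultrapower_simps:
  "Univ ultrapower = urep ` useqs" "Metr ultrapower = udist"
  "Fun_interp ultrapower = (\<lambda>f xs. urep (\<lambda>n. Fun_interp M f (map (\<lambda>x. x n) xs)))"
  "Pred_interp ultrapower = (\<lambda>P xs. ulim (\<lambda>n. Pred_interp M P (map (\<lambda>x. x n) xs)))"
  by (simp_all add: ultrapower_def)

lemma Univ_ultrapower_useqs: "x \<in> Univ ultrapower \<Longrightarrow> x \<in> useqs"
  by (auto simp: ultrapower_simps intro: urep)

lemma urep_Univ_ultrapower: "x \<in> Univ ultrapower \<Longrightarrow> urep x = x"
  by (auto simp: ultrapower_simps intro!: urep_eqI urep simp: udist_commute[of "urep _"])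

lemma urep_in_Univ: "x \<in> useqs \<Longrightarrow> urep x \<in> Univ ultrapower"
  by (simp add: ultrapower_simps)

lemma Metric_space_ultrapower: "Metric_space (Univ ultrapower) (Metr ultrapower)"
proof
  fix x y z
  show "0 \<le> Metr ultrapower x y"
    by (simp add: ultrapower_simps udist_nonneg)
  show "Metr ultrapower x y = Metr ultrapower y x"
    by (simp add: ultrapower_simps udist_commute)
  show "Metr ultrapower x y = 0 \<longleftrightarrow> x = y" if "x \<in> Univ ultrapower" "y \<in> Univ ultrapower"
    using that urep_eqI[of x y] urep_Univ_ultrapower Univ_ultrapower_useqs udist_refl
    by (auto simp: ultrapower_simps(2))
  show "Metr ultrapower x z \<le> Metr ultrapower x y + Metr ultrapower y z"
    if "x \<in> Univ ultrapower" "y \<in> Univ ultrapower" "z \<in> Univ ultrapower"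
    using that by (auto simp: ultrapower_simps(2) intro!: udist_triangle Univ_ultrapower_useqs)
qed

lemma tuple_ultrapower_component:
  assumes "xs \<in> tuples (Univ ultrapower) k"
  shows "map (\<lambda>x. x n) xs \<in> tuples (Univ M) k"
  using assms Univ_ultrapower_useqs useqsD by (fastforce simp: tuples_def)

lemma eventually_tuples_close:
  assumes "xs \<in> tuples (Univ ultrapower) k" "ys \<in> tuples (Univ ultrapower) k"
    "\<And>i. i < k \<Longrightarrow> udist (xs ! i) (ys ! i) < \<mu>"
  shows "eventually (\<lambda>n. \<forall>i<k. Metr M (map (\<lambda>x. x n) xs ! i) (map (\<lambda>x. x n) ys ! i) < \<mu>) ultra"
proof -
  have "eventually (\<lambda>n. \<forall>i\<in>{..<k}. Metr M ((xs ! i) n) ((ys ! i) n) < \<mu>) ultra"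
  proof (intro eventually_ball_finite ballI)
    fix i assume "i \<in> {..<k}"
    then have "xs ! i \<in> useqs" "ys ! i \<in> useqs"
      using assms(1,2) by (auto simp: tuples_def intro!: Univ_ultrapower_useqs)
    from order_tendstoD(2)[OF tendsto_udist[OF this]]
    show "eventually (\<lambda>n. Metr M ((xs ! i) n) ((ys ! i) n) < \<mu>) ultra"
      using assms(3) \<open>i \<in> {..<k}\<close> by simp
  qed simp
  then show ?thesis
    by eventually_elim (use assms in \<open>auto simp: tuples_def\<close>)
qed

lemma Fun_ultrapower_useqs:
  assumes "f \<in> Funs L" "xs \<in> tuples (Univ ultrapower) (Fun_arity L f)"
  shows "(\<lambda>n. Fun_interp M f (map (\<lambda>x. x n) xs)) \<in> useqs"
  using Fun_in_Univ[OF assms(1) tuple_ultrapower_component[OF assms(2)]] by (auto simp: useqs_def)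

text \<open>A diagonal argument: along a fast Cauchy subsequence \<open>x\<close>, coordinate
  \<open>n\<close> of the limit is taken from the furthest \<open>x k\<close> up to which all
  increments at \<open>n\<close> are geometrically small.\<close>

lemma mcomplete_ultrapower: "Metric_space.mcomplete (Univ ultrapower) (Metr ultrapower)"
proof -
  interpret U: Metric_space "Univ ultrapower" "Metr ultrapower"
    by (rule Metric_space_ultrapower)
  show ?thesis
    unfolding U.mcomplete_def
  proof (intro allI impI)
    fix \<sigma> assume \<sigma>: "U.MCauchy \<sigma>"
    then have s: "\<sigma> n \<in> useqs" for n
      by (auto simp: U.MCauchy_def intro!: Univ_ultrapower_useqs)
    have "\<forall>k. \<exists>N. \<forall>n n'. N \<le> n \<longrightarrow> N \<le> n' \<longrightarrow> udist (\<sigma> n) (\<sigma> n') < (1 / 2) ^ k"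
      using \<sigma>[unfolded U.MCauchy_def, THEN conjunct2] by (simp add: ultrapower_simps(2))
    then obtain N where N: "\<And>k n n'. N k \<le> n \<Longrightarrow> N k \<le> n' \<Longrightarrow> udist (\<sigma> n) (\<sigma> n') < (1 / 2) ^ k"
      by metis
    \<comment> \<open>Summing makes the indices nondecreasing while they still dominate
      \<open>N\<close>.\<close>
    define R where "R k = (\<Sum>i\<le>k. N i)" for k
    have R: "N k \<le> R k" "R k \<le> R (Suc k)" for k
      by (auto simp: R_def intro: member_le_sum)
    define x where "x k = \<sigma> (R k)" for k
    have x: "x k \<in> useqs" for k by (simp add: x_def s)
    have close: "udist (x k) (x (Suc k)) < (1 / 2) ^ k" for k
      unfolding x_def using R[of k] by (intro N) auto
    \<comment> \<open>The cap \<open>k \<le> n\<close> makes the set finite; for fixed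
      \<open>k\<close> it is harmless, since almost all \<open>n\<close> exceed
      \<open>k\<close>.\<close>
    define S where "S n = {k. k \<le> n \<and> (\<forall>i<k. Metr M (x i n) (x (Suc i) n) < (1 / 2) ^ i)}" for n
    have S: "finite (S n)" "0 \<in> S n" for n by (auto simp: S_def)
    define y where "y n = x (Max (S n)) n" for n
    have y: "y \<in> useqs" using x useqsD by (auto simp: useqs_def y_def)
    have tele: "Metr M (x k n) (x j n) \<le> 2 * (1 / 2) ^ k - 2 * (1 / 2) ^ j"
      if "k \<le> j" "\<forall>i<j. Metr M (x i n) (x (Suc i) n) < (1 / 2) ^ i" for k j n
      using that
    proof (induction j rule: dec_induct)
      case base
      then show ?case using x useqsD by simp
    next
      case (step j)
      then have "Metr M (x k n) (x j n) \<le> 2 * (1 / 2) ^ k - 2 * (1 / 2) ^ j"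
        "Metr M (x j n) (x (Suc j) n) < (1 / 2) ^ j" by auto
      then show ?case
        using triangle[of "x k n" "x j n" "x (Suc j) n"] useqsD[OF x] by simp
    qed
    have xy: "udist (x k) y \<le> 2 * (1 / 2) ^ k" for k
    proof (rule udist_le[OF x y])
      have "eventually (\<lambda>n. \<forall>i\<in>{..<k}. Metr M (x i n) (x (Suc i) n) < (1 / 2) ^ i) ultra"
        by (intro eventually_ball_finite ballI order_tendstoD(2)[OF tendsto_udist[OF x x]] close) simp
      then show "eventually (\<lambda>n. Metr M (x k n) (y n) \<le> 2 * (1 / 2) ^ k) ultra"
        using eventually_ultra_ge[of k]
      proof eventually_elim
        case (elim n)
        then have "k \<in> S n" by (auto simp: S_def)
        then have "k \<le> Max (S n)" "Max (S n) \<in> S n"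
          using S by (auto intro: Max_in)
        then have "Metr M (x k n) (y n) \<le> 2 * (1 / 2) ^ k - 2 * (1 / 2) ^ Max (S n)"
          unfolding y_def by (intro tele) (auto simp: S_def)
        also have "\<dots> \<le> 2 * (1 / 2) ^ k" by simp
        finally show ?case .
      qed
    qed
    have "limitin U.mtopology \<sigma> (urep y) sequentially"
      unfolding U.limit_metric_sequentially
    proof (intro conjI allI impI)
      show "urep y \<in> Univ ultrapower" by (rule urep_in_Univ[OF y])
      fix \<epsilon> :: real assume "\<epsilon> > 0"
      then obtain k where k: "(1 / 2) ^ k < \<epsilon> / 3"
        using real_arch_pow_inv[of "\<epsilon> / 3" "1 / 2"] by auto
      have "udist (\<sigma> n) (urep y) < \<epsilon>" if "n \<ge> R k" for n
      proof -
        have "udist (\<sigma> n) (x k) < (1 / 2) ^ k"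
          unfolding x_def using R(1)[of k] that by (intro N) auto
        then show ?thesis
          using udist_triangle[OF s x y, of n k] udist_triangle[OF s y urep(1)[OF y], of n]
            urep(2)[OF y] xy[of k] k by linarith
      qed
      then show "\<exists>N. \<forall>n\<ge>N. \<sigma> n \<in> Univ ultrapower \<and> Metr ultrapower (\<sigma> n) (urep y) < \<epsilon>"
        using \<sigma>[unfolded U.MCauchy_def, THEN conjunct1]
        by (intro exI[of _ "R k"]) (auto simp: ultrapower_simps(2))
    qed
    then show "\<exists>x. limitin U.mtopology \<sigma> x sequentially" by blast
  qed
qed

lemma Pred_ultrapower_tendsto:
  assumes "P \<in> Preds L" "xs \<in> tuples (Univ ultrapower) (Pred_arity L P)"
  shows "((\<lambda>n. Pred_interp M P (map (\<lambda>x. x n) xs)) \<longlongrightarrow> Pred_interp ultrapower P xs) ultra"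
  unfolding ultrapower_simps
proof (rule tendsto_ulim[of _ "max \<bar>Pred_lower L P\<bar> \<bar>Pred_upper L P\<bar>"], rule always_eventually, rule allI)
  fix n
  show "\<bar>Pred_interp M P (map (\<lambda>x. x n) xs)\<bar> \<le> max \<bar>Pred_lower L P\<bar> \<bar>Pred_upper L P\<bar>"
    using Pred_bounds[OF assms(1) tuple_ultrapower_component[OF assms(2), of n]] by auto
qed

lemma is_structure_ultrapower: "is_structure L ultrapower"
  unfolding is_structure_def
proof (intro conjI ballI allI impI)
  obtain a where "a \<in> Univ M" using Univ_nonempty by blast
  then have "(\<lambda>_. a) \<in> useqs" by (auto simp: useqs_def)
  then show "Univ ultrapower \<noteq> {}" using urep_in_Univ by blast
  show "Metric_space (Univ ultrapower) (Metr ultrapower)"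
    by (rule Metric_space_ultrapower)
  show "Metric_space.mcomplete (Univ ultrapower) (Metr ultrapower)"
    by (rule mcomplete_ultrapower)
  show "Metr ultrapower x y \<le> Diameter L" if "x \<in> Univ ultrapower" "y \<in> Univ ultrapower" for x y
    using that unfolding ultrapower_simps(2)
    by (intro udist_le always_eventually allI Metr_le useqsD Univ_ultrapower_useqs)
  fix f xs assume f: "f \<in> Funs L" "xs \<in> tuples (Univ ultrapower) (Fun_arity L f)"
  show "Fun_interp ultrapower f xs \<in> Univ ultrapower"
    unfolding ultrapower_simps(3) by (intro urep_in_Univ Fun_ultrapower_useqs f)
  fix ys \<epsilon> assume ys: "ys \<in> tuples (Univ ultrapower) (Fun_arity L f)" and "(0 :: real) < \<epsilon>"
    and *: "\<forall>i<Fun_arity L f. Metr ultrapower (xs ! i) (ys ! i) < Fun_modulus L f \<epsilon>"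
  have "udist (\<lambda>n. Fun_interp M f (map (\<lambda>x. x n) xs)) (\<lambda>n. Fun_interp M f (map (\<lambda>x. x n) ys)) \<le> \<epsilon>"
  proof (rule udist_le[OF Fun_ultrapower_useqs Fun_ultrapower_useqs])
    have "eventually (\<lambda>n. \<forall>i<Fun_arity L f.
      Metr M (map (\<lambda>x. x n) xs ! i) (map (\<lambda>x. x n) ys ! i) < Fun_modulus L f \<epsilon>) ultra"
      using * by (intro eventually_tuples_close f ys) (simp add: ultrapower_simps)
    then show "eventually (\<lambda>n. Metr M (Fun_interp M f (map (\<lambda>x. x n) xs))
        (Fun_interp M f (map (\<lambda>x. x n) ys)) \<le> \<epsilon>) ultra"
      by eventually_elim
        (intro Fun_continuous f ys tuple_ultrapower_component \<open>0 < \<epsilon>\<close>, blast)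
  qed (use f ys in auto)
  then show "Metr ultrapower (Fun_interp ultrapower f xs) (Fun_interp ultrapower f ys) \<le> \<epsilon>"
    unfolding ultrapower_simps using f ys by (subst udist_urep) (auto intro!: Fun_ultrapower_useqs)
next
  fix P xs assume P: "P \<in> Preds L" "xs \<in> tuples (Univ ultrapower) (Pred_arity L P)"
  note lim = Pred_ultrapower_tendsto[OF P]
  have "Pred_interp M P (map (\<lambda>x. x n) xs) \<in> {Pred_lower L P..Pred_upper L P}" for n
    by (rule Pred_bounds[OF P(1) tuple_ultrapower_component[OF P(2)]])
  then show "Pred_interp ultrapower P xs \<in> {Pred_lower L P..Pred_upper L P}"
    using tendsto_lowerbound[OF lim _ ultra(2), of "Pred_lower L P"]
      tendsto_upperbound[OF lim _ ultra(2), of "Pred_upper L P"] by auto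
  fix ys \<epsilon> assume ys: "ys \<in> tuples (Univ ultrapower) (Pred_arity L P)" and "(0 :: real) < \<epsilon>"
    and *: "\<forall>i<Pred_arity L P. Metr ultrapower (xs ! i) (ys ! i) < Pred_modulus L P \<epsilon>"
  have "eventually (\<lambda>n. \<forall>i<Pred_arity L P.
    Metr M (map (\<lambda>x. x n) xs ! i) (map (\<lambda>x. x n) ys ! i) < Pred_modulus L P \<epsilon>) ultra"
    using * by (intro eventually_tuples_close P ys) (simp add: ultrapower_simps)
  then have "eventually (\<lambda>n. \<bar>Pred_interp M P (map (\<lambda>x. x n) xs) -
      Pred_interp M P (map (\<lambda>x. x n) ys)\<bar> \<le> \<epsilon>) ultra"
    by eventually_elim (intro Pred_continuous P ys tuple_ultrapower_component \<open>0 < \<epsilon>\<close>, blast)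
  then show "\<bar>Pred_interp ultrapower P xs - Pred_interp ultrapower P ys\<bar> \<le> \<epsilon>"
    by (rule ulim_le[OF tendsto_rabs[OF tendsto_diff[OF lim Pred_ultrapower_tendsto[OF P(1) ys]]]])
qed

text \<open>The ultrapower applies \<open>urep\<close> at every function symbol, so coordinatewise
  values agree with its values only up to distance 0; uniform continuity of the symbol absorbs this
  in the induction.\<close>

lemma trm_val_ultrapower:
  assumes "wf_trm L t" "range e \<subseteq> Univ ultrapower"
  shows "(\<lambda>n. trm_val M (\<lambda>i. e i n) t) \<in> useqs \<and>
    trm_val ultrapower e t = urep (\<lambda>n. trm_val M (\<lambda>i. e i n) t)"
  using assms(1)
proof (induction t)
  case (Var i)
  have "e i \<in> Univ ultrapower" using assms(2) by auto
  then show ?case using Univ_ultrapower_useqs urep_Univ_ultrapower by simp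
next
  case (Fn f ts)
  let ?s = "\<lambda>t n. trm_val M (\<lambda>i. e i n) t"
  have wf: "f \<in> Funs L" "length ts = Fun_arity L f" "\<And>t. t \<in> set ts \<Longrightarrow> wf_trm L t"
    using Fn.prems by (auto simp: list_all_iff)
  have IH: "?s t \<in> useqs" "trm_val ultrapower e t = urep (?s t)" if "t \<in> set ts" for t
    using Fn.IH[OF that wf(3)[OF that]] by auto
  have tup: "map (\<lambda>t. ?s t n) ts \<in> tuples (Univ M) (Fun_arity L f)"
      "map (\<lambda>t. urep (?s t) n) ts \<in> tuples (Univ M) (Fun_arity L f)" for n
    using IH(1) wf(2) urep(1)[OF IH(1)] useqsD by (auto simp: tuples_def)
  have 1: "(\<lambda>n. Fun_interp M f (map (\<lambda>t. ?s t n) ts)) \<in> useqs"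
    "(\<lambda>n. Fun_interp M f (map (\<lambda>t. urep (?s t) n) ts)) \<in> useqs"
    using Fun_in_Univ[OF wf(1)] tup by (auto simp: useqs_def)
  have "udist (\<lambda>n. Fun_interp M f (map (\<lambda>t. ?s t n) ts))
      (\<lambda>n. Fun_interp M f (map (\<lambda>t. urep (?s t) n) ts)) \<le> \<epsilon>" if "\<epsilon> > 0" for \<epsilon>
  proof (rule udist_le[OF 1])
    have "eventually (\<lambda>n. \<forall>t\<in>set ts. Metr M (?s t n) (urep (?s t) n) < Fun_modulus L f \<epsilon>) ultra"
      using urep IH(1) modulus_pos(1)[OF wf(1) that]
      by (intro eventually_ball_finite ballI order_tendstoD(2)[OF tendsto_udist]) auto
    then show "eventually (\<lambda>n. Metr M (Fun_interp M f (map (\<lambda>t. ?s t n) ts))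
      (Fun_interp M f (map (\<lambda>t. urep (?s t) n) ts)) \<le> \<epsilon>) ultra"
      by eventually_elim (intro Fun_continuous wf tup that, simp add: wf(2)[symmetric])
  qed
  then have "udist (\<lambda>n. Fun_interp M f (map (\<lambda>t. ?s t n) ts))
      (\<lambda>n. Fun_interp M f (map (\<lambda>t. urep (?s t) n) ts)) = 0"
    using field_le_epsilon[of _ 0, simplified] udist_nonneg by (meson antisym)
  from urep_eqI[OF 1 this] 1(1) IH(2) show ?case
    by (simp add: ultrapower_simps comp_def cong: map_cong)
qed

lemma tuples_trm_ultrapower:
  assumes "list_all (wf_trm L) ts" "length ts = k" "range e \<subseteq> Univ ultrapower"
  shows "map (trm_val ultrapower e) ts \<in> tuples (Univ ultrapower) k"
  using assms trm_val_ultrapower[OF _ assms(3)] by (auto simp: tuples_def list_all_iff urep_in_Univ)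

lemma fm_val_uniform_upd:
  assumes "wf_fm L \<phi>" "\<epsilon> > 0"
  shows "\<exists>\<delta>>0. \<forall>e a b. range e \<subseteq> Univ M \<and> a \<in> Univ M \<and> b \<in> Univ M \<and> Metr M a b < \<delta> \<longrightarrow>
    \<bar>fm_val M \<phi> (e(j := a)) - fm_val M \<phi> (e(j := b))\<bar> \<le> \<epsilon>"
proof -
  obtain \<delta> where "\<delta> > 0" and \<delta>: "\<And>e e'. range e \<subseteq> Univ M \<and> range e' \<subseteq> Univ M \<and>
    (\<forall>i\<in>free_vars \<phi>. Metr M (e i) (e' i) < \<delta>) \<Longrightarrow> \<bar>fm_val M \<phi> e - fm_val M \<phi> e'\<bar> \<le> \<epsilon>"
    using fm_val_uniform[OF assms] by blast
  have "\<bar>fm_val M \<phi> (e(j := a)) - fm_val M \<phi> (e(j := b))\<bar> \<le> \<epsilon>"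
    if "range e \<subseteq> Univ M" "a \<in> Univ M" "b \<in> Univ M" "Metr M a b < \<delta>" for e a b
    using that \<open>\<delta> > 0\<close> by (intro \<delta> conjI range_fun_upd_subset ballI) (auto simp: image_subset_iff)
  with \<open>\<delta> > 0\<close> show ?thesis by auto
qed

lemma Pred_ultrapower:
  assumes "wf_fm L (Pred P ts)" "range e \<subseteq> Univ ultrapower"
  shows "((\<lambda>n. fm_val M (Pred P ts) (\<lambda>i. e i n)) \<longlongrightarrow> fm_val ultrapower (Pred P ts) e) ultra"
proof -
  let ?s = "\<lambda>t n. trm_val M (\<lambda>i. e i n) t"
  have wf: "P \<in> Preds L" "length ts = Pred_arity L P" "list_all (wf_trm L) ts"
    using assms(1) by auto
  have IH: "?s t \<in> useqs" "trm_val ultrapower e t = urep (?s t)" if "t \<in> set ts" for t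
    using trm_val_ultrapower[OF _ assms(2), of t] wf(3) that by (auto simp: list_all_iff)
  have tup: "map (\<lambda>t. ?s t n) ts \<in> tuples (Univ M) (Pred_arity L P)"
      "map (\<lambda>t. urep (?s t) n) ts \<in> tuples (Univ M) (Pred_arity L P)" for n
    using IH(1) wf(2) urep(1)[OF IH(1)] useqsD by (auto simp: tuples_def)
  have "((\<lambda>n. Pred_interp M P (map (\<lambda>x. x n) (map (trm_val ultrapower e) ts))) \<longlongrightarrow>
      fm_val ultrapower (Pred P ts) e) ultra"
    unfolding fm_val.simps by (intro Pred_ultrapower_tendsto tuples_trm_ultrapower wf assms)
  then have lim: "((\<lambda>n. Pred_interp M P (map (\<lambda>t. urep (?s t) n) ts)) \<longlongrightarrow>
      fm_val ultrapower (Pred P ts) e) ultra"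
    using IH(2) by (simp add: comp_def cong: map_cong)
  have "((\<lambda>n. Pred_interp M P (map (\<lambda>t. ?s t n) ts) -
      Pred_interp M P (map (\<lambda>t. urep (?s t) n) ts)) \<longlongrightarrow> 0) ultra"
  proof (rule tendstoI)
    fix \<epsilon> :: real assume "\<epsilon> > 0"
    then have "\<epsilon> / 2 > 0" by simp
    have "eventually (\<lambda>n. \<forall>t\<in>set ts. Metr M (?s t n) (urep (?s t) n) < Pred_modulus L P (\<epsilon> / 2)) ultra"
      using urep IH(1) modulus_pos(2)[OF wf(1) \<open>\<epsilon> / 2 > 0\<close>]
      by (intro eventually_ball_finite ballI order_tendstoD(2)[OF tendsto_udist]) auto
    then show "eventually (\<lambda>n. dist (Pred_interp M P (map (\<lambda>t. ?s t n) ts) -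
      Pred_interp M P (map (\<lambda>t. urep (?s t) n) ts)) 0 < \<epsilon>) ultra"
    proof eventually_elim
      case (elim n)
      have "\<bar>Pred_interp M P (map (\<lambda>t. ?s t n) ts) -
        Pred_interp M P (map (\<lambda>t. urep (?s t) n) ts)\<bar> \<le> \<epsilon> / 2"
        by (intro Pred_continuous wf tup \<open>\<epsilon> / 2 > 0\<close>) (use elim in \<open>simp add: wf(2)[symmetric]\<close>)
      with \<open>\<epsilon> > 0\<close> show ?case by simp
    qed
  qed
  from tendsto_add[OF lim this] show ?thesis by (simp add: comp_def)
qed

text \<open>The quantifier step of Los's theorem, with abstract \<open>F\<close> and
  \<open>G\<close> so that the infimum follows by negation. Coordinatewise near-maximisers with
  error 1/(n+1) form one sequence, and the error vanishes because the ultrafilter is free. Uniform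
  continuity is what permits replacing this sequence by its representative.\<close>

lemma Sup_ultrapower:
  fixes F :: "(nat \<Rightarrow> 'a) \<Rightarrow> real" and G :: "(nat \<Rightarrow> nat \<Rightarrow> 'a) \<Rightarrow> real"
  assumes e0: "range e \<subseteq> Univ ultrapower"
    and IH: "\<And>e. range e \<subseteq> Univ ultrapower \<Longrightarrow> ((\<lambda>n. F (\<lambda>i. e i n)) \<longlongrightarrow> G e) ultra"
    and B: "\<And>e. range e \<subseteq> Univ M \<Longrightarrow> \<bar>F e\<bar> \<le> B"
    and unif: "\<And>\<epsilon>. \<epsilon> > 0 \<Longrightarrow> \<exists>\<delta>>0. \<forall>e a b. range e \<subseteq> Univ M \<and> a \<in> Univ M \<and> b \<in> Univ M \<and>
      Metr M a b < \<delta> \<longrightarrow> \<bar>F (e(j := a)) - F (e(j := b))\<bar> \<le> \<epsilon>"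
  shows "((\<lambda>n. SUP a\<in>Univ M. F ((\<lambda>i. e i n)(j := a))) \<longlongrightarrow>
    (SUP a\<in>Univ ultrapower. G (e(j := a)))) ultra"
proof -
  define g where "g n = (SUP a\<in>Univ M. F ((\<lambda>i. e i n)(j := a)))" for n
  have e: "range (\<lambda>i. e i n) \<subseteq> Univ M" for n
    using e0 Univ_ultrapower_useqs useqsD by (auto simp: image_subset_iff)
  have bdd: "bdd_above ((\<lambda>a. F ((\<lambda>i. e i n)(j := a))) ` Univ M)" for n
    using B[OF range_fun_upd_subset[OF e]] by (intro bdd_aboveI2[of _ _ B]) (auto simp: abs_le_iff)
  have up: "F ((\<lambda>i. e i n)(j := a)) \<le> g n" if "a \<in> Univ M" for a n
    unfolding g_def by (rule cSUP_upper[OF that bdd])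
  have "\<bar>g n\<bar> \<le> B" for n
    unfolding g_def
    by (rule cSup_abs_le) (use Univ_nonempty e in \<open>auto simp del: fun_upd_apply intro!: B[OF range_fun_upd_subset]\<close>)
  then have lim: "(g \<longlongrightarrow> ulim g) ultra"
    by (intro tendsto_ulim[of _ B]) simp
  have upd: "(\<lambda>i. (e(j := a)) i n) = (\<lambda>i. e i n)(j := a n)" for a n
    by auto
  have IH': "((\<lambda>n. F ((\<lambda>i. e i n)(j := a n))) \<longlongrightarrow> G (e(j := a))) ultra"
    if "a \<in> Univ ultrapower" for a
    using IH[OF range_fun_upd_subset[OF e0 that, where n = j]] unfolding upd .
  have le: "G (e(j := a)) \<le> ulim g" if "a \<in> Univ ultrapower" for a
    by (rule tendsto_le[OF ultra(2) lim IH'[OF that]])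
      (use up useqsD[OF Univ_ultrapower_useqs[OF that]] in simp)
  have "\<exists>a\<in>Univ M. g n - 1 / real (Suc n) < F ((\<lambda>i. e i n)(j := a))" for n
    using less_cSUP_iff[THEN iffD1, OF Univ_nonempty bdd[of n], of "g n - 1 / real (Suc n)"]
    unfolding g_def[symmetric] by simp
  then obtain a where a: "\<And>n. a n \<in> Univ M"
      "\<And>n. g n - 1 / real (Suc n) < F ((\<lambda>i. e i n)(j := a n))"
    by metis
  have au: "a \<in> useqs" using a(1) by (auto simp: useqs_def)
  have "((\<lambda>n. F ((\<lambda>i. e i n)(j := urep a n)) - F ((\<lambda>i. e i n)(j := a n))) \<longlongrightarrow> 0) ultra"
  proof (rule tendstoI)
    fix \<epsilon> :: real assume "\<epsilon> > 0"
    then obtain \<delta> where "\<delta> > 0" and \<delta>: "\<forall>e a b. range e \<subseteq> Univ M \<and> a \<in> Univ M \<and> b \<in> Univ M \<and>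
      Metr M a b < \<delta> \<longrightarrow> \<bar>F (e(j := a)) - F (e(j := b))\<bar> \<le> \<epsilon> / 2"
      using unif[of "\<epsilon> / 2"] by auto
    have "eventually (\<lambda>n. Metr M (urep a n) (a n) < \<delta>) ultra"
      using urep[OF au] \<open>\<delta> > 0\<close>
      by (intro order_tendstoD(2)[OF tendsto_udist] au) (auto simp: udist_commute)
    then show "eventually (\<lambda>n. dist (F ((\<lambda>i. e i n)(j := urep a n)) - F ((\<lambda>i. e i n)(j := a n))) 0 < \<epsilon>) ultra"
    proof eventually_elim
      case (elim n)
      then have "\<bar>F ((\<lambda>i. e i n)(j := urep a n)) - F ((\<lambda>i. e i n)(j := a n))\<bar> \<le> \<epsilon> / 2"
        using \<delta> e[of n] a(1)[of n] useqsD[OF urep(1)[OF au], of n] by blast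
      with \<open>\<epsilon> > 0\<close> show ?case by simp
    qed
  qed
  from tendsto_diff[OF IH'[OF urep_in_Univ[OF au]] this]
  have lima: "((\<lambda>n. F ((\<lambda>i. e i n)(j := a n))) \<longlongrightarrow> G (e(j := urep a))) ultra" by simp
  have "((\<lambda>n. 1 / real (Suc n)) \<longlongrightarrow> 0) ultra"
    by (rule tendsto_mono[OF ultra(1) lim_1_over_n[THEN LIMSEQ_Suc]])
  from tendsto_diff[OF lim this] have lim': "((\<lambda>n. g n - 1 / real (Suc n)) \<longlongrightarrow> ulim g) ultra" by simp
  have ge: "ulim g \<le> G (e(j := urep a))"
    by (rule tendsto_le[OF ultra(2) lima lim']) (intro always_eventually allI less_imp_le a(2))
  have "(SUP a\<in>Univ ultrapower. G (e(j := a))) = ulim g"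
  proof (rule antisym)
    show "(SUP a\<in>Univ ultrapower. G (e(j := a))) \<le> ulim g"
      using le urep_in_Univ[OF au] by (intro cSUP_least) auto
    show "ulim g \<le> (SUP a\<in>Univ ultrapower. G (e(j := a)))"
      using le by (intro order_trans[OF ge]
          cSUP_upper[where f = "\<lambda>a. G (e(j := a))", OF urep_in_Univ[OF au]] bdd_aboveI2[of _ _ "ulim g"]) auto
  qed
  with lim show ?thesis by (simp add: g_def[abs_def])
qed

text \<open>The continuous form of Los's theorem.\<close>

theorem fm_val_ultrapower:
  assumes "wf_fm L \<phi>" "range e \<subseteq> Univ ultrapower"
  shows "((\<lambda>n. fm_val M \<phi> (\<lambda>i. e i n)) \<longlongrightarrow> fm_val ultrapower \<phi> e) ultra"
  using assms
proof (induction \<phi> arbitrary: e)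
  case (Dist s t)
  have s: "(\<lambda>n. trm_val M (\<lambda>i. e i n) s) \<in> useqs"
    "trm_val ultrapower e s = urep (\<lambda>n. trm_val M (\<lambda>i. e i n) s)"
    and t: "(\<lambda>n. trm_val M (\<lambda>i. e i n) t) \<in> useqs"
    "trm_val ultrapower e t = urep (\<lambda>n. trm_val M (\<lambda>i. e i n) t)"
    using trm_val_ultrapower Dist by auto
  show ?case
    using tendsto_udist[OF s(1) t(1)] by (simp add: s(2) t(2) ultrapower_simps(2) udist_urep[OF s(1) t(1)])
next
  case (Pred P ts)
  then show ?case by (rule Pred_ultrapower)
next
  case (Conn u \<phi>s)
  have "((\<lambda>n. u (map (\<lambda>\<phi>. fm_val M \<phi> (\<lambda>i. e i n)) \<phi>s)) \<longlongrightarrow>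
      u (map (\<lambda>\<phi>. fm_val ultrapower \<phi> e) \<phi>s)) ultra"
  proof (rule tendsto_connective[where n = "length \<phi>s"])
    show "continuous_on UNIV (\<lambda>v :: nat \<Rightarrow> real. u (map v [0..<length \<phi>s]))"
      using Conn.prems(1) by simp
    fix i assume i: "i < length \<phi>s"
    then have "wf_fm L (\<phi>s ! i)" using Conn.prems(1) by (simp add: list_all_length)
    from Conn.IH[OF nth_mem[OF i] this Conn.prems(2)] i
    show "((\<lambda>n. map (\<lambda>\<phi>. fm_val M \<phi> (\<lambda>i. e i n)) \<phi>s ! i) \<longlongrightarrow>
      map (\<lambda>\<phi>. fm_val ultrapower \<phi> e) \<phi>s ! i) ultra" by simp
  qed simp_all
  then show ?case by (simp add: comp_def)
next
  case (SupQ j \<phi>)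
  have wf: "wf_fm L \<phi>" using SupQ.prems by simp
  obtain B where B: "\<And>e. range e \<subseteq> Univ M \<Longrightarrow> \<bar>fm_val M \<phi> e\<bar> \<le> B"
    using fm_val_bounded[OF wf] by blast
  show ?case
    unfolding fm_val.simps
    by (intro Sup_ultrapower[OF SupQ.prems(2) SupQ.IH[OF wf] B] fm_val_uniform_upd[OF wf])
next
  case (InfQ j \<phi>)
  have wf: "wf_fm L \<phi>" using InfQ.prems by simp
  obtain B where B: "\<And>e. range e \<subseteq> Univ M \<Longrightarrow> \<bar>fm_val M \<phi> e\<bar> \<le> B"
    using fm_val_bounded[OF wf] by blast
  have "((\<lambda>n. SUP a\<in>Univ M. - fm_val M \<phi> ((\<lambda>i. e i n)(j := a))) \<longlongrightarrow>
    (SUP a\<in>Univ ultrapower. - fm_val ultrapower \<phi> (e(j := a)))) ultra"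
  proof (rule Sup_ultrapower[OF InfQ.prems(2)])
    show "((\<lambda>n. - fm_val M \<phi> (\<lambda>i. e i n)) \<longlongrightarrow> - fm_val ultrapower \<phi> e) ultra"
      if "range e \<subseteq> Univ ultrapower" for e
      by (intro tendsto_minus InfQ.IH[OF wf that])
    show "\<bar>- fm_val M \<phi> e\<bar> \<le> B" if "range e \<subseteq> Univ M" for e
      using B[OF that] by simp
    show "\<exists>\<delta>>0. \<forall>e a b. range e \<subseteq> Univ M \<and> a \<in> Univ M \<and> b \<in> Univ M \<and> Metr M a b < \<delta> \<longrightarrow>
      \<bar>- fm_val M \<phi> (e(j := a)) - - fm_val M \<phi> (e(j := b))\<bar> \<le> \<epsilon>" if "\<epsilon> > 0" for \<epsilon>
      using fm_val_uniform_upd[OF wf that, of j] by (simp add: abs_minus_commute)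
  qed
  from tendsto_minus[OF this] show ?case
    by (simp add: Inf_real_def image_image)
qed

text \<open>Concrete sequences need not be the chosen representatives. Only the finitely many free
  variables matter, and replacing their values by representatives moves them by distances tending to
  0.\<close>

corollary fm_val_ultrapower_urep:
  assumes "wf_fm L \<phi>" "\<And>i. x i \<in> useqs"
  shows "((\<lambda>n. fm_val M \<phi> (\<lambda>i. x i n)) \<longlongrightarrow> fm_val ultrapower \<phi> (\<lambda>i. urep (x i))) ultra"
proof -
  have lim: "((\<lambda>n. fm_val M \<phi> (\<lambda>i. urep (x i) n)) \<longlongrightarrow> fm_val ultrapower \<phi> (\<lambda>i. urep (x i))) ultra"
    using assms(2) by (intro fm_val_ultrapower assms(1)) (auto intro: urep_in_Univ)
  have "((\<lambda>n. fm_val M \<phi> (\<lambda>i. x i n) - fm_val M \<phi> (\<lambda>i. urep (x i) n)) \<longlongrightarrow> 0) ultra"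
  proof (rule tendstoI)
    fix \<epsilon> :: real assume "\<epsilon> > 0"
    then have "\<epsilon> / 2 > 0" by simp
    then obtain \<delta> where "\<delta> > 0" and \<delta>: "\<And>e e'. range e \<subseteq> Univ M \<and> range e' \<subseteq> Univ M \<and>
      (\<forall>i\<in>free_vars \<phi>. Metr M (e i) (e' i) < \<delta>) \<Longrightarrow> \<bar>fm_val M \<phi> e - fm_val M \<phi> e'\<bar> \<le> \<epsilon> / 2"
      using fm_val_uniform[OF assms(1)] by meson
    have "eventually (\<lambda>n. \<forall>i\<in>free_vars \<phi>. Metr M (x i n) (urep (x i) n) < \<delta>) ultra"
      using urep[OF assms(2)] \<open>\<delta> > 0\<close>
      by (intro eventually_ball_finite finite_free_vars ballI order_tendstoD(2)[OF tendsto_udist] assms(2)) auto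
    then show "eventually (\<lambda>n. dist (fm_val M \<phi> (\<lambda>i. x i n) - fm_val M \<phi> (\<lambda>i. urep (x i) n)) 0 < \<epsilon>) ultra"
    proof eventually_elim
      case (elim n)
      have "range (\<lambda>i. x i n) \<subseteq> Univ M" "range (\<lambda>i. urep (x i) n) \<subseteq> Univ M"
        using useqsD[OF assms(2)] useqsD[OF urep(1)[OF assms(2)]] by blast+
      with elim have "\<bar>fm_val M \<phi> (\<lambda>i. x i n) - fm_val M \<phi> (\<lambda>i. urep (x i) n)\<bar> \<le> \<epsilon> / 2"
        by (intro \<delta>) simp
      with \<open>\<epsilon> > 0\<close> show ?case by simp
    qed
  qed
  from tendsto_add[OF lim this] show ?thesis by simp
qed

lemma satisfies_ultrapower:
  assumes "wf_fm L \<phi>" "satisfies M \<phi>"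
  shows "satisfies ultrapower \<phi>"
  unfolding satisfies_def
proof (intro allI impI)
  fix e :: "nat \<Rightarrow> nat \<Rightarrow> 'a" assume e: "range e \<subseteq> Univ ultrapower"
  then have "range (\<lambda>i. e i n) \<subseteq> Univ M" for n
    using useqsD[OF Univ_ultrapower_useqs] by blast
  then have "fm_val M \<phi> (\<lambda>i. e i n) = 0" for n
    by (rule assms(2)[unfolded satisfies_def, rule_format])
  with fm_val_ultrapower[OF assms(1) e] have "((\<lambda>_. 0) \<longlongrightarrow> fm_val ultrapower \<phi> e) ultra" by simp
  then show "fm_val ultrapower \<phi> e = 0"
    using tendsto_unique[OF ultra(2) _ tendsto_const] by blast
qed

end

section \<open>Downward Loewenheim-Skolem theorem\<close>

text \<open>
  There are uncountably many formulas because every continuous function is a connective, but up to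
  uniform approximation on a fixed structure it is enough to use the countably many connectives
  that round their arguments to a grid and then consult a finite table of rationals. These are not
  continuous, so the coded formulas need not be well-formed.
\<close>

instance trm :: (countable) countable
  by countable_datatype

datatype fm_code =
    CDist "nat trm" "nat trm"
  | CPred nat "nat trm list"
  | CTable nat "(int list \<times> rat) list" "fm_code list"
  | CSup nat fm_code
  | CInf nat fm_code

instance fm_code :: countable
  by countable_datatype

definition table_fun :: "nat \<Rightarrow> (int list \<times> rat) list \<Rightarrow> real list \<Rightarrow> real" where
  "table_fun k tab xs = (case map_of tab (map (\<lambda>x. \<lfloor>real k * x\<rfloor>) xs) of Some q \<Rightarrow> of_rat q | None \<Rightarrow> 0)"

primrec decode_fm :: "(nat \<Rightarrow> 'f) \<Rightarrow> (nat \<Rightarrow> 'p) \<Rightarrow> fm_code \<Rightarrow> ('f, 'p) fm" where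
  "decode_fm F P (CDist s t) = Dist (map_trm F s) (map_trm F t)"
| "decode_fm F P (CPred k ts) = Pred (P k) (map (map_trm F) ts)"
| "decode_fm F P (CTable k tab cs) = Conn (table_fun k tab) (map (decode_fm F P) cs)"
| "decode_fm F P (CSup n c) = SupQ n (decode_fm F P c)"
| "decode_fm F P (CInf n c) = InfQ n (decode_fm F P c)"

text \<open>Names for the points of an iterated Skolem hull: \<open>Base i\<close> is the i-th given
  point, and \<open>Witness c n k ts\<close> is a point minimising the coded formula
  \<open>c\<close> in variable \<open>n\<close> up to 1/(k+1), with the points named by
  \<open>ts\<close> as parameters. A countable datatype closes the given set under all these choices
  at once.\<close>

datatype witness = Base nat | Witness fm_code nat nat "witness list"

instance witness :: countable
  by countable_datatype

text \<open>By uniform continuity \<open>u\<close> is nearly constant on fine grid cells, and only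
  finitely many cells meet the cube. The slack between \<open>xs\<close> and \<open>ys\<close> is
  there because a coded connective receives arguments that are themselves approximations.\<close>

lemma table_fun_approx:
  fixes u :: "real list \<Rightarrow> real"
  assumes u: "continuous_on UNIV (\<lambda>v :: nat \<Rightarrow> real. u (map v [0..<n]))" and "\<epsilon> > 0"
  shows "\<exists>\<delta>>0. \<exists>k tab. \<forall>xs ys. length xs = n \<and> length ys = n \<and> (\<forall>i<n. \<bar>xs ! i\<bar> \<le> B) \<and>
    (\<forall>i<n. \<bar>xs ! i - ys ! i\<bar> \<le> \<delta>) \<longrightarrow> \<bar>u xs - table_fun k tab ys\<bar> \<le> \<epsilon>"
proof -
  obtain \<mu> where "\<mu> > 0" and \<mu>: "\<And>xs ys. length xs = n \<Longrightarrow> length ys = n \<Longrightarrow>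
    (\<forall>i<n. \<bar>xs ! i\<bar> \<le> B) \<Longrightarrow> (\<forall>i<n. \<bar>xs ! i - ys ! i\<bar> < \<mu>) \<Longrightarrow> \<bar>u xs - u ys\<bar> < \<epsilon> / 2"
    using connective_uniform[OF u, of "\<epsilon> / 2" B] \<open>\<epsilon> > 0\<close> by auto
  obtain k :: nat where k: "k > 0" "1 / real k < \<mu> / 2"
    using \<open>\<mu> > 0\<close> by (metis half_gt_zero nat_approx_posE of_nat_0_less_iff zero_less_Suc)
  \<comment> \<open>The entries of \<open>ys\<close> are bounded by \<open>B + \<mu>\<close>; the
    extra 1 pays for rounding down.\<close>
  define K where "K = \<lceil>real k * (B + \<mu>)\<rceil> + 1"
  define S where "S = {il :: int list. set il \<subseteq> {-K..K} \<and> length il = n}"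
  have "finite S" unfolding S_def by (rule finite_lists_length_eq) simp
  then obtain ils where ils: "set ils = S" using finite_list by blast
  have "\<exists>q. \<bar>of_rat q - u (map (\<lambda>i. of_int i / real k) il)\<bar> < \<epsilon> / 2" for il
  proof -
    let ?v = "u (map (\<lambda>i. of_int i / real k) il)"
    obtain q where "?v < real_of_rat q" "real_of_rat q < ?v + \<epsilon> / 2"
      using of_rat_dense[of ?v "?v + \<epsilon> / 2"] \<open>\<epsilon> > 0\<close> by auto
    then show ?thesis by (intro exI[of _ q]) linarith
  qed
  then obtain q where q: "\<And>il. \<bar>of_rat (q il) - u (map (\<lambda>i. of_int i / real k) il)\<bar> < \<epsilon> / 2"
    by metis
  define tab where "tab = map (\<lambda>il. (il, q il)) ils"
  have "\<bar>u xs - table_fun k tab ys\<bar> \<le> \<epsilon>"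
    if *: "length xs = n" "length ys = n" "\<forall>i<n. \<bar>xs ! i\<bar> \<le> B"
      "\<forall>i<n. \<bar>xs ! i - ys ! i\<bar> \<le> \<mu> / 2" for xs ys
  proof -
    define il where "il = map (\<lambda>x. \<lfloor>real k * x\<rfloor>) ys"
    have near: "\<bar>ys ! i - of_int (il ! i) / real k\<bar> < \<mu> / 2" if "i < n" for i
    proof -
      have "0 \<le> real k * ys ! i - of_int (il ! i)" "real k * ys ! i - of_int (il ! i) < 1"
        using that *(2) by (auto simp: il_def) linarith
      then have "\<bar>(real k * ys ! i - of_int (il ! i)) / real k\<bar> < 1 / real k"
        using k(1) by (simp add: divide_strict_right_mono abs_of_nonneg)
      moreover have "(real k * ys ! i - of_int (il ! i)) / real k = ys ! i - of_int (il ! i) / real k"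
        using k(1) by (simp add: field_simps)
      ultimately show ?thesis using k(2) by simp
    qed
    have "il ! i \<in> {-K..K}" if "i < n" for i
    proof -
      have "\<bar>ys ! i\<bar> \<le> B + \<mu>" using *(3,4) that \<open>\<mu> > 0\<close> by (smt (verit) field_sum_of_halves)
      then have "real k * \<bar>ys ! i\<bar> \<le> real k * (B + \<mu>)" by (intro mult_left_mono) auto
      then have "\<bar>real k * ys ! i\<bar> \<le> real k * (B + \<mu>)" by (simp add: abs_mult)
      moreover have "il ! i = \<lfloor>real k * ys ! i\<rfloor>" using that *(2) by (simp add: il_def)
      ultimately show ?thesis unfolding K_def by (simp add: abs_le_iff) linarith
    qed
    then have "il \<in> S" using *(2) by (auto simp: S_def il_def in_set_conv_nth)
    then have "map_of tab il = Some (q il)"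
      unfolding tab_def map_of_map_restrict using ils by simp
    then have "table_fun k tab ys = of_rat (q il)"
      unfolding table_fun_def il_def by simp
    moreover have "\<bar>u xs - u (map (\<lambda>i. of_int i / real k) il)\<bar> < \<epsilon> / 2"
    proof (rule \<mu>)
      show "\<forall>i<n. \<bar>xs ! i - map (\<lambda>i. of_int i / real k) il ! i\<bar> < \<mu>"
      proof (intro allI impI)
        fix i assume i: "i < n"
        then have "map (\<lambda>i. of_int i / real k) il ! i = of_int (il ! i) / real k"
          using *(2) by (simp add: il_def)
        with near[OF i] *(4) i show "\<bar>xs ! i - map (\<lambda>i. of_int i / real k) il ! i\<bar> < \<mu>"
          by (smt (verit) field_sum_of_halves)
      qed
    qed (use * in \<open>auto simp: il_def\<close>)
    ultimately show ?thesis using q[of il] by linarith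
  qed
  moreover have "\<mu> / 2 > 0" using \<open>\<mu> > 0\<close> by simp
  ultimately show ?thesis by blast
qed

section \<open>Approximation of formulas by codes\<close>

context language_structure
begin

abbreviation dec :: "fm_code \<Rightarrow> ('f, 'p) fm" where
  "dec \<equiv> decode_fm (from_nat_into (Funs L)) (from_nat_into (Preds L))"

lemma trm_decode:
  assumes "countable_language L" "wf_trm L t"
  shows "\<exists>s. map_trm (from_nat_into (Funs L)) s = t"
  using assms(2)
proof (induction t)
  case (Var n)
  then show ?case by (intro exI[of _ "Var n"]) simp
next
  case (Fn f ts)
  have "\<forall>t\<in>set ts. \<exists>s. map_trm (from_nat_into (Funs L)) s = t"
    using Fn by (auto simp: list_all_iff)
  then obtain g where "\<And>t. t \<in> set ts \<Longrightarrow> map_trm (from_nat_into (Funs L)) (g t) = t" by metis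
  then have "map (map_trm (from_nat_into (Funs L))) (map g ts) = ts"
    by (auto intro: map_idI)
  moreover obtain k where "from_nat_into (Funs L) k = f"
    using assms(1) Fn.prems from_nat_into_surj[of "Funs L" f] by (auto simp: countable_language_def)
  ultimately show ?case by (intro exI[of _ "Fn k (map g ts)"]) simp
qed

text \<open>For a connective the table is chosen first; its tolerance \<open>\<delta>\<close> then
  dictates how well the arguments have to be approximated.\<close>

lemma fm_decode_approx:
  assumes "countable_language L" "wf_fm L \<phi>" "\<epsilon> > 0"
  shows "\<exists>c. \<forall>e. range e \<subseteq> Univ M \<longrightarrow> \<bar>fm_val M \<phi> e - fm_val M (dec c) e\<bar> \<le> \<epsilon>"
  using assms(2,3)
proof (induction \<phi> arbitrary: \<epsilon>)
  case (Dist s t)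
  then obtain s' t' where "map_trm (from_nat_into (Funs L)) s' = s" "map_trm (from_nat_into (Funs L)) t' = t"
    using trm_decode[OF assms(1)] by (metis wf_fm.simps(1))
  with \<open>\<epsilon> > 0\<close> show ?case by (intro exI[of _ "CDist s' t'"]) simp
next
  case (Pred P ts)
  then have "\<forall>t\<in>set ts. \<exists>s. map_trm (from_nat_into (Funs L)) s = t"
    using trm_decode[OF assms(1)] by (auto simp: list_all_iff)
  then obtain g where "\<And>t. t \<in> set ts \<Longrightarrow> map_trm (from_nat_into (Funs L)) (g t) = t" by metis
  then have "map (map_trm (from_nat_into (Funs L))) (map g ts) = ts"
    by (auto intro: map_idI)
  moreover obtain k where "from_nat_into (Preds L) k = P"
    using assms(1) Pred.prems from_nat_into_surj[of "Preds L" P] by (auto simp: countable_language_def)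
  ultimately have "dec (CPred k (map g ts)) = Pred P ts" by simp
  with \<open>\<epsilon> > 0\<close> show ?case by (metis abs_zero diff_self less_imp_le)
next
  case (Conn u \<phi>s)
  have wf: "wf_fm L \<phi>" if "\<phi> \<in> set \<phi>s" for \<phi> using Conn.prems that by (auto simp: list_all_iff)
  obtain B where B: "\<And>\<phi> e. \<phi> \<in> set \<phi>s \<Longrightarrow> range e \<subseteq> Univ M \<Longrightarrow> \<bar>fm_val M \<phi> e\<bar> \<le> B"
    using fm_vals_bounded[of \<phi>s] Conn.prems(1) by auto
  have "continuous_on UNIV (\<lambda>v :: nat \<Rightarrow> real. u (map v [0..<length \<phi>s]))"
    using Conn.prems(1) by simp
  from table_fun_approx[OF this \<open>\<epsilon> > 0\<close>, of B]
  obtain \<delta> k tab where "\<delta> > 0" and tab: "\<And>xs ys. length xs = length \<phi>s \<Longrightarrow> length ys = length \<phi>s \<Longrightarrow>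
    (\<forall>i<length \<phi>s. \<bar>xs ! i\<bar> \<le> B) \<Longrightarrow> (\<forall>i<length \<phi>s. \<bar>xs ! i - ys ! i\<bar> \<le> \<delta>) \<Longrightarrow>
    \<bar>u xs - table_fun k tab ys\<bar> \<le> \<epsilon>" by blast
  have "\<forall>\<phi>\<in>set \<phi>s. \<exists>c. \<forall>e. range e \<subseteq> Univ M \<longrightarrow> \<bar>fm_val M \<phi> e - fm_val M (dec c) e\<bar> \<le> \<delta>"
    using Conn.IH wf \<open>\<delta> > 0\<close> by blast
  then obtain g where g: "\<And>\<phi> e. \<phi> \<in> set \<phi>s \<Longrightarrow> range e \<subseteq> Univ M \<Longrightarrow>
    \<bar>fm_val M \<phi> e - fm_val M (dec (g \<phi>)) e\<bar> \<le> \<delta>" by metis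
  have "\<bar>u (map (\<lambda>\<phi>. fm_val M \<phi> e) \<phi>s) - table_fun k tab (map (\<lambda>\<phi>. fm_val M (dec (g \<phi>)) e) \<phi>s)\<bar> \<le> \<epsilon>"
    if "range e \<subseteq> Univ M" for e
    by (intro tab) (use B[OF nth_mem that] g[OF nth_mem that] in simp_all)
  then show ?case by (intro exI[of _ "CTable k tab (map g \<phi>s)"]) (simp add: comp_def)
next
  case (SupQ n \<phi>)
  have wf: "wf_fm L \<phi>" using SupQ.prems by simp
  obtain c where c: "\<And>e. range e \<subseteq> Univ M \<Longrightarrow> \<bar>fm_val M \<phi> e - fm_val M (dec c) e\<bar> \<le> \<epsilon>"
    using SupQ.IH[OF wf \<open>\<epsilon> > 0\<close>] by blast
  obtain B where B: "\<And>e. range e \<subseteq> Univ M \<Longrightarrow> \<bar>fm_val M \<phi> e\<bar> \<le> B"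
    using fm_val_bounded[OF wf] by blast
  have "\<bar>fm_val M (SupQ n \<phi>) e - fm_val M (dec (CSup n c)) e\<bar> \<le> \<epsilon>" if "range e \<subseteq> Univ M" for e
    unfolding fm_val.simps decode_fm.simps using that
    by (intro SUP_INF_diff_le(1)[where B = B] Univ_nonempty c B range_fun_upd_subset)
  then show ?case by blast
next
  case (InfQ n \<phi>)
  have wf: "wf_fm L \<phi>" using InfQ.prems by simp
  obtain c where c: "\<And>e. range e \<subseteq> Univ M \<Longrightarrow> \<bar>fm_val M \<phi> e - fm_val M (dec c) e\<bar> \<le> \<epsilon>"
    using InfQ.IH[OF wf \<open>\<epsilon> > 0\<close>] by blast
  obtain B where B: "\<And>e. range e \<subseteq> Univ M \<Longrightarrow> \<bar>fm_val M \<phi> e\<bar> \<le> B"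
    using fm_val_bounded[OF wf] by blast
  have "\<bar>fm_val M (InfQ n \<phi>) e - fm_val M (dec (CInf n c)) e\<bar> \<le> \<epsilon>" if "range e \<subseteq> Univ M" for e
    unfolding fm_val.simps decode_fm.simps using that
    by (intro SUP_INF_diff_le(2)[where B = B] Univ_nonempty c B range_fun_upd_subset)
  then show ?case by blast
qed

section \<open>Skolem witnesses and the closure of the set of their values\<close>

definition list_assign :: "'a \<Rightarrow> 'a list \<Rightarrow> nat \<Rightarrow> 'a" where
  "list_assign a xs i = (if i < length xs then xs ! i else a)"

definition near_inf :: "fm_code \<Rightarrow> nat \<Rightarrow> nat \<Rightarrow> (nat \<Rightarrow> 'a) \<Rightarrow> 'a \<Rightarrow> bool" where
  "near_inf c n k e a \<longleftrightarrow> a \<in> Univ M \<and>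
     fm_val M (dec c) (e(n := a)) \<le> (INF b\<in>Univ M. fm_val M (dec c) (e(n := b))) + 1 / real (Suc k)"

text \<open>The default \<open>a0\<close> keeps every value in the universe without any assumption
  on the code, which need not decode to a well-formed formula.\<close>

primrec witness_val :: "'a \<Rightarrow> (nat \<Rightarrow> 'a) \<Rightarrow> witness \<Rightarrow> 'a" where
  "witness_val a0 C (Base i) = C i"
| "witness_val a0 C (Witness c n k ts) =
     (if \<exists>a. near_inf c n k (list_assign a0 (map (witness_val a0 C) ts)) a
      then SOME a. near_inf c n k (list_assign a0 (map (witness_val a0 C) ts)) a else a0)"

lemma witness_val_in_Univ:
  assumes "a0 \<in> Univ M" "range C \<subseteq> Univ M"
  shows "witness_val a0 C w \<in> Univ M"
proof (cases w)
  case (Base i)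
  then show ?thesis using assms(2) by auto
next
  case (Witness c n k ts)
  then show ?thesis
    using assms(1) someI_ex[of "near_inf c n k (list_assign a0 (map (witness_val a0 C) ts))"]
    by (auto simp: near_inf_def)
qed

text \<open>The parameters are moved to nearby witnesses and the formula is replaced by a code, at a
  cost of \<epsilon>/5 each. Both costs occur once for the value and once for the infimum; the last
  \<epsilon>/5 is the error of the near-minimiser.\<close>

lemma tarski_vaught:
  assumes "countable_language L" "a0 \<in> Univ M" "range C \<subseteq> Univ M" "wf_fm L \<phi>" "\<epsilon> > 0"
    and e: "range e \<subseteq> {x \<in> Univ M. \<forall>\<epsilon>>0. \<exists>w. Metr M (witness_val a0 C w) x < \<epsilon>}"
  shows "\<exists>w. fm_val M \<phi> (e(n := witness_val a0 C w)) \<le> (INF b\<in>Univ M. fm_val M \<phi> (e(n := b))) + \<epsilon>"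
proof -
  let ?w = "witness_val a0 C"
  have wU: "?w w \<in> Univ M" for w by (rule witness_val_in_Univ[OF assms(2,3)])
  have eU: "range e \<subseteq> Univ M" using e by auto
  have "\<epsilon> / 5 > 0" using \<open>\<epsilon> > 0\<close> by simp
  then obtain \<delta> where "\<delta> > 0" and \<delta>: "\<And>e e'. range e \<subseteq> Univ M \<and> range e' \<subseteq> Univ M \<and>
    (\<forall>i\<in>free_vars \<phi>. Metr M (e i) (e' i) < \<delta>) \<Longrightarrow> \<bar>fm_val M \<phi> e - fm_val M \<phi> e'\<bar> \<le> \<epsilon> / 5"
    using fm_val_uniform[OF assms(4)] by meson
  obtain c where c: "\<And>e. range e \<subseteq> Univ M \<Longrightarrow> \<bar>fm_val M \<phi> e - fm_val M (dec c) e\<bar> \<le> \<epsilon> / 5"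
    using fm_decode_approx[OF assms(1,4) \<open>\<epsilon> / 5 > 0\<close>] by blast
  obtain B where B: "\<And>e. range e \<subseteq> Univ M \<Longrightarrow> \<bar>fm_val M \<phi> e\<bar> \<le> B"
    using fm_val_bounded[OF assms(4)] by blast
  obtain k where k: "1 / real (Suc k) < \<epsilon> / 5"
    using nat_approx_posE[OF \<open>\<epsilon> / 5 > 0\<close>] by auto
  have "\<forall>i. \<exists>w. Metr M (?w w) (e i) < \<delta>" using e \<open>\<delta> > 0\<close> by blast
  then obtain ws where ws: "\<And>i. Metr M (?w (ws i)) (e i) < \<delta>" by metis
  obtain m where m: "\<And>i. i \<in> free_vars \<phi> \<Longrightarrow> i < m"
    using finite_nat_set_iff_bounded[THEN iffD1, OF finite_free_vars[of \<phi>]] by blast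
  define ts where "ts = map ws [0..<m]"
  define e' where "e' = list_assign a0 (map ?w ts)"
  have e'U: "range e' \<subseteq> Univ M"
    using assms(2) wU by (auto simp: e'_def list_assign_def ts_def)
  have e'i: "Metr M (e i) (e' i) < \<delta>" if "i \<in> free_vars \<phi>" for i
    using m[OF that] ws[of i] commute[of "e i"] by (simp add: e'_def list_assign_def ts_def)
  have 1: "\<bar>fm_val M \<phi> (e(n := b)) - fm_val M (dec c) (e'(n := b))\<bar> \<le> 2 * \<epsilon> / 5"
    if "b \<in> Univ M" for b
  proof -
    have "\<bar>fm_val M \<phi> (e(n := b)) - fm_val M \<phi> (e'(n := b))\<bar> \<le> \<epsilon> / 5"
      using e'i \<open>\<delta> > 0\<close> that by (intro \<delta> conjI range_fun_upd_subset eU e'U ballI) auto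
    with c[OF range_fun_upd_subset[OF e'U that, of n]] show ?thesis by linarith
  qed
  have 2: "\<bar>(INF b\<in>Univ M. fm_val M \<phi> (e(n := b))) - (INF b\<in>Univ M. fm_val M (dec c) (e'(n := b)))\<bar> \<le> 2 * \<epsilon> / 5"
    by (intro SUP_INF_diff_le(2)[where B = B] Univ_nonempty 1 B range_fun_upd_subset eU)
  have "\<exists>a. near_inf c n k e' a"
  proof -
    have "bdd_below ((\<lambda>b. fm_val M (dec c) (e'(n := b))) ` Univ M)"
    proof (rule bdd_belowI2[of _ "- B - \<epsilon> / 5"])
      fix b assume "b \<in> Univ M"
      from c[OF range_fun_upd_subset[OF e'U this, of n]] B[OF range_fun_upd_subset[OF e'U this, of n]]
      show "- B - \<epsilon> / 5 \<le> fm_val M (dec c) (e'(n := b))" by linarith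
    qed
    from cINF_less_iff[THEN iffD1, OF Univ_nonempty this, of "(INF b\<in>Univ M. fm_val M (dec c) (e'(n := b))) + 1 / real (Suc k)"]
    show ?thesis by (auto simp: near_inf_def intro: less_imp_le)
  qed
  then have "near_inf c n k e' (?w (Witness c n k ts))"
    by (simp add: e'_def[symmetric] someI_ex del: map_map)
  then have "fm_val M (dec c) (e'(n := ?w (Witness c n k ts))) \<le>
    (INF b\<in>Univ M. fm_val M (dec c) (e'(n := b))) + 1 / real (Suc k)"
    by (simp only: near_inf_def)
  with 2 1[OF wU[of "Witness c n k ts"]] k
  have "fm_val M \<phi> (e(n := ?w (Witness c n k ts))) \<le> (INF b\<in>Univ M. fm_val M \<phi> (e(n := b))) + \<epsilon>"
    by linarith
  then show ?thesis by blast
qed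

definition witness_closure :: "'a \<Rightarrow> (nat \<Rightarrow> 'a) \<Rightarrow> 'a set" where
  "witness_closure a0 C = {x \<in> Univ M. \<forall>\<epsilon>>0. \<exists>w. Metr M (witness_val a0 C w) x < \<epsilon>}"

context
  fixes a0 :: 'a and C :: "nat \<Rightarrow> 'a"
  assumes countable: "countable_language L" and a0: "a0 \<in> Univ M" and C: "range C \<subseteq> Univ M"
begin

lemma witness_closure_subset: "witness_closure a0 C \<subseteq> Univ M"
  by (auto simp: witness_closure_def)

lemma witness_in_closure: "witness_val a0 C w \<in> witness_closure a0 C"
  using witness_val_in_Univ[OF a0 C] unfolding witness_closure_def by (auto intro!: exI[of _ w])

lemma INF_witness_closure:
  assumes "wf_fm L \<phi>" "range e \<subseteq> witness_closure a0 C"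
  shows "(INF b\<in>witness_closure a0 C. fm_val M \<phi> (e(n := b))) = (INF b\<in>Univ M. fm_val M \<phi> (e(n := b)))"
proof (rule antisym)
  obtain B where B: "\<And>e. range e \<subseteq> Univ M \<Longrightarrow> \<bar>fm_val M \<phi> e\<bar> \<le> B"
    using fm_val_bounded[OF assms(1)] by blast
  have eU: "range e \<subseteq> Univ M" using assms(2) witness_closure_subset by blast
  have bdd: "bdd_below ((\<lambda>b. fm_val M \<phi> (e(n := b))) ` Univ M)"
    using B[OF range_fun_upd_subset[OF eU]] by (intro bdd_belowI2[of _ "-B"]) (auto simp: abs_le_iff minus_le_iff)
  show "(INF b\<in>Univ M. fm_val M \<phi> (e(n := b))) \<le> (INF b\<in>witness_closure a0 C. fm_val M \<phi> (e(n := b)))"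
    using witness_in_closure bdd witness_closure_subset by (intro cINF_superset_mono) auto
  have bdd': "bdd_below ((\<lambda>b. fm_val M \<phi> (e(n := b))) ` witness_closure a0 C)"
    using bdd witness_closure_subset by (meson bdd_below_mono image_mono)
  show "(INF b\<in>witness_closure a0 C. fm_val M \<phi> (e(n := b))) \<le> (INF b\<in>Univ M. fm_val M \<phi> (e(n := b)))"
  proof (rule field_le_epsilon)
    fix \<epsilon> :: real assume "\<epsilon> > 0"
    from tarski_vaught[OF countable a0 C assms(1) this assms(2)[unfolded witness_closure_def], of n]
    obtain w where "fm_val M \<phi> (e(n := witness_val a0 C w)) \<le> (INF b\<in>Univ M. fm_val M \<phi> (e(n := b))) + \<epsilon>"
      by blast
    moreover have "(INF b\<in>witness_closure a0 C. fm_val M \<phi> (e(n := b))) \<le> fm_val M \<phi> (e(n := witness_val a0 C w))"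
      by (rule cINF_lower[OF bdd' witness_in_closure])
    ultimately show "(INF b\<in>witness_closure a0 C. fm_val M \<phi> (e(n := b))) \<le>
      (INF b\<in>Univ M. fm_val M \<phi> (e(n := b))) + \<epsilon>" by linarith
  qed
qed

lemma SUP_witness_closure:
  assumes "wf_fm L \<phi>" "range e \<subseteq> witness_closure a0 C"
  shows "(SUP b\<in>witness_closure a0 C. fm_val M \<phi> (e(n := b))) = (SUP b\<in>Univ M. fm_val M \<phi> (e(n := b)))"
proof -
  have "continuous_on UNIV (\<lambda>v :: nat \<Rightarrow> real. - v 0)"
    by (intro continuous_intros continuous_on_product_coordinates)
  then have "wf_fm L (Conn (\<lambda>v. - v ! 0) [\<phi>])" using assms(1) by simp
  from INF_witness_closure[OF this assms(2), of n] show ?thesis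
    by (simp add: Inf_real_def image_image)
qed

text \<open>The Tarski-Vaught property for the formula giving the distance of a new point from the
  value of \<open>f\<close>: its infimum over the universe is at most 0, so some witnesses come
  arbitrarily close to that value.\<close>

lemma Fun_in_witness_closure:
  assumes "f \<in> Funs L" "xs \<in> tuples (witness_closure a0 C) (Fun_arity L f)"
  shows "Fun_interp M f xs \<in> witness_closure a0 C"
proof -
  \<comment> \<open>Variable 0 is reserved for the new point, so the arguments of \<open>f\<close>
    are shifted to the variables from 1 on.\<close>
  define e where "e i = (if 0 < i \<and> i \<le> length xs then xs ! (i - 1) else witness_val a0 C (Base 0))" for i
  have e: "range e \<subseteq> witness_closure a0 C"
    using assms(2) witness_in_closure[of "Base 0"] by (auto simp: e_def tuples_def subset_iff)
  have len: "length xs = Fun_arity L f" using assms(2) by (simp add: tuples_def)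
  have xs: "xs \<in> tuples (Univ M) (Fun_arity L f)"
    using assms(2) witness_closure_subset by (auto simp: tuples_def)
  have fU: "Fun_interp M f xs \<in> Univ M" by (rule Fun_in_Univ[OF assms(1) xs])
  define \<phi> :: "('f, 'p) fm" where "\<phi> = Dist (Var 0) (Fn f (map Var [1..<Suc (length xs)]))"
  have wf: "wf_fm L \<phi>" using assms(1) len by (simp add: \<phi>_def list_all_iff)
  have "map e [Suc 0..<Suc (length xs)] = xs"
    by (rule nth_equalityI) (auto simp: e_def nth_append simp del: upt_Suc)
  then have val: "fm_val M \<phi> (e(0 := b)) = Metr M b (Fun_interp M f xs)" for b
    by (simp add: \<phi>_def comp_def del: upt_Suc)
  have "bdd_below ((\<lambda>b. fm_val M \<phi> (e(0 := b))) ` Univ M)"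
    by (intro bdd_belowI2[of _ 0]) (simp add: val)
  from cINF_lower[OF this fU] have inf: "(INF b\<in>Univ M. fm_val M \<phi> (e(0 := b))) \<le> 0"
    using fU by (simp add: val)
  have "\<exists>w. Metr M (witness_val a0 C w) (Fun_interp M f xs) < \<epsilon>" if "\<epsilon> > 0" for \<epsilon>
  proof -
    have "\<epsilon> / 2 > 0" using that by simp
    from tarski_vaught[OF countable a0 C wf this e[unfolded witness_closure_def], of 0]
    obtain w where "fm_val M \<phi> (e(0 := witness_val a0 C w)) \<le> (INF b\<in>Univ M. fm_val M \<phi> (e(0 := b))) + \<epsilon> / 2"
      by blast
    with inf have "Metr M (witness_val a0 C w) (Fun_interp M f xs) \<le> \<epsilon> / 2"
      unfolding val by linarith
    with that show ?thesis by (intro exI[of _ w]) simp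
  qed
  with fU show ?thesis by (auto simp: witness_closure_def)
qed

text \<open>
  A point of the closure is determined by its distances to the witnesses, hence by a set of natural
  numbers, hence by a real number.
\<close>

lemma witness_closure_inj: "\<exists>j :: 'a \<Rightarrow> real. inj_on j (witness_closure a0 C)"
proof -
  define code where "code x = {m. \<exists>w k. m = to_nat (w, k) \<and> Metr M (witness_val a0 C w) x < 1 / real (Suc k)}" for x
  have "inj_on code (witness_closure a0 C)"
  proof (rule inj_onI)
    fix x y assume x: "x \<in> witness_closure a0 C" and y: "y \<in> witness_closure a0 C" and "code x = code y"
    have xU: "x \<in> Univ M" "y \<in> Univ M" using x y witness_closure_subset by auto
    have "Metr M x y \<le> 2 / real (Suc k)" for k
    proof -
      have "1 / real (Suc k) > 0" by simp
      then obtain w where w: "Metr M (witness_val a0 C w) x < 1 / real (Suc k)"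
        using x unfolding witness_closure_def by blast
      then have "to_nat (w, k) \<in> code x" unfolding code_def by blast
      then have "to_nat (w, k) \<in> code y" using \<open>code x = code y\<close> by simp
      then have "Metr M (witness_val a0 C w) y < 1 / real (Suc k)"
        by (auto simp: code_def)
      with w triangle[OF xU(1) witness_val_in_Univ[OF a0 C] xU(2), of w]
        commute[of x "witness_val a0 C w"]
      have "Metr M x y \<le> 1 / real (Suc k) + 1 / real (Suc k)" by linarith
      then show ?thesis by simp
    qed
    then have "Metr M x y \<le> 0"
      by (intro LIMSEQ_le_const[OF tendsto_mult_right_zero[OF lim_1_over_n[THEN LIMSEQ_Suc], of 2]]) auto
    then show "x = y" using xU nonneg[of x y] zero by (metis antisym)
  qed
  moreover obtain g :: "nat set \<Rightarrow> real" where "bij g"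
    using nat_sets_eqpoll_reals by (auto simp: eqpoll_def)
  ultimately have "inj_on (g \<circ> code) (witness_closure a0 C)"
    by (meson bij_is_inj comp_inj_on inj_on_subset subset_UNIV)
  then show ?thesis by blast
qed

text \<open>The closure inherits completeness from \<open>M\<close> because it is closed in it. It
  is carried to the reals by an injection \<open>j\<close>, and quantifiers over it agree with those
  over \<open>M\<close> by the Tarski-Vaught property.\<close>

lemma small_elementary_witness_closure:
  "\<exists>(S :: ('f, 'p) small_structure) h. is_structure L S \<and> separable_structure S \<and>
     bij_betw h (Univ S) (witness_closure a0 C) \<and>
     (\<forall>\<phi> e. wf_fm L \<phi> \<and> range e \<subseteq> Univ S \<longrightarrow> fm_val M \<phi> (h \<circ> e) = fm_val S \<phi> e)"
proof -
  let ?W = "witness_closure a0 C"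
  obtain j :: "'a \<Rightarrow> real" where j: "inj_on j ?W" using witness_closure_inj by blast
  define h where "h = inv_into ?W j"
  have hj: "h (j x) = x" if "x \<in> ?W" for x using j that by (simp add: h_def)
  have h: "h x \<in> ?W" "j (h x) = x" if "x \<in> j ` ?W" for x
    using that by (auto simp: hj)
  have hU: "h x \<in> Univ M" if "x \<in> j ` ?W" for x
    using h(1)[OF that] witness_closure_subset by blast
  have him: "h ` j ` ?W = ?W" by (auto simp: hj image_image)
  define S :: "('f, 'p) small_structure" where
    "S = \<lparr>Univ = j ` ?W, Metr = (\<lambda>x y. Metr M (h x) (h y)),
      Fun_interp = (\<lambda>f xs. j (Fun_interp M f (map h xs))),
      Pred_interp = (\<lambda>P xs. Pred_interp M P (map h xs))\<rparr>"
  have S: "Univ S = j ` ?W" "Metr S = (\<lambda>x y. Metr M (h x) (h y))"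
    "Fun_interp S = (\<lambda>f xs. j (Fun_interp M f (map h xs)))"
    "Pred_interp S = (\<lambda>P xs. Pred_interp M P (map h xs))"
    by (simp_all add: S_def)
  have tupW: "map h xs \<in> tuples ?W n" if "xs \<in> tuples (Univ S) n" for xs n
    using that h(1) by (auto simp: tuples_def S)
  then have tup: "map h xs \<in> tuples (Univ M) n" if "xs \<in> tuples (Univ S) n" for xs n
    using that witness_closure_subset by (fastforce simp: tuples_def)
  have met: "Metric_space (Univ S) (Metr S)"
  proof
    show "Metr S x y = 0 \<longleftrightarrow> x = y" if "x \<in> Univ S" "y \<in> Univ S" for x y
      using that hU h(2) by (metis S(1,2) zero)
    show "Metr S x z \<le> Metr S x y + Metr S y z" if "x \<in> Univ S" "y \<in> Univ S" "z \<in> Univ S" for x y z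
      using that hU triangle by (simp add: S)
  qed (simp_all add: S commute)
  interpret S: Metric_space "Univ S" "Metr S" by (rule met)
  have comp: "S.mcomplete"
    unfolding S.mcomplete_def
  proof (intro allI impI)
    fix \<sigma> assume \<sigma>: "S.MCauchy \<sigma>"
    then have \<sigma>S: "\<sigma> n \<in> j ` ?W" for n using S(1) unfolding S.MCauchy_def by auto
    have "MCauchy (h \<circ> \<sigma>)"
      unfolding MCauchy_def
    proof
      show "range (h \<circ> \<sigma>) \<subseteq> Univ M" using hU \<sigma>S by auto
      show "\<forall>\<epsilon>>0. \<exists>N. \<forall>n n'. N \<le> n \<longrightarrow> N \<le> n' \<longrightarrow> Metr M ((h \<circ> \<sigma>) n) ((h \<circ> \<sigma>) n') < \<epsilon>"
        using \<sigma>[unfolded S.MCauchy_def, THEN conjunct2] by (simp add: S(2))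
    qed
    then obtain x where x: "limitin mtopology (h \<circ> \<sigma>) x sequentially"
      using mcomplete by (auto simp: mcomplete_def)
    then have xU: "x \<in> Univ M" and lim: "\<And>\<epsilon>. \<epsilon> > 0 \<Longrightarrow> \<exists>N. \<forall>n\<ge>N. Metr M (h (\<sigma> n)) x < \<epsilon>"
      unfolding limit_metric_sequentially by (auto, meson)
    have "\<exists>w. Metr M (witness_val a0 C w) x < \<epsilon>" if "\<epsilon> > 0" for \<epsilon>
    proof -
      have "\<epsilon> / 2 > 0" using that by simp
      from lim[OF this] obtain N where N: "Metr M (h (\<sigma> N)) x < \<epsilon> / 2" by blast
      obtain w where "Metr M (witness_val a0 C w) (h (\<sigma> N)) < \<epsilon> / 2"
        using h(1)[OF \<sigma>S[of N]] \<open>\<epsilon> / 2 > 0\<close> unfolding witness_closure_def by blast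
      with N triangle[OF witness_val_in_Univ[OF a0 C] hU[OF \<sigma>S[of N]] xU, of w] show ?thesis
        by (intro exI[of _ w]) linarith
    qed
    with xU have xW: "x \<in> ?W" by (simp add: witness_closure_def)
    have "limitin S.mtopology \<sigma> (j x) sequentially"
      unfolding S.limit_metric_sequentially using xW \<sigma>S lim by (simp add: S(1,2) hj)
    then show "\<exists>x. limitin S.mtopology \<sigma> x sequentially" by blast
  qed
  have struct: "is_structure L S"
    unfolding is_structure_def
  proof (intro conjI ballI allI impI met comp)
    show "Univ S \<noteq> {}" using witness_in_closure by (auto simp: S(1))
    show "Metr S x y \<le> Diameter L" if "x \<in> Univ S" "y \<in> Univ S" for x y
      using that hU Metr_le by (simp add: S)
    fix f xs assume f: "f \<in> Funs L" "xs \<in> tuples (Univ S) (Fun_arity L f)"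
    show "Fun_interp S f xs \<in> Univ S"
      unfolding S using Fun_in_witness_closure[OF f(1) tupW[OF f(2)]] by blast
    fix ys \<epsilon> assume ys: "ys \<in> tuples (Univ S) (Fun_arity L f)" and "(0 :: real) < \<epsilon>"
      and *: "\<forall>i<Fun_arity L f. Metr S (xs ! i) (ys ! i) < Fun_modulus L f \<epsilon>"
    have "Metr M (Fun_interp M f (map h xs)) (Fun_interp M f (map h ys)) \<le> \<epsilon>"
      using * f(2) ys by (intro Fun_continuous f(1) tup ys \<open>0 < \<epsilon>\<close>) (auto simp: S tuples_def)
    then show "Metr S (Fun_interp S f xs) (Fun_interp S f ys) \<le> \<epsilon>"
      using Fun_in_witness_closure[OF f(1) tupW[OF f(2)]] Fun_in_witness_closure[OF f(1) tupW[OF ys]]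
      by (simp add: S hj)
  next
    fix P xs assume P: "P \<in> Preds L" "xs \<in> tuples (Univ S) (Pred_arity L P)"
    show "Pred_interp S P xs \<in> {Pred_lower L P..Pred_upper L P}"
      unfolding S(4) by (rule Pred_bounds[OF P(1) tup[OF P(2)]])
    fix ys \<epsilon> assume ys: "ys \<in> tuples (Univ S) (Pred_arity L P)" and "(0 :: real) < \<epsilon>"
      and *: "\<forall>i<Pred_arity L P. Metr S (xs ! i) (ys ! i) < Pred_modulus L P \<epsilon>"
    show "\<bar>Pred_interp S P xs - Pred_interp S P ys\<bar> \<le> \<epsilon>"
      unfolding S(4) using * P(2) ys
      by (intro Pred_continuous P(1) tup ys \<open>0 < \<epsilon>\<close>) (auto simp: S tuples_def)
  qed
  have sep: "separable_structure S"
    unfolding separable_structure_def separable_space_def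
  proof (intro exI conjI)
    let ?D = "range (\<lambda>w. j (witness_val a0 C w))"
    show "countable ?D" by simp
    show "?D \<subseteq> topspace S.mtopology"
      unfolding S.topspace_mtopology using witness_in_closure by (auto simp: S(1))
    have "\<exists>y\<in>?D. y \<in> S.mball x r" if xr: "x \<in> Univ S" "r > 0" for x r
    proof -
      obtain w where "Metr M (witness_val a0 C w) (h x) < r"
        using h(1)[OF xr(1)[unfolded S(1)]] xr(2) unfolding witness_closure_def by blast
      then have "j (witness_val a0 C w) \<in> S.mball x r"
        using witness_in_closure[of w] xr(1) commute[of "h x"]
        unfolding S.in_mball by (auto simp: S(1,2) hj)
      then show ?thesis by blast
    qed
    then show "S.mtopology closure_of ?D = topspace S.mtopology"
      unfolding S.metric_closure_of S.topspace_mtopology by blast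
  qed
  have trm: "h (trm_val S e t) = trm_val M (h \<circ> e) t \<and> trm_val M (h \<circ> e) t \<in> ?W"
    if "wf_trm L t" "range e \<subseteq> Univ S" for e t
    using that(1)
  proof (induction t)
    case (Var n)
    then show ?case using that(2) h(1) by (auto simp: S(1))
  next
    case (Fn f ts)
    have IH: "h (trm_val S e t) = trm_val M (h \<circ> e) t" "trm_val M (h \<circ> e) t \<in> ?W" if "t \<in> set ts" for t
    proof -
      have "wf_trm L t" using Fn.prems that by (simp add: list_all_iff)
      from Fn.IH[OF that this]
      show "h (trm_val S e t) = trm_val M (h \<circ> e) t" "trm_val M (h \<circ> e) t \<in> ?W" by blast+
    qed
    have eq: "map h (map (trm_val S e) ts) = map (trm_val M (h \<circ> e)) ts"
      unfolding map_map by (rule map_cong[OF refl]) (subst o_apply, erule IH(1))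
    have "map (trm_val M (h \<circ> e)) ts \<in> tuples ?W (Fun_arity L f)"
      unfolding tuples_def using IH(2) Fn.prems by force
    then have "Fun_interp M f (map (trm_val M (h \<circ> e)) ts) \<in> ?W"
      using Fn.prems by (intro Fun_in_witness_closure) auto
    then show ?case by (simp only: trm_val.simps S(3) eq hj simp_thms)
  qed
  have elem: "fm_val M \<phi> (h \<circ> e) = fm_val S \<phi> e" if "wf_fm L \<phi>" "range e \<subseteq> Univ S" for \<phi> e
    using that
  proof (induction \<phi> arbitrary: e)
    case (Dist s t)
    then have "wf_trm L s" "wf_trm L t" by simp_all
    from trm[OF this(1) Dist.prems(2)] trm[OF this(2) Dist.prems(2)]
    have "h (trm_val S e s) = trm_val M (h \<circ> e) s" "h (trm_val S e t) = trm_val M (h \<circ> e) t"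
      by blast+
    then show ?case by (simp only: fm_val.simps S(2))
  next
    case (Pred P ts)
    have eq: "map h (map (trm_val S e) ts) = map (trm_val M (h \<circ> e)) ts"
      unfolding map_map
    proof (rule map_cong[OF refl])
      fix t assume "t \<in> set ts"
      then have "wf_trm L t" using Pred.prems(1) by (simp add: list_all_iff)
      from trm[OF this Pred.prems(2)] show "(h \<circ> trm_val S e) t = trm_val M (h \<circ> e) t"
        by (subst o_apply) blast
    qed
    show ?case by (simp only: fm_val.simps S(4) eq)
  next
    case (Conn u \<phi>s)
    have "map (\<lambda>\<phi>. fm_val M \<phi> (h \<circ> e)) \<phi>s = map (\<lambda>\<phi>. fm_val S \<phi> e) \<phi>s"
    proof (rule map_cong[OF refl])
      fix \<phi> assume \<phi>: "\<phi> \<in> set \<phi>s"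
      then have "wf_fm L \<phi>" using Conn.prems(1) by (simp add: list_all_iff)
      from Conn.IH[OF \<phi> this Conn.prems(2)] show "fm_val M \<phi> (h \<circ> e) = fm_val S \<phi> e" .
    qed
    then show ?case by (simp only: fm_val.simps map_map comp_def)
  next
    case (SupQ n \<phi>)
    have wf: "wf_fm L \<phi>" using SupQ.prems by simp
    have "range (h \<circ> e) \<subseteq> ?W" using SupQ.prems(2) h(1) by (auto simp: S(1))
    from SUP_witness_closure[OF wf this, of n]
    have "fm_val M (SupQ n \<phi>) (h \<circ> e) = (SUP b\<in>h ` Univ S. fm_val M \<phi> ((h \<circ> e)(n := b)))"
      by (simp add: S(1) him)
    also have "\<dots> = (SUP a\<in>Univ S. fm_val M \<phi> (h \<circ> e(n := a)))"
      by (simp add: image_image fun_upd_comp)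
    also have "\<dots> = fm_val S (SupQ n \<phi>) e"
      unfolding fm_val.simps
      by (intro SUP_cong refl SupQ.IH[OF wf] range_fun_upd_subset SupQ.prems(2))
    finally show ?case .
  next
    case (InfQ n \<phi>)
    have wf: "wf_fm L \<phi>" using InfQ.prems by simp
    have "range (h \<circ> e) \<subseteq> ?W" using InfQ.prems(2) h(1) by (auto simp: S(1))
    from INF_witness_closure[OF wf this, of n]
    have "fm_val M (InfQ n \<phi>) (h \<circ> e) = (INF b\<in>h ` Univ S. fm_val M \<phi> ((h \<circ> e)(n := b)))"
      by (simp add: S(1) him)
    also have "\<dots> = (INF a\<in>Univ S. fm_val M \<phi> (h \<circ> e(n := a)))"
      by (simp add: image_image fun_upd_comp)
    also have "\<dots> = fm_val S (InfQ n \<phi>) e"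
      unfolding fm_val.simps
      by (intro INF_cong refl InfQ.IH[OF wf] range_fun_upd_subset InfQ.prems(2))
    finally show ?case .
  qed
  have "bij_betw h (Univ S) ?W"
    unfolding S(1) using h(2) him by (intro bij_betw_imageI inj_on_inverseI[of _ j]) auto
  with struct sep elem show ?thesis by blast
qed

end

theorem exists_small_elementary_substructure:
  assumes "countable_language L" "countable X" "X \<subseteq> Univ M"
  shows "\<exists>(S :: ('f, 'p) small_structure) h. is_structure L S \<and> separable_structure S \<and>
     h ` Univ S \<subseteq> Univ M \<and> X \<subseteq> h ` Univ S \<and>
     (\<forall>\<phi> e. wf_fm L \<phi> \<and> range e \<subseteq> Univ S \<longrightarrow> fm_val M \<phi> (h \<circ> e) = fm_val S \<phi> e)"
proof -
  obtain a0 where a0: "a0 \<in> Univ M" using Univ_nonempty by blast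
  \<comment> \<open>Adding \<open>a0\<close> covers an empty \<open>X\<close>, which
    \<open>from_nat_into\<close> could not enumerate.\<close>
  let ?C = "from_nat_into (insert a0 X)"
  have C: "range ?C = insert a0 X"
    using assms(2) by (intro range_from_nat_into) auto
  then have C': "range ?C \<subseteq> Univ M" using a0 assms(3) by simp
  obtain S :: "('f, 'p) small_structure" and h where *: "is_structure L S" "separable_structure S"
    and bij: "bij_betw h (Univ S) (witness_closure a0 ?C)"
    and el: "\<forall>\<phi> e. wf_fm L \<phi> \<and> range e \<subseteq> Univ S \<longrightarrow> fm_val M \<phi> (h \<circ> e) = fm_val S \<phi> e"
    using small_elementary_witness_closure[OF assms(1) a0 C'] by blast
  have "X \<subseteq> witness_closure a0 ?C"
  proof
    fix x assume "x \<in> X"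
    then obtain i where "x = ?C i" using C by blast
    then show "x \<in> witness_closure a0 ?C"
      using witness_in_closure[OF assms(1) a0 C', of "Base i"] by simp
  qed
  then show ?thesis
    using * el bij_betw_imp_surj_on[OF bij] witness_closure_subset[OF assms(1) a0 C'] by blast
qed

end

section \<open>Tsirelson norms\<close>

lemma finite_support_coord: "finite {k. coord x k \<noteq> 0}"
  using coord[of x] by simp

lemma coord_0: "coord x 0 = 0"
  using coord[of x] by simp

lemma coord_add: "coord (x + y) k = coord x k + coord y k"
  by transfer simp

lemma coord_diff: "coord (x - y) k = coord x k - coord y k"
  by transfer simp

lemma coord_scaleR: "coord (c *\<^sub>R x) k = c * coord x k"
  by transfer simp

lemma coord_sum: "coord (\<Sum>i\<in>I. f i) k = (\<Sum>i\<in>I. coord (f i) k)"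
proof (induction I rule: infinite_finite_induct)
  case (insert i I)
  then show ?case by (simp add: coord_add)
qed (simp_all add: zero_c00.rep_eq)

lemma coord_eqI: "(\<And>k. coord x k = coord y k) \<Longrightarrow> x = y"
  by (simp add: coord_inject[symmetric] fun_eq_iff)

lemma abs_coord_le_norm: "\<bar>coord x k\<bar> \<le> norm x"
  unfolding norm_c00.rep_eq by (rule coord_le_tsirelson_norm[OF finite_support_coord])

lift_definition restr :: "nat set \<Rightarrow> c00 \<Rightarrow> c00" is seq_restrict
  by (simp add: finite_support_restrict) (simp add: seq_restrict_def)

text \<open>Index 0 gives the zero vector, because sequences in \<open>c00\<close> vanish at
  0.\<close>

lift_definition basis :: "nat \<Rightarrow> c00" is "\<lambda>n k. if k = n \<and> 0 < n then 1 else 0"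
  by (auto intro: finite_subset[of _ "{_}"])

lemma coord_restr: "coord (restr E x) k = (if k \<in> E then coord x k else 0)"
  by transfer (simp add: seq_restrict_def)

lemma coord_basis: "0 < n \<Longrightarrow> coord (basis n) k = (if k = n then 1 else 0)"
  by transfer simp

lemma restr_add: "restr E (x + y) = restr E x + restr E y"
  by (rule coord_eqI) (simp add: coord_restr coord_add)

lemma restr_scaleR: "restr E (c *\<^sub>R x) = c *\<^sub>R restr E x"
  by (rule coord_eqI) (simp add: coord_restr coord_scaleR)

lemma restr_sum: "restr E (\<Sum>i\<in>I. f i) = (\<Sum>i\<in>I. restr E (f i))"
  by (rule coord_eqI) (simp add: coord_restr coord_sum)

lemma tsirelson_norm_step_le_norm: "tsirelson_norm_step n (coord x) \<le> norm x"
  unfolding norm_c00.rep_eq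
  by (rule incseq_le[OF tsirelson_norm_step_incseq tsirelson_norm_LIMSEQ[OF finite_support_coord]])

text \<open>
  The norm of \<open>x\<close> is the larger one of the supremum norm of \<open>x\<close> and the supremum of
  \<open>(\<Sum>E\<leftarrow>Es. norm (restr E x)) / 2\<close> over admissible families \<open>Es\<close>; the next two lemmas are the two
  halves of this implicit equation.
\<close>

lemma norm_c00_le:
  assumes "\<And>k. \<bar>coord x k\<bar> \<le> c"
    and "\<And>Es. admissible Es \<Longrightarrow> (\<Sum>E\<leftarrow>Es. norm (restr E x)) \<le> 2 * c"
  shows "norm x \<le> c"
proof -
  have "tsirelson_norm_step n (coord x) \<le> c" for n
  proof (induction n)
    case 0
    then show ?case using assms(1) by (simp add: cSUP_least)
  next
    case (Suc n)
    show ?case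
    proof (rule tsirelson_norm_step_Suc_least[OF Suc])
      fix Es assume "admissible Es"
      have "(\<Sum>E\<leftarrow>Es. tsirelson_norm_step n (seq_restrict E (coord x))) \<le> (\<Sum>E\<leftarrow>Es. norm (restr E x))"
        by (rule sum_list_mono) (metis restr.rep_eq tsirelson_norm_step_le_norm)
      also have "\<dots> \<le> 2 * c" by (rule assms(2)) fact
      finally show "1 / 2 * (\<Sum>E\<leftarrow>Es. tsirelson_norm_step n (seq_restrict E (coord x))) \<le> c" by simp
    qed
  qed
  then show ?thesis
    unfolding norm_c00.rep_eq
    by (intro LIMSEQ_le_const2[OF tsirelson_norm_LIMSEQ[OF finite_support_coord]]) auto
qed

lemma admissible_sum_norm_le:
  assumes "admissible Es"
  shows "(\<Sum>E\<leftarrow>Es. norm (restr E x)) \<le> 2 * norm x"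
proof -
  have "((\<lambda>n. \<Sum>E\<leftarrow>Es. tsirelson_norm_step n (coord (restr E x))) \<longlongrightarrow> (\<Sum>E\<leftarrow>Es. norm (restr E x))) sequentially"
    unfolding norm_c00.rep_eq
    by (induction Es) (auto intro!: tendsto_add tsirelson_norm_LIMSEQ finite_support_coord)
  moreover have "(\<Sum>E\<leftarrow>Es. tsirelson_norm_step n (coord (restr E x))) \<le> 2 * norm x" for n
    using tsirelson_norm_step_upper[where n = n and x = "coord x", OF finite_support_coord assms]
      tsirelson_norm_step_le_norm[of "Suc n" x] unfolding restr.rep_eq by linarith
  ultimately show ?thesis by (intro LIMSEQ_le_const2) auto
qed

text \<open>Restrictions commute, so the induction on the stage of the norm applies inside each
  member of an admissible family.\<close>

lemma norm_restr_le: "norm (restr E x) \<le> norm x"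
proof -
  have "tsirelson_norm_step n (coord (restr E x)) \<le> tsirelson_norm_step n (coord x)" for n
  proof (induction n arbitrary: x)
    case 0
    have "\<bar>coord (restr E x) k\<bar> \<le> tsirelson_norm_step 0 (coord x)" for k
      \<comment> \<open>Coordinate 0, which vanishes, supplies the nonnegativity used outside
        \<open>E\<close>.\<close>
      using coord_le_tsirelson_norm_step[OF finite_support_coord, of x k 0]
        coord_le_tsirelson_norm_step[OF finite_support_coord, of x 0 0] by (simp add: coord_restr coord_0)
    then show ?case by (simp add: cSUP_least)
  next
    case (Suc n)
    show ?case
    proof (rule tsirelson_norm_step_Suc_least)
      show "tsirelson_norm_step n (coord (restr E x)) \<le> tsirelson_norm_step (Suc n) (coord x)"
        using Suc[of x] incseq_SucD[OF tsirelson_norm_step_incseq[of "coord x"], of n] by linarith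
      fix Es assume Es: "admissible Es"
      have "restr F (restr E x) = restr E (restr F x)" for F
        by (rule coord_eqI) (simp add: coord_restr)
      then have "tsirelson_norm_step n (seq_restrict F (coord (restr E x))) \<le>
          tsirelson_norm_step n (seq_restrict F (coord x))" for F
        using Suc[of "restr F x"] by (metis restr.rep_eq)
      then have "(\<Sum>F\<leftarrow>Es. tsirelson_norm_step n (seq_restrict F (coord (restr E x)))) \<le>
          (\<Sum>F\<leftarrow>Es. tsirelson_norm_step n (seq_restrict F (coord x)))"
        by (rule sum_list_mono)
      with tsirelson_norm_step_upper[where n = n and x = "coord x", OF finite_support_coord Es]
      show "1 / 2 * (\<Sum>F\<leftarrow>Es. tsirelson_norm_step n (seq_restrict F (coord (restr E x)))) \<le>
          tsirelson_norm_step (Suc n) (coord x)" by linarith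
    qed
  qed
  then show ?thesis
    unfolding norm_c00.rep_eq
    by (intro LIMSEQ_le[OF tsirelson_norm_LIMSEQ tsirelson_norm_LIMSEQ] finite_support_coord) auto
qed

abbreviation l1 :: "c00 \<Rightarrow> real" where
  "l1 x \<equiv> l1_norm (coord x)"

lemma l1_eq_sum:
  assumes "finite A" "\<And>k. k \<notin> A \<Longrightarrow> coord x k = 0"
  shows "l1 x = (\<Sum>k\<in>A. \<bar>coord x k\<bar>)"
  unfolding l1_norm_def using assms by (intro sum.mono_neutral_left) auto

lemma norm_le_l1: "norm x \<le> l1 x"
  unfolding norm_c00.rep_eq
  by (rule LIMSEQ_le_const2[OF tsirelson_norm_LIMSEQ[OF finite_support_coord]])
    (use tsirelson_norm_step_le_l1[OF finite_support_coord] in auto)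

lemma admissible_sum_l1_le:
  "admissible Es \<Longrightarrow> (\<Sum>E\<leftarrow>Es. l1 (restr E x)) \<le> l1 x"
  unfolding restr.rep_eq by (intro l1_norm_disjoint admissible_disjoint finite_support_coord)

text \<open>One use of the implicit equation already halves the l1 norm. Together with
  \<open>sum_coord_le_norm\<close> this fixes the norm of vectors whose support is small compared
  with where it starts.\<close>

lemma norm_le_max_sup_l1:
  assumes "\<And>k. \<bar>coord x k\<bar> \<le> c" "l1 x \<le> 2 * c"
  shows "norm x \<le> c"
proof (rule norm_c00_le[OF assms(1)])
  fix Es assume Es: "admissible Es"
  have "(\<Sum>E\<leftarrow>Es. norm (restr E x)) \<le> (\<Sum>E\<leftarrow>Es. l1 (restr E x))"
    by (rule sum_list_mono) (rule norm_le_l1)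
  with admissible_sum_l1_le[OF Es, of x] assms(2)
  show "(\<Sum>E\<leftarrow>Es. norm (restr E x)) \<le> 2 * c" by linarith
qed

text \<open>The sum dominates the maximum of the sup norm and half the l1 norm, and unlike the
  maximum it can be added up over the members of a family.\<close>

lemma norm_restr_le_half_l1:
  assumes "\<And>k. \<bar>coord x k\<bar> \<le> c" "0 \<le> c"
  shows "norm (restr E x) \<le> c + l1 (restr E x) / 2"
proof (rule norm_le_max_sup_l1)
  have "0 \<le> l1 (restr E x)" by (simp add: l1_norm_def sum_nonneg)
  then show "\<bar>coord (restr E x) k\<bar> \<le> c + l1 (restr E x) / 2" for k
    using assms(1)[of k] assms(2) by (simp add: coord_restr)
  show "l1 (restr E x) \<le> 2 * (c + l1 (restr E x) / 2)" using assms(2) by simp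
qed

text \<open>The singletons of \<open>A\<close> form an admissible family.\<close>

lemma sum_coord_le_norm:
  assumes "finite A" "A \<noteq> {}" "card A \<le> Min A"
  shows "(\<Sum>k\<in>A. \<bar>coord x k\<bar>) \<le> 2 * norm x"
proof -
  define xs where "xs = sorted_list_of_set A"
  have xs: "set xs = A" "sorted xs" "distinct xs" "length xs = card A"
    using assms(1) by (simp_all add: xs_def)
  have ne: "xs \<noteq> []" using xs(1) assms(2) by auto
  let ?Es = "map (\<lambda>k. {k}) xs"
  have "hd xs = Min A" using sorted_list_of_set_nonempty[OF assms(1,2)] by (simp add: xs_def)
  then have "admissible ?Es"
    using xs ne assms(3) strict_sorted_iff[of xs]
    by (auto simp: admissible_def hd_map sorted_wrt_map)
  from admissible_sum_norm_le[OF this, of x]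
  have "(\<Sum>k\<leftarrow>xs. norm (restr {k} x)) \<le> 2 * norm x" by (simp add: comp_def)
  moreover have "(\<Sum>k\<leftarrow>xs. \<bar>coord x k\<bar>) \<le> (\<Sum>k\<leftarrow>xs. norm (restr {k} x))"
    by (rule sum_list_mono) (metis abs_coord_le_norm coord_restr singletonI)
  moreover have "(\<Sum>k\<leftarrow>xs. \<bar>coord x k\<bar>) = (\<Sum>k\<in>A. \<bar>coord x k\<bar>)"
    using xs(1,3) by (simp add: sum_list_distinct_conv_sum_set)
  ultimately show ?thesis by linarith
qed

section \<open>Order property\<close>

text \<open>The mass 2 compensates the factor 1/2 of the norm: the block stays in the unit ball for
  \<open>2 \<le> R\<close>, and reaches norm 1 whenever an admissible family can separate its
  coordinates.\<close>

definition block :: "nat \<Rightarrow> nat \<Rightarrow> c00" where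
  "block s R = (\<Sum>k\<in>{s<..s + R}. (2 / real R) *\<^sub>R basis k)"

lemma coord_block: "coord (block s R) k = (if s < k \<and> k \<le> s + R then 2 / real R else 0)"
proof -
  have "coord (block s R) k = (\<Sum>i\<in>{s<..s + R}. if k = i then 2 / real R else 0)"
    unfolding block_def coord_sum by (intro sum.cong) (auto simp: coord_scaleR coord_basis)
  also have "\<dots> = (if s < k \<and> k \<le> s + R then 2 / real R else 0)"
    by (subst sum.delta') auto
  finally show ?thesis .
qed

lemma l1_block: "0 < R \<Longrightarrow> l1 (block s R) = 2"
  by (subst l1_eq_sum[of "{s<..s + R}"]) (auto simp: coord_block)

lemma norm_block_le: "2 \<le> R \<Longrightarrow> norm (block s R) \<le> 1"
  by (rule norm_le_max_sup_l1) (auto simp: coord_block l1_block)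

lemma norm_basis_le: "0 < m \<Longrightarrow> norm (basis m) \<le> 1"
proof -
  assume "0 < m"
  then have "l1 (basis m) = 1"
    by (subst l1_eq_sum[of "{m}"]) (auto simp: coord_basis)
  with norm_le_l1[of "basis m"] show ?thesis by simp
qed

text \<open>The \<open>R + 1\<close> coordinates can be separated by singletons starting at
  \<open>m\<close>, which gives half the l1 norm, (1 + 2)/2.\<close>

lemma norm_basis_add_block_ge:
  assumes "0 < R" "R < m" "m \<le> s"
  shows "3 / 2 \<le> norm (basis m + block s R)"
proof -
  let ?A = "insert m {s<..s + R}"
  have "Min ?A = m"
    using assms by (intro Min_eqI) auto
  moreover have "card ?A = R + 1" using assms by simp
  ultimately have "(\<Sum>k\<in>?A. \<bar>coord (basis m + block s R) k\<bar>) \<le> 2 * norm (basis m + block s R)"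
    using assms by (intro sum_coord_le_norm) auto
  moreover have "(\<Sum>k\<in>?A. \<bar>coord (basis m + block s R) k\<bar>) = 1 + (\<Sum>k\<in>{s<..s + R}. 2 / real R)"
    using assms by (simp add: coord_add coord_basis coord_block)
  ultimately show ?thesis using assms by simp
qed

text \<open>The first member has the smallest minimum, so the bound on the length passes to every
  element of every member.\<close>

lemma admissible_length_le:
  assumes "admissible Es" "E \<in> set Es" "k \<in> E"
  shows "length Es \<le> k"
proof -
  obtain F Fs where Es: "Es = F # Fs" using assms(1) by (cases Es) (auto simp: admissible_def)
  have fin: "finite E" "E \<noteq> {}" "finite F" "F \<noteq> {}" using assms Es by (auto simp: admissible_def)
  have "Min F \<le> Min E"
  proof (cases "E = F")
    case False
    then have "E \<in> set Fs" using assms(2) Es by simp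
    moreover have "sorted_wrt (\<lambda>E F. Max E < Min F) (F # Fs)"
      using assms(1) Es by (simp only: admissible_def)
    ultimately have "Max F < Min E" by (simp only: sorted_wrt.simps)
    then show ?thesis using fin Max_ge[OF fin(3) Min_in[OF fin(3,4)]] by linarith
  qed simp
  also have "Min E \<le> k" using fin assms(3) by simp
  finally show ?thesis using assms(1) Es by (simp add: admissible_def)
qed

lemma admissible_sum_basis_le:
  assumes "admissible Es" "0 < m"
  shows "(\<Sum>E\<leftarrow>Es. norm (restr E (basis m))) \<le> 1"
proof -
  have "(\<Sum>E\<leftarrow>Es. norm (restr E (basis m))) \<le> (\<Sum>E\<leftarrow>Es. l1 (restr E (basis m)))"
    by (rule sum_list_mono) (rule norm_le_l1)
  also have "\<dots> \<le> l1 (basis m)" by (rule admissible_sum_l1_le[OF assms(1)])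
  also have "\<dots> = 1" using assms(2) by (subst l1_eq_sum[of "{m}"]) (auto simp: coord_basis)
  finally show ?thesis .
qed

text \<open>A family meeting \<open>m\<close> has at most \<open>m\<close> members, and each sees of
  the block at most one coordinate 2/R plus half of the mass it covers. The total is at most 1 +
  2m/R + 1, hence at most 5/2, and half of it is 5/4. A family missing \<open>m\<close> sees only
  the block.\<close>

lemma norm_basis_add_block_le:
  assumes "0 < m" "4 * m \<le> R" "m \<le> s"
  shows "norm (basis m + block s R) \<le> 5 / 4"
proof (rule norm_c00_le)
  have R: "2 / real R \<le> 1 / 2" "8 / real R \<le> 5" "0 < R" using assms by (auto simp: field_simps)
  show "\<bar>coord (basis m + block s R) k\<bar> \<le> 5 / 4" for k
    using R assms by (auto simp: coord_add coord_basis coord_block)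
  fix Es assume Es: "admissible Es"
  show "(\<Sum>E\<leftarrow>Es. norm (restr E (basis m + block s R))) \<le> 2 * (5 / 4)"
  proof (cases "\<exists>E\<in>set Es. m \<in> E")
    case False
    then have "restr E (basis m + block s R) = restr E (block s R)" if "E \<in> set Es" for E
      using that assms(1) by (intro coord_eqI) (auto simp: coord_restr coord_add coord_basis)
    then have "(\<Sum>E\<leftarrow>Es. norm (restr E (basis m + block s R))) = (\<Sum>E\<leftarrow>Es. norm (restr E (block s R)))"
      by (simp cong: map_cong)
    also have "\<dots> \<le> 2 * norm (block s R)" by (rule admissible_sum_norm_le[OF Es])
    also have "\<dots> \<le> 2" using norm_block_le[of R s] assms by simp
    finally show ?thesis by simp
  next
    case True
    then have len: "length Es \<le> m" using admissible_length_le[OF Es] by blast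
    have "norm (restr E (basis m + block s R)) \<le>
        norm (restr E (basis m)) + (2 / real R + 1 / 2 * l1 (restr E (block s R)))" for E
    proof -
      have "norm (restr E (block s R)) \<le> 2 / real R + 1 / 2 * l1 (restr E (block s R))"
        using norm_restr_le_half_l1[of "block s R" "2 / real R" E] by (simp add: coord_block)
      then show ?thesis
        using norm_triangle_ineq[of "restr E (basis m)" "restr E (block s R)"] unfolding restr_add by linarith
    qed
    then have "(\<Sum>E\<leftarrow>Es. norm (restr E (basis m + block s R))) \<le>
        (\<Sum>E\<leftarrow>Es. norm (restr E (basis m)) + (2 / real R + 1 / 2 * l1 (restr E (block s R))))"
      by (rule sum_list_mono)
    also have "\<dots> = (\<Sum>E\<leftarrow>Es. norm (restr E (basis m))) + (real (length Es) * (2 / real R) +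
        1 / 2 * (\<Sum>E\<leftarrow>Es. l1 (restr E (block s R))))"
      unfolding sum_list_addf sum_list_const_mult by (simp add: sum_list_triv)
    also have "\<dots> \<le> 1 + (real m * (2 / real R) + 1 / 2 * 2)"
      using admissible_sum_basis_le[OF Es assms(1)] admissible_sum_l1_le[OF Es, of "block s R"] len R
      by (intro add_mono mult_left_mono mult_right_mono) (auto simp: l1_block)
    also have "\<dots> \<le> 2 * (5 / 4)" using assms R by (simp add: field_simps)
    finally show ?thesis .
  qed
qed

section \<open>Isometric copies of l1\<close>

definition basis_pair :: "nat \<Rightarrow> nat \<Rightarrow> c00" where
  "basis_pair n i = basis (n + 1 + 2 * i) + basis (n + 2 + 2 * i)"

lemma norm_basis_pair_le: "norm (basis_pair n i) \<le> 1"
proof (rule norm_le_max_sup_l1)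
  show "\<bar>coord (basis_pair n i) k\<bar> \<le> 1" for k
    by (auto simp: basis_pair_def coord_add coord_basis)
  show "l1 (basis_pair n i) \<le> 2 * 1"
    by (subst l1_eq_sum[of "{n + 1 + 2 * i, n + 2 + 2 * i}"])
      (auto simp: basis_pair_def coord_add coord_basis)
qed

text \<open>The functionals that norm combinations of pairs: \<open>T\<close> pairs beyond
  \<open>n\<close> use \<open>2 * T\<close> coordinates, few enough to be separated by
  singletons.\<close>

lemma sum_pair_coord_le_norm:
  fixes x :: c00 and \<sigma> :: "nat \<Rightarrow> real"
  assumes "0 < T" "2 * T \<le> n" "inj s" "\<And>t. \<bar>\<sigma> t\<bar> \<le> 1"
  shows "(\<Sum>t<T. \<sigma> t * (coord x (n + 1 + 2 * s t) + coord x (n + 2 + 2 * s t))) \<le> 2 * norm x"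
proof -
  let ?f = "\<lambda>t. n + 1 + 2 * s t" and ?g = "\<lambda>t. n + 2 + 2 * s t"
  let ?A = "?f ` {..<T} \<union> ?g ` {..<T}"
  have fg: "inj_on ?f {..<T}" "inj_on ?g {..<T}"
    using assms(3) by (auto simp: inj_on_def inj_def)
  have disj: "?f ` {..<T} \<inter> ?g ` {..<T} = {}"
    by auto presburger
  have "card ?A \<le> T + T"
    by (rule order_trans[OF card_Un_le])
      (simp only: card_image[OF fg(1)] card_image[OF fg(2)] card_lessThan order_refl)
  moreover have "n \<le> Min ?A" using assms(1) by (intro Min.boundedI) auto
  ultimately have "(\<Sum>k\<in>?A. \<bar>coord x k\<bar>) \<le> 2 * norm x"
    using assms(1,2) by (intro sum_coord_le_norm) auto
  moreover have "(\<Sum>k\<in>?A. \<bar>coord x k\<bar>) = (\<Sum>t<T. \<bar>coord x (?f t)\<bar> + \<bar>coord x (?g t)\<bar>)"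
    by (subst sum.union_disjoint[OF _ _ disj])
      (simp_all only: finite_imageI finite_lessThan sum.reindex[OF fg(1)] sum.reindex[OF fg(2)] comp_def sum.distrib)
  moreover have "(\<Sum>t<T. \<sigma> t * (coord x (?f t) + coord x (?g t))) \<le>
      (\<Sum>t<T. \<bar>coord x (?f t)\<bar> + \<bar>coord x (?g t)\<bar>)"
  proof (rule sum_mono)
    fix t
    have "\<sigma> t * (coord x (?f t) + coord x (?g t)) \<le> \<bar>\<sigma> t\<bar> * \<bar>coord x (?f t) + coord x (?g t)\<bar>"
      by (metis abs_ge_self abs_mult)
    also have "\<dots> \<le> 1 * \<bar>coord x (?f t) + coord x (?g t)\<bar>"
      by (intro mult_right_mono assms) simp
    also have "\<dots> \<le> \<bar>coord x (?f t)\<bar> + \<bar>coord x (?g t)\<bar>"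
      using abs_triangle_ineq by simp
    finally show "\<sigma> t * (coord x (?f t) + coord x (?g t)) \<le> \<bar>coord x (?f t)\<bar> + \<bar>coord x (?g t)\<bar>" .
  qed
  ultimately show ?thesis by linarith
qed

text \<open>
  In an isometric copy of l1 the vector below has norm 1, whereas its norm is bounded away from 1
  in Tsirelson's space if \<open>r\<close> and \<open>s\<close> are large enough.
\<close>

definition l1_test :: "nat \<Rightarrow> (nat \<Rightarrow> nat) \<Rightarrow> (nat \<Rightarrow> 'a::real_vector) \<Rightarrow> 'a" where
  "l1_test r s z = (1 / 2) *\<^sub>R z (s 0) + (1 / 2) *\<^sub>R ((1 / real r) *\<^sub>R
     (\<Sum>i<r. (1 / 2) *\<^sub>R (z (s (2 * i + 1)) - z (s (2 * i + 2)))))"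

text \<open>\<open>l1_test\<close> is linear with coefficients of total absolute value 1: one half
  for the first vector and 1/(4r) for each of the 2r others.\<close>

lemma norm_l1_test_diff_le:
  fixes z w :: "nat \<Rightarrow> 'a::real_normed_vector"
  assumes "\<And>i. norm (z i - w i) \<le> \<eta>" "0 < r"
  shows "norm (l1_test r s z - l1_test r s w) \<le> \<eta>"
proof -
  let ?d = "\<lambda>i. z i - w i"
  have "l1_test r s z - l1_test r s w = l1_test r s ?d"
    by (simp add: l1_test_def scaleR_diff_right sum_subtractf sum.distrib algebra_simps)
  also have "norm \<dots> \<le> (1 / 2) * \<eta> + (1 / 2) * ((1 / real r) * (\<Sum>i<r. \<eta>))"
  proof -
    let ?S = "\<Sum>i<r. (1 / 2) *\<^sub>R (?d (s (2 * i + 1)) - ?d (s (2 * i + 2)))"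
    have "norm ?S \<le> (\<Sum>i<r. \<eta>)"
    proof (rule order_trans[OF norm_sum], rule sum_mono)
      fix i
      show "norm ((1 / 2) *\<^sub>R (?d (s (2 * i + 1)) - ?d (s (2 * i + 2)))) \<le> \<eta>"
        using norm_triangle_ineq4[of "?d (s (2 * i + 1))" "?d (s (2 * i + 2))"]
          assms(1)[of "s (2 * i + 1)"] assms(1)[of "s (2 * i + 2)"] by simp
    qed
    then have "(1 / 2) * ((1 / real r) * norm ?S) \<le> (1 / 2) * ((1 / real r) * (\<Sum>i<r. \<eta>))"
      by (intro mult_left_mono) auto
    then have "norm ((1 / 2) *\<^sub>R ((1 / real r) *\<^sub>R ?S)) \<le> (1 / 2) * ((1 / real r) * (\<Sum>i<r. \<eta>))"
      by (simp only: norm_scaleR) simp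
    moreover have "norm ((1 / 2) *\<^sub>R ?d (s 0)) \<le> (1 / 2) * \<eta>" using assms(1)[of "s 0"] by simp
    ultimately show ?thesis unfolding l1_test_def by (intro norm_triangle_mono)
  qed
  also have "\<dots> = \<eta>" using assms(2) by simp
  finally show ?thesis .
qed

lemma coord_basis_pair:
  "coord (basis_pair n i) (n + 1 + 2 * j) = (if j = i then 1 else 0)"
  "coord (basis_pair n i) (n + 2 + 2 * j) = (if j = i then 1 else 0)"
  unfolding basis_pair_def coord_add by (auto simp: coord_basis) presburger+

text \<open>The lower bound pairs the vector with the functional whose signs match its coefficients.
  The bound on \<open>n\<close> is twice the number \<open>2 * r + 1\<close> of pairs.\<close>

lemma norm_l1_test_basis_pair:
  assumes "0 < r" "4 * r + 2 \<le> n" "strict_mono s"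
  shows "norm (l1_test r s (basis_pair n)) = 1"
proof (rule antisym)
  show "norm (l1_test r s (basis_pair n)) \<le> 1"
    using norm_l1_test_diff_le[of "basis_pair n" "\<lambda>_. 0" 1 r s] norm_basis_pair_le assms(1)
    by (simp add: l1_test_def)
  \<comment> \<open>In \<open>l1_test\<close> exactly the positive even positions carry a minus
    sign.\<close>
  define \<sigma> :: "nat \<Rightarrow> real" where "\<sigma> t = (if 0 < t \<and> even t then - 1 else 1)" for t
  define \<phi> where "\<phi> x = (\<Sum>t<2 * r + 1. \<sigma> t * (coord x (n + 1 + 2 * s t) + coord x (n + 2 + 2 * s t)))" for x
  have inj: "inj s" using assms(3) by (rule strict_mono_imp_inj_on)
  have pair: "\<phi> (basis_pair n (s u)) = 2 * \<sigma> u" if "u < 2 * r + 1" for u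
  proof -
    have "\<phi> (basis_pair n (s u)) = (\<Sum>t<2 * r + 1. if t = u then 2 * \<sigma> u else 0)"
      unfolding \<phi>_def coord_basis_pair using inj by (intro sum.cong) (auto dest: injD)
    with that show ?thesis by simp
  qed
  have lin: "linear \<phi>"
    by (rule linearI)
      (simp_all add: \<phi>_def coord_add coord_scaleR algebra_simps sum.distrib sum_distrib_left)
  have "\<phi> (l1_test r s (basis_pair n)) = 1 / 2 * (2 * 1) + 1 / 2 * (1 / real r * (\<Sum>i<r. 1 / 2 * (2 * 1 - 2 * (- 1))))"
    unfolding l1_test_def linear_add[OF lin] linear_scale[OF lin] linear_sum[OF lin] linear_diff[OF lin]
    by (simp add: pair) (simp add: \<sigma>_def)
  also have "\<dots> = 2" using assms(1) by simp
  finally have "2 = \<phi> (l1_test r s (basis_pair n))" by simp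
  also have "\<dots> \<le> 2 * norm (l1_test r s (basis_pair n))"
    unfolding \<phi>_def using assms inj by (intro sum_pair_coord_le_norm) (auto simp: \<sigma>_def)
  finally show "1 \<le> norm (l1_test r s (basis_pair n))" by simp
qed

section \<open>No isometric l1 sequence in Tsirelson's space\<close>

lemma sum_list_sum_swap:
  "(\<Sum>x\<leftarrow>xs. \<Sum>i\<in>I. f x i) = (\<Sum>i\<in>I. \<Sum>x\<leftarrow>xs. (f x i :: 'b::comm_monoid_add))"
  by (induction xs) (simp_all add: sum.distrib)

text \<open>
  The estimate of Figiel and Johnson. An admissible family reaching below \<open>m\<close> has at most \<open>m\<close>
  members, and therefore at most \<open>m\<close> of the successive vectors \<open>v i\<close> are met by more than one
  member; each of the others contributes to the sum only once, with its norm.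
\<close>

lemma figiel_johnson:
  fixes v :: "nat \<Rightarrow> c00" and b :: "nat \<Rightarrow> nat"
  assumes "0 < r" "mono b" "m \<le> b 0"
    and v0: "\<And>k. m < k \<Longrightarrow> coord v0 k = 0" "norm v0 \<le> C"
    and v: "\<And>i k. k \<notin> {b i<..b (Suc i)} \<Longrightarrow> coord (v i) k = 0" "\<And>i. norm (v i) \<le> C"
  shows "norm (v0 + (1 / real r) *\<^sub>R (\<Sum>i<r. v i)) \<le> C * (3 / 2 + real m / real r)"
proof (rule norm_c00_le)
  have C: "0 \<le> C" using v0(2) norm_ge_zero order_trans by blast
  define a where "a = (1 / real r) *\<^sub>R (\<Sum>i<r. v i)"
  have "norm (\<Sum>i<r. v i) \<le> real r * C"
    using sum_norm_le[of "{..<r}" v "\<lambda>_. C"] v(2) by simp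
  then have a: "norm a \<le> C" using assms(1) by (simp add: a_def field_simps)
  have small: "coord a k = 0" if "k \<le> m" for k
  proof -
    have "k \<le> b i" for i using that assms(3) monoD[OF assms(2), of 0 i] by simp
    then show ?thesis by (simp add: a_def coord_scaleR coord_sum v(1) leD)
  qed
  have D: "C \<le> C * (3 / 2 + real m / real r)" "2 * C \<le> 2 * (C * (3 / 2 + real m / real r))"
  proof -
    have "0 \<le> real m / real r" by simp
    then have "1 \<le> 3 / 2 + real m / real r" by linarith
    from mult_left_mono[OF this C]
    show "C \<le> C * (3 / 2 + real m / real r)" "2 * C \<le> 2 * (C * (3 / 2 + real m / real r))" by simp_all
  qed
  show "\<bar>coord (v0 + (1 / real r) *\<^sub>R (\<Sum>i<r. v i)) k\<bar> \<le> C * (3 / 2 + real m / real r)" for k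
    using small[of k] v0(1)[of k] abs_coord_le_norm[of v0 k] abs_coord_le_norm[of a k] v0(2) a D(1)
    unfolding a_def[symmetric] coord_add by (cases "k \<le> m") auto
  fix Es assume Es: "admissible Es"
  show "(\<Sum>E\<leftarrow>Es. norm (restr E (v0 + (1 / real r) *\<^sub>R (\<Sum>i<r. v i)))) \<le> 2 * (C * (3 / 2 + real m / real r))"
  \<comment> \<open>A family lying beyond \<open>m\<close> does not see \<open>v0\<close> and is
    bounded by the average alone.\<close>
  proof (cases "\<exists>E\<in>set Es. \<exists>k\<in>E. k \<le> m")
    case False
    then have "restr E (v0 + a) = restr E a" if "E \<in> set Es" for E
      using that v0(1) by (intro coord_eqI) (auto simp: coord_restr coord_add not_le)
    then have "(\<Sum>E\<leftarrow>Es. norm (restr E (v0 + a))) = (\<Sum>E\<leftarrow>Es. norm (restr E a))"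
      by (simp cong: map_cong)
    also have "\<dots> \<le> 2 * norm a" by (rule admissible_sum_norm_le[OF Es])
    finally show ?thesis using a D(2) unfolding a_def by linarith
  next
    case True
    then have len: "length Es \<le> m" using admissible_length_le[OF Es] by (meson order_trans)
    let ?meets = "\<lambda>j i. j < length Es \<and> Es ! j \<inter> {b i<..b (Suc i)} \<noteq> {}"
    define X where "X = {i. i < r \<and> (\<exists>j j'. j < j' \<and> ?meets j i \<and> ?meets j' i)}"
    have finX: "finite X" by (simp add: X_def)
    define g where "g i = (LEAST j. ?meets j i)" for i
    have least: "?meets (g i) i" "\<exists>j'>g i. ?meets j' i" if i: "i \<in> X" for i
    proof -
      obtain j j' where *: "j < j'" "?meets j i" "?meets j' i" using i by (auto simp: X_def)
      show "?meets (g i) i" unfolding g_def by (rule LeastI[of "\<lambda>j. ?meets j i"]) fact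
      have "g i \<le> j" unfolding g_def by (rule Least_le) fact
      with *(1) have "g i < j'" by linarith
      with *(3) show "\<exists>j'>g i. ?meets j' i" by blast
    qed
    \<comment> \<open>If the first member meeting \<open>v i\<close> also reached a later
      \<open>v i'\<close>, the second member meeting \<open>v i\<close> would come after a point
      beyond \<open>b i'\<close>, yet it contains a point up to \<open>b (Suc i)\<close>.\<close>
    have "g i \<noteq> g i'" if i: "i \<in> X" "i' \<in> X" "i < i'" for i i'
    proof
      assume "g i = g i'"
      obtain j' where j': "g i < j'" "?meets j' i" using least(2)[OF i(1)] by blast
      obtain y where y: "y \<in> Es ! j'" "y \<le> b (Suc i)" using j'(2) by auto
      have "?meets (g i) i'" using least(1)[OF i(2)] \<open>g i = g i'\<close> by simp
      then obtain x where x: "x \<in> Es ! g i" "b i' < x" and jl: "g i < length Es" by auto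
      have "sorted_wrt (\<lambda>E F. Max E < Min F) Es" using Es by (simp only: admissible_def)
      from sorted_wrt_nth_less[OF this j'(1)] j'(2)
      have "Max (Es ! g i) < Min (Es ! j')" by blast
      moreover have "finite (Es ! g i)" "finite (Es ! j')"
        using Es jl j'(2) by (auto simp: admissible_def)
      ultimately have "x < y"
        using Max_ge[OF _ x(1)] Min_le[OF _ y(1)] by linarith
      with x y monoD[OF assms(2), of "Suc i" i'] i(3) show False by simp
    qed
    then have "inj_on g X"
      by (intro linorder_inj_onI) auto
    moreover have "g ` X \<subseteq> {..<length Es}" using least(1) by blast
    ultimately have "card X \<le> card {..<length Es}" by (rule card_inj_on_le) simp
    then have card: "card X \<le> m" using len by simp
    \<comment> \<open>For \<open>i\<close> in \<open>X\<close> the general bound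
      \<open>2 * C\<close> is used; otherwise at most one member sees \<open>v i\<close>.\<close>
    have once: "(\<Sum>E\<leftarrow>Es. norm (restr E (v i))) \<le> C + (if i \<in> X then C else 0)" if "i < r" for i
    proof (cases "i \<in> X")
      case True
      then show ?thesis using admissible_sum_norm_le[OF Es, of "v i"] v(2)[of i] by simp
    next
      case False
      have zero: "restr (Es ! j) (v i) = 0" if "j < length Es" "\<not> ?meets j i" for j
      proof (rule coord_eqI)
        fix k
        have "k \<in> Es ! j \<Longrightarrow> k \<notin> {b i<..b (Suc i)}" using that by blast
        then show "coord (restr (Es ! j) (v i)) k = coord 0 k"
          using v(1)[of k i] by (auto simp only: coord_restr zero_c00.rep_eq if_cancel split: if_split)
      qed
      have "(\<Sum>j<length Es. norm (restr (Es ! j) (v i))) \<le> C"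
      proof (cases "\<exists>j. ?meets j i")
        case True
        then obtain j where j: "?meets j i" by blast
        have "\<not> ?meets j' i" if "j' \<noteq> j" for j'
        proof
          assume j': "?meets j' i"
          have "j < j' \<or> j' < j" using that by linarith
          then have "\<exists>j j'. j < j' \<and> ?meets j i \<and> ?meets j' i" using j j' by blast
          then have "i \<in> X" using \<open>i < r\<close> unfolding X_def by simp
          with False show False ..
        qed
        then have "(\<Sum>j<length Es. norm (restr (Es ! j) (v i))) = (\<Sum>j\<in>{j}. norm (restr (Es ! j) (v i)))"
          using j zero by (intro sum.mono_neutral_right) auto
        also have "\<dots> \<le> C" using norm_restr_le[of "Es ! j" "v i"] v(2)[of i] by simp
        finally show ?thesis .
      next
        case False
        then have "(\<Sum>j<length Es. norm (restr (Es ! j) (v i))) = 0"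
          using zero by (intro sum.neutral) auto
        with C show ?thesis by simp
      qed
      with False show ?thesis by (simp add: sum_list_sum_nth atLeast0LessThan)
    qed
    have "norm (restr E (v0 + (1 / real r) *\<^sub>R (\<Sum>i<r. v i))) \<le>
        norm (restr E v0) + 1 / real r * (\<Sum>i<r. norm (restr E (v i)))" for E
      unfolding restr_add restr_scaleR restr_sum
      by (rule norm_triangle_mono) (simp_all add: divide_right_mono norm_sum)
    then have "(\<Sum>E\<leftarrow>Es. norm (restr E (v0 + (1 / real r) *\<^sub>R (\<Sum>i<r. v i)))) \<le>
        (\<Sum>E\<leftarrow>Es. norm (restr E v0) + 1 / real r * (\<Sum>i<r. norm (restr E (v i))))"
      by (rule sum_list_mono)
    also have "\<dots> = (\<Sum>E\<leftarrow>Es. norm (restr E v0)) + 1 / real r * (\<Sum>i<r. \<Sum>E\<leftarrow>Es. norm (restr E (v i)))"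
      unfolding sum_list_addf sum_list_const_mult sum_list_sum_swap ..
    \<comment> \<open>The constant 3/2 is half of 3: a share \<open>2 * C\<close> from
      \<open>v0\<close> and a share \<open>C\<close> from the average. The vectors in
      \<open>X\<close> add at most \<open>C * m / r\<close>.\<close>
    also have "\<dots> \<le> 2 * C + 1 / real r * (\<Sum>i<r. C + (if i \<in> X then C else 0))"
      using admissible_sum_norm_le[OF Es, of v0] v0(2)
      by (intro add_mono mult_left_mono sum_mono once) auto
    also have "(\<Sum>i<r. C + (if i \<in> X then C else 0)) = real r * C + real (card X) * C"
    proof -
      have "{..<r} \<inter> X = X" by (auto simp: X_def)
      then show ?thesis by (simp add: sum.distrib sum.If_cases)
    qed
    also have "2 * C + 1 / real r * (real r * C + real (card X) * C) \<le> 2 * C + 1 / real r * (real r * C + real m * C)"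
      using card C by (intro add_mono mult_left_mono mult_right_mono) auto
    also have "\<dots> \<le> 2 * (C * (3 / 2 + real m / real r))"
      using assms(1) C by (simp add: field_simps)
    finally show ?thesis .
  qed
qed

text \<open>All coordinates converge along the ultrafilter, so two late members almost agree on a
  finite initial segment and their difference almost lives beyond \<open>b\<close>.\<close>

lemma close_pair_on_initial_segment:
  fixes w :: "nat \<Rightarrow> c00"
  assumes "\<And>i. norm (w i) \<le> C" "0 < \<delta>"
  shows "\<exists>p q. b < p \<and> p < q \<and> norm (restr {..b} (w p - w q)) \<le> \<delta>"
proof -
  define l where "l k = ulim (\<lambda>i. coord (w i) k)" for k
  have lim: "((\<lambda>i. coord (w i) k) \<longlongrightarrow> l k) ultra" for k
    unfolding l_def
    using abs_coord_le_norm[of "w _" k] assms(1) by (intro tendsto_ulim[of _ C] always_eventually) (meson order_trans)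
  \<comment> \<open>There are \<open>b + 1\<close> coordinates, on each of which the two members
    differ by at most \<open>2 * d\<close>.\<close>
  define d where "d = \<delta> / (2 * real (Suc b))"
  have "d > 0" using assms(2) by (simp add: d_def)
  then have "eventually (\<lambda>i. \<forall>k\<in>{..b}. dist (coord (w i) k) (l k) < d) ultra"
    by (intro eventually_ball_finite ballI tendstoD[OF lim]) auto
  then have ex: "\<exists>i\<ge>N. \<forall>k\<in>{..b}. \<bar>coord (w i) k - l k\<bar> < d" for N
    unfolding dist_real_def by (rule eventually_ultra_ex)
  obtain p where p: "p \<ge> Suc b" "\<And>k. k \<le> b \<Longrightarrow> \<bar>coord (w p) k - l k\<bar> < d" using ex[of "Suc b"] by auto
  obtain q where q: "q \<ge> Suc p" "\<And>k. k \<le> b \<Longrightarrow> \<bar>coord (w q) k - l k\<bar> < d" using ex[of "Suc p"] by auto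
  have "norm (restr {..b} (w p - w q)) \<le> l1 (restr {..b} (w p - w q))" by (rule norm_le_l1)
  also have "\<dots> = (\<Sum>k\<in>{..b}. \<bar>coord (w p) k - coord (w q) k\<bar>)"
    by (subst l1_eq_sum[of "{..b}"]) (auto simp: coord_restr coord_diff)
  also have "\<dots> \<le> (\<Sum>k\<in>{..b}. 2 * d)"
  proof (rule sum_mono)
    fix k assume "k \<in> {..b}"
    with p(2)[of k] q(2)[of k] show "\<bar>coord (w p) k - coord (w q) k\<bar> \<le> 2 * d" by simp
  qed
  also have "\<dots> = \<delta>" by (simp add: d_def field_simps)
  finally show ?thesis using p(1) q(1) by (intro exI[of _ p] exI[of _ q]) simp
qed

lemma support_bound: "\<exists>m. \<forall>k>m. coord x k = 0"
  using finite_support_coord[of x] unfolding finite_nat_set_iff_bounded by (metis (mono_tags) mem_Collect_eq less_asym)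

text \<open>Halved differences of close pairs are successive vectors up to a small error, so
  \<open>figiel_johnson\<close> applies with \<open>C = 65 / 64\<close>. The bound 65/64 * 13/8
  stays well below 2, which leaves room for the errors of approximation.\<close>

theorem norm_l1_test_tsirelson_less:
  fixes z :: "nat \<Rightarrow> tsirelson"
  assumes z: "\<And>i. norm (z i) \<le> 1"
  shows "\<exists>r s. 0 < r \<and> strict_mono s \<and> norm (l1_test r s z) < 1"
proof -
  have "\<forall>i. \<exists>w. norm (z i - to_completion w) < 1 / 64" by (intro allI to_completion_approx) simp
  then obtain w where w: "\<And>i. norm (z i - to_completion (w i)) < 1 / 64" by metis
  have nw: "norm (w i) \<le> 65 / 64" for i
    using norm_triangle_sub[of "to_completion (w i)" "z i"] w[of i] z[of i]
    by (simp add: norm_to_completion norm_minus_commute)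
  obtain m0 where "\<And>k. k > m0 \<Longrightarrow> coord (w 0) k = 0" using support_bound by blast
  \<comment> \<open>Positivity of \<open>m\<close> makes \<open>r = 8 * m\<close> positive.\<close>
  then obtain m where m: "0 < m" "\<And>k. k > m \<Longrightarrow> coord (w 0) k = 0"
    by (intro that[of "Suc m0"]) auto
  \<comment> \<open>The number \<open>b\<close> bounds both coordinates and indices: the pair is
    taken after index \<open>b\<close> and nearly vanishes up to coordinate \<open>b\<close>, while
    \<open>b'\<close> lies beyond both indices and both supports. Iterating gives increasing indices
    and successive vectors at once.\<close>
  have "\<exists>p q b'. b < p \<and> p < q \<and> q < b' \<and> norm (restr {..b} (w p - w q)) \<le> 1 / 64 \<and>
    (\<forall>k>b'. coord (w p) k = 0 \<and> coord (w q) k = 0)" for b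
  proof -
    obtain p q where pq: "b < p" "p < q" "norm (restr {..b} (w p - w q)) \<le> 1 / 64"
      using close_pair_on_initial_segment[of w "65 / 64" "1 / 64" b] nw by auto
    obtain m1 m2 where "\<And>k. k > m1 \<Longrightarrow> coord (w p) k = 0" "\<And>k. k > m2 \<Longrightarrow> coord (w q) k = 0"
      using support_bound[of "w p"] support_bound[of "w q"] by blast
    with pq show ?thesis by (intro exI[of _ p] exI[of _ q] exI[of _ "Suc (q + m1 + m2)"]) auto
  qed
  then obtain P Q B where PQB: "\<And>b. b < P b" "\<And>b. P b < Q b" "\<And>b. Q b < B b"
    "\<And>b. norm (restr {..b} (w (P b) - w (Q b))) \<le> 1 / 64"
    "\<And>b k. k > B b \<Longrightarrow> coord (w (P b)) k = 0 \<and> coord (w (Q b)) k = 0"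
    by metis
  define b where "b i = (B ^^ i) m" for i
  have b: "b 0 = m" "b (Suc i) = B (b i)" for i by (simp_all add: b_def)
  have "b i \<le> b (Suc i)" for i
    using PQB(1)[of "b i"] PQB(2)[of "b i"] PQB(3)[of "b i"] b(2)[of i] by linarith
  then have "mono b" by (simp add: mono_iff_le_Suc)
  \<comment> \<open>Lists the indices as 0, then \<open>P (b 0)\<close>, \<open>Q (b 0)\<close>,
    \<open>P (b 1)\<close>, \<open>Q (b 1)\<close> and so on, in the order in which
    \<open>l1_test\<close> reads them.\<close>
  define s where "s t = (if t = 0 then 0 else if odd t then P (b (t div 2)) else Q (b (t div 2 - 1)))" for t
  have s: "s 0 = 0" "s (2 * i + 1) = P (b i)" "s (2 * i + 2) = Q (b i)" for i
    by (simp_all add: s_def)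
  have "s t < s (Suc t)" for t
  proof (cases "t = 0")
    case True
    then show ?thesis using PQB(1)[of "b 0"] s(1) s(2)[of 0] by simp
  next
    case False
    then obtain i where "t = 2 * i + 1 \<or> t = 2 * i + 2"
      by (metis add_2_eq_Suc' add_Suc_right gr0_implies_Suc mult_Suc_right oddE evenE not_gr_zero add.commute mult_0_right)
    then show ?thesis
    proof
      assume "t = 2 * i + 1"
      then show ?thesis using s(2)[of i] s(3)[of i] PQB(2)[of "b i"] by simp
    next
      assume t: "t = 2 * i + 2"
      have "s (Suc t) = P (B (b i))" using s(2)[of "Suc i"] b(2) t by simp
      then show ?thesis using t s(3)[of i] PQB(3)[of "b i"] PQB(1)[of "B (b i)"] by simp
    qed
  qed
  then have mono_s: "strict_mono s" by (simp add: strict_mono_Suc_iff)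
  \<comment> \<open>This makes the factor 3/2 + m/r equal to 13/8.\<close>
  define r where "r = 8 * m"
  have r: "0 < r" using m(1) by (simp add: r_def)
  define D where "D i = (1 / 2) *\<^sub>R (w (P (b i)) - w (Q (b i)))" for i
  define v where "v i = restr {b i<..} (D i)" for i
  have nD: "norm (D i) \<le> 65 / 64" for i
    using norm_triangle_ineq4[of "w (P (b i))" "w (Q (b i))"] nw[of "P (b i)"] nw[of "Q (b i)"]
    by (simp add: D_def)
  have Dv: "norm (D i - v i) \<le> 1 / 128" for i
  proof -
    have "D i - v i = (1 / 2) *\<^sub>R restr {..b i} (w (P (b i)) - w (Q (b i)))"
      by (rule coord_eqI) (auto simp: D_def v_def coord_diff coord_restr coord_scaleR)
    with PQB(4)[of "b i"] show ?thesis by simp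
  qed
  have "norm (w 0 + (1 / real r) *\<^sub>R (\<Sum>i<r. v i)) \<le> 65 / 64 * (3 / 2 + real m / real r)"
  proof (rule figiel_johnson[OF r \<open>mono b\<close>])
    show "coord (v i) k = 0" if "k \<notin> {b i<..b (Suc i)}" for i k
      using that PQB(5)[of "b i" k] b(2)[of i]
      by (auto simp: v_def D_def coord_restr coord_scaleR coord_diff)
    show "norm (v i) \<le> 65 / 64" for i
      using norm_restr_le[of "{b i<..}" "D i"] nD[of i] by (simp add: v_def)
  qed (use m nw b in auto)
  also have "\<dots> = 65 / 64 * (13 / 8)" using m(1) by (simp add: r_def)
  finally have 1: "norm (w 0 + (1 / real r) *\<^sub>R (\<Sum>i<r. v i)) \<le> 65 / 64 * (13 / 8)" .
  have "norm (\<Sum>i<r. D i - v i) \<le> real r * (1 / 128)"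
    using sum_norm_le[of "{..<r}" "\<lambda>i. D i - v i" "\<lambda>_. 1 / 128"] Dv by simp
  then have 2: "norm ((1 / real r) *\<^sub>R (\<Sum>i<r. D i - v i)) \<le> 1 / 128"
    using r by (simp add: field_simps)
  have "l1_test r s w = (1 / 2) *\<^sub>R ((w 0 + (1 / real r) *\<^sub>R (\<Sum>i<r. v i)) +
      (1 / real r) *\<^sub>R (\<Sum>i<r. D i - v i))"
    unfolding l1_test_def s D_def[symmetric] by (simp add: sum_subtractf algebra_simps)
  with 1 2 norm_triangle_ineq[of "w 0 + (1 / real r) *\<^sub>R (\<Sum>i<r. v i)" "(1 / real r) *\<^sub>R (\<Sum>i<r. D i - v i)"]
  have "norm (l1_test r s w) \<le> 1 / 2 * (65 / 64 * (13 / 8) + 1 / 128)" by simp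
  moreover have "l1_test r s (\<lambda>i. to_completion (w i)) = to_completion (l1_test r s w)"
    by (simp add: l1_test_def linear_add[OF linear_to_completion] linear_scale[OF linear_to_completion]
        linear_sum[OF linear_to_completion] linear_diff[OF linear_to_completion])
  moreover have "norm (l1_test r s z - l1_test r s (\<lambda>i. to_completion (w i))) \<le> 1 / 64"
    using w r by (intro norm_l1_test_diff_le) (auto intro: less_imp_le)
  ultimately have "norm (l1_test r s z) < 1"
    using norm_triangle_sub[of "l1_test r s z" "l1_test r s (\<lambda>i. to_completion (w i))"]
    by (simp add: norm_to_completion)
  with r mono_s show ?thesis by blast
qed

section \<open>Linear combinations as terms\<close>

definition comb_trm :: "rat \<Rightarrow> rat \<Rightarrow> (banach_fun + 'f) trm \<Rightarrow> (banach_fun + 'f) trm \<Rightarrow> (banach_fun + 'f) trm" where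
  "comb_trm r s t u = Fn (Inl (Comb r s)) [t, u]"

text \<open>The language offers only combinations that preserve the unit ball, so a mean is built as
  a running average with weights k/(k+1) and 1/(k+1).\<close>

primrec average_trm :: "(nat \<Rightarrow> (banach_fun + 'f) trm) \<Rightarrow> nat \<Rightarrow> (banach_fun + 'f) trm" where
  "average_trm f 0 = Fn (Inl Zero) []"
| "average_trm f (Suc k) =
     comb_trm (of_nat k / of_nat (Suc k)) (1 / of_nat (Suc k)) (average_trm f k) (f k)"

definition l1_test_trm :: "nat \<Rightarrow> (nat \<Rightarrow> nat) \<Rightarrow> (banach_fun + 'f) trm" where
  "l1_test_trm r s = comb_trm (1 / 2) (1 / 2) (Var (s 0))
     (average_trm (\<lambda>i. comb_trm (1 / 2) (- 1 / 2) (Var (s (2 * i + 1))) (Var (s (2 * i + 2)))) r)"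

definition l1_test_fm :: "nat \<Rightarrow> (nat \<Rightarrow> nat) \<Rightarrow> (banach_fun + 'f, banach_pred + 'p) fm" where
  "l1_test_fm r s = Pred (Inl Norm) [l1_test_trm r s]"

lemma wf_comb_trm:
  assumes "extends_banach_language L" "\<bar>r\<bar> + \<bar>s\<bar> \<le> 1" "wf_trm L t" "wf_trm L u"
  shows "wf_trm L (comb_trm r s t u)"
proof -
  have "Comb r s \<in> banach_funs" using assms(2) by (auto simp: banach_funs_def)
  with assms show ?thesis by (simp add: comb_trm_def extends_banach_language_def)
qed

lemma average_weights: "\<bar>of_nat k / of_nat (Suc k)\<bar> + \<bar>1 / of_nat (Suc k)\<bar> \<le> (1 :: rat)"
  by (simp add: add_divide_distrib[symmetric] del: of_nat_Suc)

lemma wf_average_trm: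
  assumes "extends_banach_language L" "\<And>i. wf_trm L (f i)"
  shows "wf_trm L (average_trm f k)"
proof (induction k)
  case 0
  have "Zero \<in> banach_funs" by (simp add: banach_funs_def)
  then show ?case using assms(1) by (simp add: extends_banach_language_def)
next
  case (Suc k)
  then show ?case
    unfolding average_trm.simps by (intro wf_comb_trm assms average_weights)
qed

lemma wf_l1_test:
  assumes "extends_banach_language L"
  shows "wf_trm L (l1_test_trm r s)" "wf_fm L (l1_test_fm r s)"
proof -
  show "wf_trm L (l1_test_trm r s)"
    unfolding l1_test_trm_def by (intro wf_comb_trm wf_average_trm assms) auto
  then show "wf_fm L (l1_test_fm r s)"
    using assms by (simp add: l1_test_fm_def extends_banach_language_def)
qed

locale unit_ball = language_structure L M
  for L :: "(banach_fun + 'f, banach_pred + 'p) metric_language"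
    and M :: "('a::banach, banach_fun + 'f, banach_pred + 'p) metric_structure" +
  assumes extends: "extends_banach_language L" and expands: "expands_unit_ball M"
begin

lemma Univ_unit_ball: "Univ M = cball 0 1"
  using expands by (simp add: expands_unit_ball_def)

lemma comb_trm_val:
  assumes "\<bar>r\<bar> + \<bar>s\<bar> \<le> 1" "wf_trm L t" "wf_trm L u" "range e \<subseteq> Univ M"
  shows "trm_val M e (comb_trm r s t u) = of_rat r *\<^sub>R trm_val M e t + of_rat s *\<^sub>R trm_val M e u"
  using expands assms trm_val_in_Univ by (simp add: comb_trm_def expands_unit_ball_def)

lemma average_trm_val:
  assumes "\<And>i. wf_trm L (f i)" "range e \<subseteq> Univ M"
  shows "trm_val M e (average_trm f k) = (1 / real k) *\<^sub>R (\<Sum>i<k. trm_val M e (f i))"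
proof (induction k)
  case 0
  then show ?case using expands by (simp add: expands_unit_ball_def)
next
  case (Suc k)
  have "trm_val M e (average_trm f (Suc k)) = of_rat (of_nat k / of_nat (Suc k)) *\<^sub>R trm_val M e (average_trm f k) +
    of_rat (1 / of_nat (Suc k)) *\<^sub>R trm_val M e (f k)"
    unfolding average_trm.simps
    by (intro comb_trm_val average_weights wf_average_trm extends assms)
  also have "\<dots> = (real k / real (Suc k)) *\<^sub>R ((1 / real k) *\<^sub>R (\<Sum>i<k. trm_val M e (f i))) + (1 / real (Suc k)) *\<^sub>R trm_val M e (f k)"
    unfolding Suc by (simp add: of_rat_divide del: of_nat_Suc)
  also have "\<dots> = (1 / real (Suc k)) *\<^sub>R (\<Sum>i<Suc k. trm_val M e (f i))"
    by (cases "k = 0") (simp_all add: scaleR_add_right del: of_nat_Suc)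
  finally show ?case .
qed

lemma l1_test_fm_val:
  assumes "range e \<subseteq> Univ M"
  shows "fm_val M (l1_test_fm r s) e = norm (l1_test r s e)"
proof -
  let ?f = "\<lambda>i. comb_trm (1 / 2) (- 1 / 2) (Var (s (2 * i + 1))) (Var (s (2 * i + 2))) :: (banach_fun + 'f) trm"
  have wf: "wf_trm L (?f i)" for i by (intro wf_comb_trm extends) auto
  have half: "of_rat (1 / 2) = (1 / 2 :: real)" "of_rat (- 1 / 2) = (- 1 / 2 :: real)"
    by (simp_all add: of_rat_divide of_rat_minus)
  have f: "trm_val M e (?f i) = (1 / 2) *\<^sub>R (e (s (2 * i + 1)) - e (s (2 * i + 2)))" for i
    by (subst comb_trm_val) (use assms in \<open>simp_all add: half of_rat_minus scaleR_diff_right\<close>)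
  have "trm_val M e (l1_test_trm r s) =
      of_rat (1 / 2) *\<^sub>R trm_val M e (Var (s 0)) + of_rat (1 / 2) *\<^sub>R trm_val M e (average_trm ?f r)"
    unfolding l1_test_trm_def by (rule comb_trm_val) (use assms wf_average_trm[OF extends wf] in auto)
  then have "trm_val M e (l1_test_trm r s) = l1_test r s e"
    by (simp only: average_trm_val[OF wf assms] f half trm_val.simps l1_test_def)
  moreover have "trm_val M e (l1_test_trm r s) \<in> Univ M"
    by (rule trm_val_in_Univ[OF wf_l1_test(1)[OF extends] assms])
  ultimately show ?thesis
    using expands by (simp add: l1_test_fm_def expands_unit_ball_def)
qed

end

section \<open>Isomorphisms and elementary substructures\<close>

lemma isomorphism_trm_val:
  assumes "language_structure L M"
    and h: "\<forall>f\<in>Funs L. \<forall>xs\<in>tuples (Univ M) (Fun_arity L f).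
        h (Fun_interp M f xs) = Fun_interp N f (map h xs)"
    and "wf_trm L t" "range e \<subseteq> Univ M"
  shows "h (trm_val M e t) = trm_val N (h \<circ> e) t"
  using assms(3)
proof (induction t)
  case (Fn f ts)
  have "map (trm_val M e) ts \<in> tuples (Univ M) (Fun_arity L f)"
    using Fn.prems by (intro language_structure.trm_vals_in_tuples[OF assms(1)] assms(4)) auto
  with h Fn.prems have "h (trm_val M e (Fn f ts)) = Fun_interp N f (map h (map (trm_val M e) ts))"
    by simp
  also have "map h (map (trm_val M e) ts) = map (trm_val N (h \<circ> e)) ts"
    unfolding map_map
  proof (rule map_cong[OF refl], subst o_apply)
    fix t assume "t \<in> set ts"
    with Fn.prems show "h (trm_val M e t) = trm_val N (h \<circ> e) t"
      by (intro Fn.IH) (simp_all add: list_all_iff)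
  qed
  finally show ?case by (simp only: trm_val.simps)
qed simp

text \<open>Atomic formulas suffice for distinguishing the models, as \<open>l1_test_fm\<close> is
  one.\<close>

lemma isomorphism_Pred:
  assumes M: "language_structure L M"
    and f: "\<forall>f\<in>Funs L. \<forall>xs\<in>tuples (Univ M) (Fun_arity L f).
        h (Fun_interp M f xs) = Fun_interp N f (map h xs)"
    and P: "\<forall>P\<in>Preds L. \<forall>xs\<in>tuples (Univ M) (Pred_arity L P).
        Pred_interp N P (map h xs) = Pred_interp M P xs"
    and "wf_fm L (Pred P ts)" "range e \<subseteq> Univ M"
  shows "fm_val N (Pred P ts) (h \<circ> e) = fm_val M (Pred P ts) e"
proof -
  have "map (trm_val M e) ts \<in> tuples (Univ M) (Pred_arity L P)"
    using assms(4) by (intro language_structure.trm_vals_in_tuples[OF M] assms(5)) auto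
  moreover have "P \<in> Preds L" using assms(4) by simp
  ultimately have "Pred_interp N P (map h (map (trm_val M e) ts)) = fm_val M (Pred P ts) e"
    unfolding fm_val.simps by (intro P[rule_format])
  moreover have "map h (map (trm_val M e) ts) = map (trm_val N (h \<circ> e)) ts"
    unfolding map_map
  proof (rule map_cong[OF refl], subst o_apply)
    fix t assume "t \<in> set ts"
    with assms(4) show "h (trm_val M e t) = trm_val N (h \<circ> e) t"
      by (intro isomorphism_trm_val[OF M f _ assms(5)]) (simp add: list_all_iff)
  qed
  ultimately show ?thesis by (simp only: fm_val.simps)
qed

lemma satisfies_elementary:
  assumes "h ` Univ S \<subseteq> Univ M"
    and "\<forall>\<phi> e. wf_fm L \<phi> \<and> range e \<subseteq> Univ S \<longrightarrow> fm_val M \<phi> (h \<circ> e) = fm_val S \<phi> e"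
    and "wf_fm L \<phi>" "satisfies M \<phi>"
  shows "satisfies S \<phi>"
  unfolding satisfies_def
proof (intro allI impI)
  fix e :: "nat \<Rightarrow> _" assume e: "range e \<subseteq> Univ S"
  then have "range (h \<circ> e) \<subseteq> Univ M" using assms(1) by auto
  then show "fm_val S \<phi> e = 0" using assms(2-4) e unfolding satisfies_def by metis
qed

section \<open>The order property and strong separability\<close>

text \<open>Models of the theory are abstract structures on sets of reals, so the range comes from
  the bounds that the language imposes on the norm predicate.\<close>

lemma norm_sum_in_Icc:
  fixes L :: "(banach_fun + 'f, banach_pred + 'p) metric_language"
  assumes "language_structure L M" "extends_banach_language L" "a \<in> Univ M" "b \<in> Univ M"
  shows "norm_sum M a b \<in> {0..2}"
proof -
  interpret language_structure L M by fact
  let ?\<phi> = "Pred (Inl Norm) [Fn (Inl (Comb (1 / 2) (1 / 2))) [Var 0, Var 1]] :: (banach_fun + 'f, banach_pred + 'p) fm"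
  have wf: "wf_fm L ?\<phi>" using wf_norm_sum_fm[OF assms(2)] by (simp add: norm_sum_fm_def)
  have "range (\<lambda>n :: nat. if n = 0 then a else b) \<subseteq> Univ M" using assms(3,4) by auto
  then have "fm_val M ?\<phi> (\<lambda>n. if n = 0 then a else b) \<in> {0..1}"
    using Pred_bounds[of "Inl Norm" "map (trm_val M (\<lambda>n. if n = 0 then a else b)) [Fn (Inl (Comb (1 / 2) (1 / 2))) [Var 0, Var 1]]"]
      trm_vals_in_tuples[of "[Fn (Inl (Comb (1 / 2) (1 / 2))) [Var 0, Var 1]]" 1 "\<lambda>n. if n = 0 then a else b"] wf assms(2)
    by (simp add: extends_banach_language_def)
  then show ?thesis by (simp add: norm_sum_def norm_sum_fm_def)
qed

text \<open>A dense set has a point within \<epsilon>/2 of each of the types \<open>p c\<close>, and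
  no point can serve two of them, so it is uncountable.\<close>

lemma not_strongly_separable_types_if_separated:
  fixes p :: "real \<Rightarrow> 'a \<Rightarrow> real"
  assumes "Univ M \<noteq> {}" "\<epsilon> > 0" "\<And>c. p c \<in> phi_types M"
    and sep: "\<And>c c'. c < c' \<Longrightarrow> \<epsilon> \<le> phi_dist M (p c) (p c')"
  shows "\<not> strongly_separable_types M"
proof
  interpret Metric_space "phi_types M" "phi_dist M" by (rule Metric_space_phi_types) fact
  assume "strongly_separable_types M"
  then obtain D where D: "countable D" "D \<subseteq> phi_types M" "mtopology closure_of D = phi_types M"
    unfolding strongly_separable_types_def separable_space_def topspace_mtopology by blast
  have "\<exists>d\<in>D. phi_dist M (p c) d < \<epsilon> / 2" for c
  proof -
    have "p c \<in> mtopology closure_of D" using assms(3) D(3) by simp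
    then show ?thesis
      unfolding metric_closure_of using \<open>\<epsilon> > 0\<close> by (force simp: in_mball dest: spec[of _ "\<epsilon> / 2"])
  qed
  then obtain d where d: "\<And>c. d c \<in> D" "\<And>c. phi_dist M (p c) (d c) < \<epsilon> / 2" by metis
  have "d c \<noteq> d c'" if "c < c'" for c c'
  proof
    assume "d c = d c'"
    moreover have "d c \<in> phi_types M" using d(1) D(2) by blast
    ultimately have "phi_dist M (p c) (p c') < \<epsilon>"
      using triangle[of "p c" "d c" "p c'"] assms(3) d(2)[of c] d(2)[of c'] commute[of "d c" "p c'"] by simp
    with sep[OF that] show False by simp
  qed
  then have "inj d" by (intro linorder_injI) auto
  moreover have "countable (range d)" using D(1) d(1) countable_subset[of "range d" D] by auto
  ultimately have "countable (UNIV :: real set)" using countable_image_inj_eq by blast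
  with uncountable_UNIV_real show False by blast
qed

text \<open>Every cut of the rationals given by a real number yields a type.\<close>

lemma not_strongly_separable_types_if_order_property:
  fixes \<alpha> \<beta> :: "rat \<Rightarrow> 'a"
  assumes "Univ M \<noteq> {}" and bounds: "\<And>a b. a \<in> Univ M \<Longrightarrow> b \<in> Univ M \<Longrightarrow> norm_sum M a b \<in> {0..2}"
    and \<alpha>\<beta>: "\<And>q. \<alpha> q \<in> Univ M" "\<And>q. \<beta> q \<in> Univ M" and "l < u"
    and ge: "\<And>q r. r \<le> q \<Longrightarrow> u \<le> norm_sum M (\<alpha> q) (\<beta> r)"
    and le: "\<And>q r. q < r \<Longrightarrow> norm_sum M (\<alpha> q) (\<beta> r) \<le> l"
  shows "\<not> strongly_separable_types M"
proof -
  \<comment> \<open>The approach to \<open>c\<close> is strictly from above: every rational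
    \<open>q \<le> c\<close> lies left of all terms, and every \<open>q > c\<close> eventually lies
    right of them. So \<open>p c\<close> jumps exactly at \<open>c\<close>.\<close>
  have "\<exists>\<rho> :: nat \<Rightarrow> rat. \<forall>n. c < of_rat (\<rho> n) \<and> of_rat (\<rho> n) < c + 1 / real (Suc n)" for c :: real
    by (intro choice allI of_rat_dense) simp
  then obtain \<rho> :: "real \<Rightarrow> nat \<Rightarrow> rat" where \<rho>: "\<And>c n. c < of_rat (\<rho> c n)"
    "\<And>c n. of_rat (\<rho> c n) < c + 1 / real (Suc n)" by metis
  define p where "p c = (\<lambda>a\<in>Univ M. ulim (\<lambda>n. norm_sum M a (\<beta> (\<rho> c n))))" for c
  have lim: "((\<lambda>n. norm_sum M a (\<beta> (\<rho> c n))) \<longlongrightarrow> p c a) ultra" if "a \<in> Univ M" for a c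
  proof -
    have "\<bar>norm_sum M a (\<beta> (\<rho> c n))\<bar> \<le> 2" for n using bounds[OF that \<alpha>\<beta>(2)[of "\<rho> c n"]] by auto
    then show ?thesis unfolding p_def using that by (simp add: tendsto_ulim[of _ 2])
  qed
  have lo: "p c (\<alpha> q) \<le> l" if "of_rat q \<le> c" for c q
  proof (rule ulim_le[OF lim[OF \<alpha>\<beta>(1)]], intro always_eventually allI le)
    fix n
    have "real_of_rat q < of_rat (\<rho> c n)" using \<rho>(1)[of c n] that by linarith
    then show "q < \<rho> c n" by (simp add: of_rat_less)
  qed
  have hi: "u \<le> p c (\<alpha> q)" if "c < of_rat q" for c q
  proof (rule tendsto_lowerbound[OF lim[OF \<alpha>\<beta>(1)] _ ultra(2)])
    have "0 < of_rat q - c" using that by simp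
    then obtain N where N: "1 / real (Suc N) < of_rat q - c"
      by (rule nat_approx_posE)
    show "eventually (\<lambda>n. u \<le> norm_sum M (\<alpha> q) (\<beta> (\<rho> c n))) ultra"
      using eventually_ultra_ge[of N]
    proof eventually_elim
      case (elim n)
      then have "1 / real (Suc n) \<le> 1 / real (Suc N)" by (intro divide_left_mono) auto
      then have "real_of_rat (\<rho> c n) < of_rat q" using N \<rho>(2)[of c n] by linarith
      then show ?case by (intro ge) (simp add: of_rat_less less_imp_le)
    qed
  qed
  have types: "p c \<in> phi_types M" for c
  proof -
    let ?X = "product_topology (\<lambda>_. top_of_set {0..2 :: real}) (Univ M)"
    let ?f = "\<lambda>n. \<lambda>a\<in>Univ M. norm_sum M a (\<beta> (\<rho> c n))"
    have pin: "p c a \<in> {0..2}" if "a \<in> Univ M" for a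
      using tendsto_lowerbound[OF lim[OF that] _ ultra(2), where a = 0]
        tendsto_upperbound[OF lim[OF that] _ ultra(2), where a = 2] bounds[OF that \<alpha>\<beta>(2)] by auto
    have "limitin ?X ?f (p c) ultra"
      unfolding limitin_componentwise
    proof (intro conjI ballI)
      show "p c \<in> extensional (Univ M)" by (simp add: p_def)
      show "eventually (\<lambda>n. ?f n \<in> topspace ?X) ultra"
        using bounds \<alpha>\<beta>(2) by (intro always_eventually) auto
      show "limitin (top_of_set {0..2}) (\<lambda>n. ?f n a) (p c a) ultra" if a: "a \<in> Univ M" for a
        using lim[OF a, of c] pin[OF a] bounds[OF a \<alpha>\<beta>(2)] a
        by (auto simp: limitin_subtopology)
    qed
    then show ?thesis
      unfolding phi_types_def
      by (rule limitin_closedin[OF _ closedin_closure_of _ ultra(2)])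
        (use \<alpha>\<beta>(2) bounds in \<open>auto intro!: always_eventually closure_of_subset[THEN subsetD]\<close>)
  qed
  show ?thesis
  proof (rule not_strongly_separable_types_if_separated[OF assms(1) _ types])
    show "0 < u - l" using \<open>l < u\<close> by simp
    fix c c' :: real assume "c < c'"
    then obtain q where q: "c < of_rat q" "real_of_rat q < c'" using of_rat_dense by blast
    have "u - l \<le> \<bar>p c (\<alpha> q) - p c' (\<alpha> q)\<bar>" using hi[OF q(1)] lo[of q c'] q(2) by linarith
    also have "\<dots> \<le> (SUP a\<in>Univ M. \<bar>p c a - p c' a\<bar>)"
    proof (rule cSUP_upper[OF \<alpha>\<beta>(1) bdd_aboveI2[of _ _ 2]])
      fix a assume "a \<in> Univ M"
      then have "p c a \<in> {0..2}" "p c' a \<in> {0..2}"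
        using types[of c] types[of c'] phi_types_PiE[of M] by (auto simp: PiE_def Pi_def)
      then show "\<bar>p c a - p c' a\<bar> \<le> 2" by auto
    qed
    also have "\<dots> = phi_dist M (p c) (p c')" using types by (simp add: phi_dist_def)
    finally show "u - l \<le> phi_dist M (p c) (p c')" .
  qed
qed

text \<open>The rationals do not embed into the naturals in an order-preserving way, but any finite
  part does. The rank among the first \<open>n\<close> rationals is always weakly monotone, and it
  tells \<open>q\<close> from larger rationals once \<open>n\<close> exceeds the code of
  \<open>q\<close>, hence for almost all \<open>n\<close>.\<close>

definition rat_rank :: "nat \<Rightarrow> rat \<Rightarrow> nat" where
  "rat_rank n q = card {s. to_nat s < n \<and> s < q}"

lemma finite_rat_initial: "finite {s :: rat. to_nat s < n}"
  by (rule finite_imageD[of to_nat]) (auto intro: finite_subset[of _ "{..<n}"] inj_on_subset[OF inj_to_nat])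

lemma rat_rank_le: "rat_rank n q \<le> n"
proof -
  have "rat_rank n q = card (to_nat ` {s. to_nat s < n \<and> s < q})"
    unfolding rat_rank_def by (intro card_image[symmetric] inj_on_subset[OF inj_to_nat]) auto
  also have "\<dots> \<le> card {..<n}" by (intro card_mono) auto
  finally show ?thesis by simp
qed

lemma rat_rank_mono: "q \<le> r \<Longrightarrow> rat_rank n q \<le> rat_rank n r"
  unfolding rat_rank_def by (intro card_mono finite_subset[OF _ finite_rat_initial[of n]]) auto

text \<open>\<open>q\<close> itself is counted for \<open>r\<close> but not for
  \<open>q\<close>.\<close>

lemma rat_rank_less: "q < r \<Longrightarrow> to_nat q < n \<Longrightarrow> rat_rank n q < rat_rank n r"
  unfolding rat_rank_def by (intro psubset_card_mono finite_subset[OF _ finite_rat_initial[of n]]) auto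

text \<open>
  Among the first \<open>n\<close> rationals the ranks interleave the positions of the basis vectors with the
  lengths of the blocks, at ratio 4.
\<close>

definition order_left :: "rat \<Rightarrow> nat \<Rightarrow> c00" where
  "order_left q n = basis (4 ^ (2 * rat_rank n q + 2))"

definition order_right :: "rat \<Rightarrow> nat \<Rightarrow> c00" where
  "order_right q n = block (4 ^ (2 * n + 2)) (4 ^ (2 * rat_rank n q + 1))"

lemma norm_order_le: "norm (order_left q n) \<le> 1" "norm (order_right q n) \<le> 1"
proof -
  show "norm (order_left q n) \<le> 1" unfolding order_left_def by (rule norm_basis_le) simp
  have "(2 :: nat) \<le> 4 ^ 1" by simp
  also have "(4 :: nat) ^ 1 \<le> 4 ^ (2 * rat_rank n q + 1)" by (rule power_increasing) auto
  finally show "norm (order_right q n) \<le> 1" unfolding order_right_def by (rule norm_block_le)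
qed

text \<open>Ranks are at most \<open>n\<close>, so every block starts at or beyond the position of
  every basis vector.\<close>

lemma order_position_le: "(4 :: nat) ^ (2 * rat_rank n q + 2) \<le> 4 ^ (2 * n + 2)"
  using rat_rank_le[of n q] by (intro power_increasing) auto

text \<open>The exponent of the block length is odd and that of the position is even and larger: 2
  rank r + 1 < 2 rank q + 2, so the block is shorter than the position.\<close>

lemma norm_order_ge:
  assumes "r \<le> q"
  shows "3 / 2 \<le> norm (order_left q n + order_right r n)"
  unfolding order_left_def order_right_def
  by (rule norm_basis_add_block_ge[OF _ _ order_position_le])
    (use rat_rank_mono[OF assms, of n] in \<open>auto intro!: power_strict_increasing simp del: power_Suc\<close>)

text \<open>A strict inequality of ranks raises the exponent of the length by 2, from 2 rank q + 1
  to at least 2 rank q + 3, which leaves the ratio 4 to the position.\<close>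

lemma norm_order_le_less:
  assumes "q < r" "to_nat q < n"
  shows "norm (order_left q n + order_right r n) \<le> 5 / 4"
  unfolding order_left_def order_right_def
proof (rule norm_basis_add_block_le[OF _ _ order_position_le])
  have "(4 :: nat) * 4 ^ (2 * rat_rank n q + 2) = 4 ^ (2 * rat_rank n q + 3)" by (simp add: power_add)
  also have "\<dots> \<le> 4 ^ (2 * rat_rank n r + 1)"
    using rat_rank_less[OF assms] by (intro power_increasing) auto
  finally show "(4 :: nat) * 4 ^ (2 * rat_rank n q + 2) \<le> 4 ^ (2 * rat_rank n r + 1)" .
qed simp

section \<open>Both claims for Tsirelson's space\<close>

theorem corollary7p5:
  fixes L :: "(banach_fun + 'f, banach_pred + 'p) metric_language"
    and MT :: "(tsirelson, banach_fun + 'f, banach_pred + 'p) metric_structure"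
  assumes "is_language L" and "countable_language L" and "extends_banach_language L"
    and "is_structure L MT" and "expands_unit_ball MT"
    and "T = complete_theory_of L MT"
  shows "\<not> aleph0_categorical L T \<and>
    (\<exists>M :: (banach_fun + 'f, banach_pred + 'p) small_structure.
       is_model L T M \<and> separable_structure M \<and> \<not> strongly_separable_types M)"
proof -
  interpret unit_ball L MT
    using assms by unfold_locales
  interpret U: language_structure L ultrapower
    using assms(1) is_structure_ultrapower by unfold_locales
  have wfT: "wf_fm L \<phi>" "satisfies MT \<phi>" if "\<phi> \<in> T" for \<phi>
    using that assms(6) by (auto simp: complete_theory_of_def sentences_def)
  have in_useqs: "(\<lambda>n. to_completion (x n)) \<in> useqs" if "\<And>n. norm (x n) \<le> 1" for x :: "nat \<Rightarrow> c00"
    using that by (auto simp: useqs_def Univ_unit_ball norm_to_completion)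
  define y where "y i n = to_completion (basis_pair n i)" for i n
  define a where "a q n = to_completion (order_left q n)" for q n
  define b where "b q n = to_completion (order_right q n)" for q n
  have useqs: "y i \<in> useqs" "a q \<in> useqs" "b q \<in> useqs" for i q
    unfolding y_def a_def b_def by (intro in_useqs norm_basis_pair_le norm_order_le)+
  \<comment> \<open>A single separable model is to contain the l1 sequence and both families of the
    order property.\<close>
  define X where "X = range (\<lambda>i. urep (y i)) \<union> range (\<lambda>q. urep (a q)) \<union> range (\<lambda>q. urep (b q))"
  have X: "countable X" "X \<subseteq> Univ ultrapower"
    using useqs urep_in_Univ by (auto simp: X_def)
  obtain M :: "(banach_fun + 'f, banach_pred + 'p) small_structure" and h where
    M: "is_structure L M" "separable_structure M" and hU: "h ` Univ M \<subseteq> Univ ultrapower"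
    and hX: "X \<subseteq> h ` Univ M"
    and h: "\<forall>\<phi> e. wf_fm L \<phi> \<and> range e \<subseteq> Univ M \<longrightarrow> fm_val ultrapower \<phi> (h \<circ> e) = fm_val M \<phi> e"
    using U.exists_small_elementary_substructure[OF assms(2) X] by blast
  interpret M: language_structure L M
    using assms(1) M(1) by unfold_locales
  have model_M: "is_model L T M"
    unfolding is_model_def
    using M(1) satisfies_elementary[OF hU h] satisfies_ultrapower wfT by blast
  have "\<forall>i. \<exists>x\<in>Univ M. h x = urep (y i)" "\<forall>q. \<exists>x\<in>Univ M. h x = urep (a q)"
    "\<forall>q. \<exists>x\<in>Univ M. h x = urep (b q)"
    using hX unfolding X_def by (metis (no_types, lifting) UnCI image_iff rangeI subsetD)+
  then obtain \<eta> \<alpha> \<beta> where \<eta>: "\<And>i. \<eta> i \<in> Univ M" "\<And>i. h (\<eta> i) = urep (y i)"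
    and \<alpha>: "\<And>q. \<alpha> q \<in> Univ M" "\<And>q. h (\<alpha> q) = urep (a q)"
    and \<beta>: "\<And>q. \<beta> q \<in> Univ M" "\<And>q. h (\<beta> q) = urep (b q)"
    by metis
  have l1_M: "fm_val M (l1_test_fm r s) \<eta> = 1" if "0 < r" "strict_mono s" for r s
  proof -
    have wf: "wf_fm L (l1_test_fm r s)" by (rule wf_l1_test(2)[OF assms(3)])
    have "h \<circ> \<eta> = (\<lambda>i. urep (y i))" by (simp add: fun_eq_iff \<eta>(2))
    then have "fm_val M (l1_test_fm r s) \<eta> = fm_val ultrapower (l1_test_fm r s) (\<lambda>i. urep (y i))"
      using h wf \<eta>(1) by (metis image_subsetI)
    moreover have "((\<lambda>n. fm_val MT (l1_test_fm r s) (\<lambda>i. y i n)) \<longlongrightarrow>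
        fm_val ultrapower (l1_test_fm r s) (\<lambda>i. urep (y i))) ultra"
      by (rule fm_val_ultrapower_urep[OF wf useqs(1)])
    moreover have "((\<lambda>n. fm_val MT (l1_test_fm r s) (\<lambda>i. y i n)) \<longlongrightarrow> 1) ultra"
    proof (rule tendsto_eventually)
      \<comment> \<open>For fixed \<open>r\<close> the value is exactly 1 as soon as the starting
        index \<open>n\<close> leaves room to separate the \<open>4 * r + 2\<close>
        coordinates.\<close>
      show "eventually (\<lambda>n. fm_val MT (l1_test_fm r s) (\<lambda>i. y i n) = 1) ultra"
        using eventually_ultra_ge[of "4 * r + 2"]
      proof eventually_elim
        case (elim n)
        have "range (\<lambda>i. y i n) \<subseteq> Univ MT" using useqsD[OF useqs(1)] by blast
        then have "fm_val MT (l1_test_fm r s) (\<lambda>i. y i n) = norm (l1_test r s (\<lambda>i. y i n))"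
          by (rule l1_test_fm_val)
        also have "l1_test r s (\<lambda>i. y i n) = to_completion (l1_test r s (basis_pair n))"
          unfolding y_def l1_test_def
          by (simp add: linear_add[OF linear_to_completion] linear_scale[OF linear_to_completion]
              linear_sum[OF linear_to_completion] linear_diff[OF linear_to_completion])
        also have "norm \<dots> = 1"
          unfolding norm_to_completion by (rule norm_l1_test_basis_pair[OF that(1) elim that(2)])
        finally show ?case .
      qed
    qed
    ultimately show ?thesis using tendsto_unique[OF ultra(2)] by metis
  qed
  have norm_sum_M: "((\<lambda>n. norm (x n + x' n)) \<longlongrightarrow> norm_sum M \<xi> \<xi>') ultra"
    if "x \<in> useqs" "x' \<in> useqs" "\<xi> \<in> Univ M" "\<xi>' \<in> Univ M" "h \<xi> = urep x" "h \<xi>' = urep x'" for x x' \<xi> \<xi>'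
  proof -
    have wf: "wf_fm L norm_sum_fm" by (rule wf_norm_sum_fm[OF assms(3)])
    let ?e = "\<lambda>i :: nat. if i = 0 then x else x'"
    have "range (\<lambda>n :: nat. if n = 0 then \<xi> else \<xi>') \<subseteq> Univ M" using that by auto
    moreover have "h \<circ> (\<lambda>n :: nat. if n = 0 then \<xi> else \<xi>') = (\<lambda>i. urep (?e i))"
      using that by (auto simp: fun_eq_iff)
    ultimately have "fm_val ultrapower norm_sum_fm (\<lambda>i. urep (?e i)) = norm_sum M \<xi> \<xi>'"
      unfolding norm_sum_def using h wf by metis
    moreover have "((\<lambda>n. fm_val MT norm_sum_fm (\<lambda>i. ?e i n)) \<longlongrightarrow>
        fm_val ultrapower norm_sum_fm (\<lambda>i. urep (?e i))) ultra"
      by (rule fm_val_ultrapower_urep[OF wf]) (use that in simp)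
    moreover have "fm_val MT norm_sum_fm (\<lambda>i. ?e i n) = norm (x n + x' n)" for n
    proof -
      have "(\<lambda>i :: nat. ?e i n) = (\<lambda>i. if i = 0 then x n else x' n)" by auto
      then have "fm_val MT norm_sum_fm (\<lambda>i. ?e i n) = norm_sum MT (x n) (x' n)"
        by (simp only: norm_sum_def)
      then show ?thesis
        using norm_sum_unit_ball[OF expands useqsD[OF that(1)] useqsD[OF that(2)]] by simp
    qed
    ultimately show ?thesis by simp
  qed
  have ab: "norm (a q n + b r n) = norm (order_left q n + order_right r n)" for q r n
    unfolding a_def b_def linear_add[OF linear_to_completion, symmetric] norm_to_completion ..
  have "\<not> strongly_separable_types M"
  proof (rule not_strongly_separable_types_if_order_property[where l = "5 / 4" and u = "3 / 2"])
    show "norm_sum M x x' \<in> {0..2}" if "x \<in> Univ M" "x' \<in> Univ M" for x x'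
      by (rule norm_sum_in_Icc[OF M.language_structure_axioms assms(3) that])
    show "3 / 2 \<le> norm_sum M (\<alpha> q) (\<beta> r)" if "r \<le> q" for q r
      by (rule tendsto_lowerbound[OF norm_sum_M[OF useqs(2,3) \<alpha>(1) \<beta>(1) \<alpha>(2) \<beta>(2)] _ ultra(2)])
        (use norm_order_ge[OF that] in \<open>simp add: ab\<close>)
    show "norm_sum M (\<alpha> q) (\<beta> r) \<le> 5 / 4" if "q < r" for q r
    proof (rule tendsto_upperbound[OF norm_sum_M[OF useqs(2,3) \<alpha>(1) \<beta>(1) \<alpha>(2) \<beta>(2)] _ ultra(2)])
      \<comment> \<open>From index \<open>Suc (to_nat q)\<close> on, \<open>q\<close> is among the
        enumerated rationals and its rank is smaller than that of \<open>r\<close>.\<close>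
      show "eventually (\<lambda>n. norm (a q n + b r n) \<le> 5 / 4) ultra"
        using eventually_ultra_ge[of "Suc (to_nat q)"]
        by eventually_elim (use norm_order_le_less[OF that] in \<open>simp add: ab\<close>)
    qed
  qed (use M.Univ_nonempty \<alpha>(1) \<beta>(1) in auto)
  moreover have "\<not> aleph0_categorical L T"
  proof
    assume categorical: "aleph0_categorical L T"
    \<comment> \<open>The unit ball of Tsirelson's space is represented by a separable elementary
      substructure; its points are sent back by \<open>k\<close>, where the norm estimate is
      available.\<close>
    obtain N :: "(banach_fun + 'f, banach_pred + 'p) small_structure" and k where
      N: "is_structure L N" "separable_structure N" and kU: "k ` Univ N \<subseteq> Univ MT"
      and k: "\<forall>\<phi> e. wf_fm L \<phi> \<and> range e \<subseteq> Univ N \<longrightarrow> fm_val MT \<phi> (k \<circ> e) = fm_val N \<phi> e"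
      using exists_small_elementary_substructure[OF assms(2), of "{}"] by auto
    have "is_model L T N"
      unfolding is_model_def using N(1) satisfies_elementary[OF kU k] wfT by blast
    with categorical model_M M(2) N(2) have "isomorphic_structures L M N"
      unfolding aleph0_categorical_def by blast
    then obtain g where g: "bij_betw g (Univ M) (Univ N)"
      "\<forall>f\<in>Funs L. \<forall>xs\<in>tuples (Univ M) (Fun_arity L f). g (Fun_interp M f xs) = Fun_interp N f (map g xs)"
      "\<forall>P\<in>Preds L. \<forall>xs\<in>tuples (Univ M) (Pred_arity L P). Pred_interp N P (map g xs) = Pred_interp M P xs"
      unfolding isomorphic_structures_def by blast
    \<comment> \<open>Through \<open>g\<close> and \<open>k\<close> the l1 sequence of
      \<open>M\<close> becomes a sequence in the unit ball of Tsirelson's space with the same test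
      values.\<close>
    have gN: "range (g \<circ> \<eta>) \<subseteq> Univ N"
      using bij_betw_apply[OF g(1) \<eta>(1)] by auto
    then have z: "range (k \<circ> (g \<circ> \<eta>)) \<subseteq> Univ MT" using kU by auto
    then have "norm ((k \<circ> (g \<circ> \<eta>)) i) \<le> 1" for i
      unfolding Univ_unit_ball by (metis dist_0_norm mem_cball rangeI subsetD)
    then obtain r s where rs: "0 < r" "strict_mono s" "norm (l1_test r s (k \<circ> (g \<circ> \<eta>))) < 1"
      using norm_l1_test_tsirelson_less by blast
    have wf: "wf_fm L (l1_test_fm r s)" by (rule wf_l1_test(2)[OF assms(3)])
    have "norm (l1_test r s (k \<circ> (g \<circ> \<eta>))) = fm_val N (l1_test_fm r s) (g \<circ> \<eta>)"
      using l1_test_fm_val[OF z] k wf gN by metis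
    also have "\<dots> = fm_val M (l1_test_fm r s) \<eta>"
      using wf \<eta>(1) unfolding l1_test_fm_def
      by (intro isomorphism_Pred[OF M.language_structure_axioms g(2,3)]) auto
    finally show False using rs l1_M[OF rs(1,2)] by simp
  qed
  ultimately show ?thesis using model_M M(2) by blast
qed

end
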